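(* Let $\mathbb O_s$ be the split octonions with a split-quaternion subalgebra $\mathbb H_s$ and a Cayley–Dickson unit $\ell$, $\mathbb O_s=\mathbb H_s\oplus\mathbb H_s\ell$. Let $p$ be a primitive (diagonal) idempotent of the split Albert algebra $J_3(\mathbb O_s)$, with Peirce decomposition $$J_3(\mathbb O_s)=\mathbb Rp\oplus J_{1/2}(p)\oplus J_0(p),\qquad J_0(p)\simeq J_2(\mathbb O_s),$$ which is $\mathbf1\oplus\mathbf{16}\oplus\mathbf{10}$ under $\operatorname{Spin}(5,5)\subset E_{6(6)}$. Then: (1) There is an orthogonal decomposition (for the quadratic norm $N_2$) $J_2(\mathbb O_s)=J_2(\mathbb H_s)\oplus\mathbb H_s\ell$, in which the summands have signatures $(3,3)$ and $(2,2)$; under $\operatorname{Spin}(3,3)\times\operatorname{Spin}(2,2)\simeq SL(4,\mathbb R)\times SL(2,\mathbb R)_+\times SL(2,\mathbb R)_-\subset\operatorname{Spin}(5,5)$, $$\mathbf{10}=(\mathbf6,\mathbf1,\mathbf1)\oplus(\mathbf1,\mathbf2,\mathbf2),\qquad \mathbf{16}=(\mathbf4,\mathbf2,\mathbf1)\oplus(\mathbf4^*,\mathbf1,\mathbf2).$$ (2) Write $X=\lambda_0p+\Psi+A+B$ with $\lambda_0\in\mathbb R$, $\Psi\in J_{1/2}(p)$, $A\in J_2(\mathbb H_s)$, $B\in\mathbb H_s\ell$. With suitable equivariant identifications $\Psi\leftrightarrow(\psi^{a\alpha},\chi_a{}^{\dot\alpha})$, $A\leftrightarrow A_{ab}=-A_{ba}$,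 $B\leftrightarrow B_{\alpha\dot\beta}$ of these representations, the cubic norm has the form $$N_3(X)=\lambda_0\big(q_{3,3}(A)+q_{2,2}(B)\big)+c_1A_{ab}\epsilon_{\alpha\beta}\psi^{a\alpha}\psi^{b\beta}+c_2\widetilde A^{ab}\epsilon_{\dot\alpha\dot\beta}\chi_a{}^{\dot\alpha}\chi_b{}^{\dot\beta}+c_3B_{\alpha\dot\beta}\psi^{a\alpha}\chi_a{}^{\dot\beta}$$ with nonzero real constants $c_1,c_2,c_3$ (depending on normalizations, signs being conventional). In particular the $B$-dependent spinor term is a $\operatorname{Spin}(3,3)$ scalar pairing the two opposite $\operatorname{Spin}(3,3)$ Weyl modules $\mathbf4$ and $\mathbf4^*$.
   Context: $J_3(\mathbb O_s)$ is the 27-dimensional real Jordan algebra of $3\times3$ Hermitian matrices over $\mathbb O_s$ with product $\frac12(XY+YX)$ and cubic norm $N_3$ (the Freudenthal determinant); its norm-preserving group is $E_{6(6)}$. $J_\nu(p)$ is the $\nu$-eigenspace of $X\mapsto p\circ X$. For $\mathbb K=\mathbb H_s,\mathbb O_s$, $J_2(\mathbb K)$ is the space of $2\times2$ Hermitian matrices $\begin{pmatrix}\alpha&x\\\bar x&\beta\end{pmatrix}$, $\alpha,\beta\in\mathbb R$, $x\in\mathbb K$, with quadratic norm $N_2=\alpha\beta-N(x)$, $N$ the composition norm; $\mathbb H_s\ell\subset J_2(\mathbb O_s)$ denotes the matrices with $\alpha=\beta=0$ and $x\in\mathbb H_s\ell$. $q_{3,3}$ and $q_{2,2}$ are the restrictions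 of $N_2$ to $J_2(\mathbb H_s)$ and $\mathbb H_s\ell$. Indices $a,b\in\{1,\dots,4\}$ belong to the fundamental of $SL(4,\mathbb R)$ (upper) and its dual (lower), $\alpha,\beta\in\{1,2\}$ to $SL(2,\mathbb R)_+$, $\dot\alpha,\dot\beta\in\{1,2\}$ to $SL(2,\mathbb R)_-$; $\epsilon$ are the invariant antisymmetric tensors and $\widetilde A^{ab}=\frac12\epsilon^{abcd}A_{cd}$; repeated indices are summed. *)

theory Defs
  imports "HOL-Analysis.Analysis"
begin

section \<open>Split quaternions and split octonions\<close>

text \<open>The split quaternions are the real 2 by 2 matrices; conjugation is the adjugate.\<close>

type_synonym quat = "real^2^2"

definition qconj :: "quat \<Rightarrow> quat" where
  "qconj a = trace a *\<^sub>R mat 1 - a"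

text \<open>The pair (a, b) stands for a + b l, where l is the Cayley--Dickson unit.  The parameter
  \<open>\<mu>\<close> is the square of l; both \<open>\<mu> = 1\<close> and \<open>\<mu> = -1\<close> give the split octonions.\<close>

type_synonym oct = "quat \<times> quat"

definition omult :: "real \<Rightarrow> oct \<Rightarrow> oct \<Rightarrow> oct" where
  "omult \<mu> x y =
     (fst x ** fst y + \<mu> *\<^sub>R (qconj (snd y) ** snd x), snd y ** fst x + snd x ** qconj (fst y))"

definition oone :: oct where
  "oone = (mat 1, 0)"

definition oconj :: "oct \<Rightarrow> oct" where
  "oconj x = (qconj (fst x), - snd x)"

definition ore :: "oct \<Rightarrow> real" where
  "ore x = trace (fst x) / 2"

definition onorm2 :: "real \<Rightarrow> oct \<Rightarrow> real" where
  "onorm2 \<mu> x = ore (omult \<mu> x (oconj x))"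

definition Hs :: "oct set" where
  "Hs = {x. snd x = 0}"

definition Hs_l :: "oct set" where
  "Hs_l = {x. fst x = 0}"

lemma trace_2: "trace (A :: real^2^2) = A$1$1 + A$2$2"
  by (simp add: trace_def sum_2)

lemma matrix_mult_2: "((A :: real^2^2) ** (B :: real^2^2)) $ i $ j = A$i$1 * B$1$j + A$i$2 * B$2$j"
  by (simp add: matrix_matrix_mult_def sum_2)

lemma qconj_nth:
  "qconj a $ 1 $ 1 = a$2$2" "qconj a $ 2 $ 2 = a$1$1"
  "qconj a $ 1 $ 2 = - (a$1$2)" "qconj a $ 2 $ 1 = - (a$2$1)"
  by (simp_all add: qconj_def trace_2 mat_def)

lemma oct_eq_iff:
  "(x :: oct) = y \<longleftrightarrow> (\<forall>i j. fst x $ i $ j = fst y $ i $ j) \<and> (\<forall>i j. snd x $ i $ j = snd y $ i $ j)"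
  by (auto simp: prod_eq_iff vec_eq_iff)

lemmas oct_coords = oct_eq_iff forall_2 matrix_mult_2 trace_2 qconj_nth
  omult_def oconj_def oone_def ore_def mat_def

lemma omult_oconj: "omult \<mu> x (oconj x) = onorm2 \<mu> x *\<^sub>R oone"
  by (simp add: onorm2_def oct_coords algebra_simps)

lemma onorm2_eq: "onorm2 \<mu> x = det (fst x) - \<mu> * det (snd x)"
  by (simp add: onorm2_def oct_coords det_2 field_simps)

lemma onorm2_omult: "onorm2 \<mu> (omult \<mu> x y) = onorm2 \<mu> x * onorm2 \<mu> y"
  by (simp add: onorm2_eq det_2 omult_def matrix_mult_2 qconj_nth) algebra

lemma oconj_omult: "oconj (omult \<mu> x y) = omult \<mu> (oconj y) (oconj x)"
  by (simp add: oct_coords algebra_simps)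

lemma oconj_oconj [simp]: "oconj (oconj x) = x"
  by (simp add: oct_coords)

lemma oconj_add: "oconj (x + y) = oconj x + oconj y"
  and oconj_diff: "oconj (x - y) = oconj x - oconj y"
  and oconj_uminus: "oconj (- x) = - oconj x"
  and oconj_scaleR: "oconj (c *\<^sub>R x) = c *\<^sub>R oconj x"
  and oconj_0 [simp]: "oconj 0 = 0"
  by (simp_all add: oct_coords algebra_simps)

lemma oconj_sum: "oconj (sum f A) = (\<Sum>k\<in>A. oconj (f k))"
  by (induction A rule: infinite_finite_induct) (simp_all add: oconj_add)

section \<open>Hermitian matrices over the split octonions\<close>

typedef 'n herm = "{X :: oct^'n^'n::finite. \<forall>i j. oconj (X $ i $ j) = X $ j $ i}"
  by (rule exI[of _ 0]) simp

setup_lifting type_definition_herm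

instantiation herm :: (finite) real_vector
begin
lift_definition zero_herm :: "'a herm" is 0 by simp
lift_definition plus_herm :: "'a herm \<Rightarrow> 'a herm \<Rightarrow> 'a herm" is "(+)"
  by (simp add: oconj_add)
lift_definition minus_herm :: "'a herm \<Rightarrow> 'a herm \<Rightarrow> 'a herm" is "(-)"
  by (simp add: oconj_diff)
lift_definition uminus_herm :: "'a herm \<Rightarrow> 'a herm" is uminus
  by (simp add: oconj_uminus)
lift_definition scaleR_herm :: "real \<Rightarrow> 'a herm \<Rightarrow> 'a herm" is "(*\<^sub>R)"
  by (simp add: oconj_scaleR)
instance
  by standard (transfer; simp add: algebra_simps)+
end

lift_definition entry :: "'n::finite herm \<Rightarrow> 'n \<Rightarrow> 'n \<Rightarrow> oct" is "\<lambda>X i j. X $ i $ j" .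

lift_definition jordan :: "real \<Rightarrow> 'n::finite herm \<Rightarrow> 'n herm \<Rightarrow> 'n herm" is
  "\<lambda>\<mu> X Y. \<chi> i j. (1/2) *\<^sub>R (\<Sum>k\<in>UNIV. omult \<mu> (X$i$k) (Y$k$j) + omult \<mu> (Y$i$k) (X$k$j))"
  by (simp add: oconj_scaleR oconj_sum oconj_add oconj_omult add.commute)

text \<open>The Freudenthal determinant of the matrix with real diagonal entries \<open>\<alpha>\<^sub>i\<close> and
  \<open>x\<^sub>1 = X\<^sub>2\<^sub>3\<close>, \<open>x\<^sub>2 = X\<^sub>3\<^sub>1\<close>, \<open>x\<^sub>3 = X\<^sub>1\<^sub>2\<close>.\<close>

definition N3 :: "real \<Rightarrow> 3 herm \<Rightarrow> real" where
  "N3 \<mu> X =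
     ore (entry X 1 1) * ore (entry X 2 2) * ore (entry X 3 3)
     - ore (entry X 1 1) * onorm2 \<mu> (entry X 2 3)
     - ore (entry X 2 2) * onorm2 \<mu> (entry X 3 1)
     - ore (entry X 3 3) * onorm2 \<mu> (entry X 1 2)
     + 2 * ore (omult \<mu> (omult \<mu> (entry X 1 2) (entry X 2 3)) (entry X 3 1))"

definition N2 :: "real \<Rightarrow> 2 herm \<Rightarrow> real" where
  "N2 \<mu> Y = ore (entry Y 1 1) * ore (entry Y 2 2) - onorm2 \<mu> (entry Y 1 2)"

definition E66 :: "real \<Rightarrow> (3 herm \<Rightarrow> 3 herm) set" where
  "E66 \<mu> = {g. linear g \<and> bij g \<and> (\<forall>X. N3 \<mu> (g X) = N3 \<mu> X)}"

definition primitive_idempotent :: "real \<Rightarrow> 'n::finite herm \<Rightarrow> bool" where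
  "primitive_idempotent \<mu> p \<longleftrightarrow> p \<noteq> 0 \<and> jordan \<mu> p p = p \<and>
     \<not> (\<exists>e f. e \<noteq> 0 \<and> f \<noteq> 0 \<and> jordan \<mu> e e = e \<and> jordan \<mu> f f = f \<and> jordan \<mu> e f = 0 \<and> p = e + f)"

definition diagonal :: "'n::finite herm \<Rightarrow> bool" where
  "diagonal p \<longleftrightarrow> (\<forall>i j. i \<noteq> j \<longrightarrow> entry p i j = 0)"

lift_definition diag_unit :: "'n::finite \<Rightarrow> 'n herm" is
  "\<lambda>i. \<chi> j k. if j = i \<and> k = i then oone else 0"
  by (simp add: oct_coords)

definition peirce :: "real \<Rightarrow> real \<Rightarrow> 'n::finite herm \<Rightarrow> 'n herm set" where
  "peirce \<mu> \<nu> p = {X. jordan \<mu> p X = \<nu> *\<^sub>R X}"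

text \<open>The 2 by 2 matrix placed in the rows and columns \<open>i + 1\<close>, \<open>i + 2\<close> (modulo 3), in this
  order, that is, in those different from \<open>i\<close>.\<close>

lift_definition block :: "3 \<Rightarrow> 2 herm \<Rightarrow> 3 herm" is
  "\<lambda>i Y. \<chi> j k. if j = i \<or> k = i then 0
      else Y $ (if j = i + 1 then 1 else 2) $ (if k = i + 1 then 1 else 2)"
  by (auto simp del: split_paired_All)

definition J2_Hs :: "2 herm set" where
  "J2_Hs = {Y. \<forall>i j. entry Y i j \<in> Hs}"

definition J2_Hs_l :: "2 herm set" where
  "J2_Hs_l = {Y. entry Y 1 1 = 0 \<and> entry Y 2 2 = 0 \<and> entry Y 1 2 \<in> Hs_l}"

definition polar :: "('v::real_vector \<Rightarrow> real) \<Rightarrow> 'v \<Rightarrow> 'v \<Rightarrow> real" where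
  "polar q x y = q (x + y) - q x - q y"

definition has_signature :: "('v::real_vector \<Rightarrow> real) \<Rightarrow> 'v set \<Rightarrow> nat \<Rightarrow> nat \<Rightarrow> bool" where
  "has_signature q V r s \<longleftrightarrow> (\<exists>b :: nat \<Rightarrow> 'v. V = span (b ` {..<r + s}) \<and>
     (\<forall>c. q (\<Sum>i<r + s. c i *\<^sub>R b i) = (\<Sum>i<r. (c i)\<^sup>2) - (\<Sum>i\<in>{r..<r + s}. (c i)\<^sup>2)))"

section \<open>Clifford algebras and spin groups\<close>

text \<open>The Clifford algebra of the form \<open>\<Sum>i. \<eta> i * (v$i)\<^sup>2\<close> on \<open>real^'n\<close>, with basis the ordered
  products of the generators, indexed by the subsets of the index type.  In
  \<open>e\<^sub>A e\<^sub>B = cl_sign \<eta> A B e\<^sub>C\<close>, with C the symmetric difference, one sign arises from each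
  transposition needed for sorting and one factor \<open>\<eta> i\<close> from each repeated generator.\<close>

type_synonym 'n clifford = "real^('n set)"

definition cl_sign :: "('n::{finite,linorder} \<Rightarrow> real) \<Rightarrow> 'n set \<Rightarrow> 'n set \<Rightarrow> real" where
  "cl_sign \<eta> A B = (-1) ^ card {(i, j). i \<in> A \<and> j \<in> B \<and> j < i} * (\<Prod>i\<in>A \<inter> B. \<eta> i)"

definition cl_mult ::
  "('n::{finite,linorder} \<Rightarrow> real) \<Rightarrow> 'n clifford \<Rightarrow> 'n clifford \<Rightarrow> 'n clifford" where
  "cl_mult \<eta> x y =
     (\<Sum>A\<in>UNIV. \<Sum>B\<in>UNIV. (cl_sign \<eta> A B * x$A * y$B) *\<^sub>R axis (sym_diff A B) 1)"

definition cl_one :: "'n::finite clifford" where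
  "cl_one = axis {} 1"

definition cl_vec :: "real^'n \<Rightarrow> 'n::finite clifford" where
  "cl_vec v = (\<Sum>i\<in>UNIV. v$i *\<^sub>R axis {i} 1)"

text \<open>The anti-automorphism that is the identity on vectors.\<close>

definition cl_rev :: "'n::finite clifford \<Rightarrow> 'n clifford" where
  "cl_rev x = (\<chi> A. (-1) ^ (card A * (card A - 1) div 2) * x$A)"

definition cl_volume :: "'n set \<Rightarrow> 'n::finite clifford" where
  "cl_volume I = axis I 1"

definition vecs :: "'n set \<Rightarrow> (real^'n::finite) set" where
  "vecs I = {v. \<forall>i. i \<notin> I \<longrightarrow> v$i = 0}"

text \<open>The even Clifford algebra of the coordinate subspace \<open>vecs I\<close>.\<close>

definition even_cl :: "'n set \<Rightarrow> 'n::finite clifford set" where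
  "even_cl I = {x. \<forall>A. x$A \<noteq> 0 \<longrightarrow> A \<subseteq> I \<and> even (card A)}"

text \<open>The spin group with trivial spinor norm (the real points of the algebraic spin group),
  for which Spin(3,3) is SL(4).\<close>

definition spin :: "('n::{finite,linorder} \<Rightarrow> real) \<Rightarrow> 'n set \<Rightarrow> 'n clifford set" where
  "spin \<eta> I = {x \<in> even_cl I. cl_mult \<eta> x (cl_rev x) = cl_one \<and>
     (\<forall>v\<in>vecs I. \<exists>w\<in>vecs I. cl_mult \<eta> (cl_mult \<eta> x (cl_vec v)) (cl_rev x) = cl_vec w)}"

definition spin_vec :: "('n::{finite,linorder} \<Rightarrow> real) \<Rightarrow> 'n clifford \<Rightarrow> (real, 'n) vec \<Rightarrow> (real, 'n) vec" where
  "spin_vec \<eta> x v = (\<chi> i. cl_mult \<eta> (cl_mult \<eta> x (cl_vec v)) (cl_rev x) $ {i})"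

text \<open>A simple module \<open>U\<close> of the even Clifford algebra of \<open>vecs I\<close> on which the volume element acts
  by \<open>\<sigma>\<close>.  For a form of signature (n, n), its restriction to the spin group is a half-spin (Weyl)
  representation; the two opposite ones have opposite \<open>\<sigma>\<close>.\<close>

definition weyl_module ::
  "('n::{finite,linorder} \<Rightarrow> real) \<Rightarrow> 'n set \<Rightarrow> real \<Rightarrow> 'v::real_vector set \<Rightarrow>
    ('n clifford \<Rightarrow> 'v \<Rightarrow> 'v) \<Rightarrow> bool" where
  "weyl_module \<eta> I \<sigma> U R \<longleftrightarrow> subspace U \<and> U \<noteq> {0} \<and>
     (\<forall>x\<in>even_cl I. \<forall>y\<in>even_cl I. \<forall>u\<in>U. \<forall>v\<in>U. \<forall>c.
        R x u \<in> U \<and> R x (u + v) = R x u + R x v \<and> R x (c *\<^sub>R u) = c *\<^sub>R R x u \<and>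
        R (x + y) u = R x u + R y u \<and> R (c *\<^sub>R x) u = c *\<^sub>R R x u \<and>
        R cl_one u = u \<and> R (cl_mult \<eta> x y) u = R x (R y u)) \<and>
     (\<forall>u\<in>U. R (cl_volume I) u = \<sigma> *\<^sub>R u) \<and>
     (\<forall>W. subspace W \<and> W \<subseteq> U \<and> (\<forall>x\<in>even_cl I. \<forall>w\<in>W. R x w \<in> W) \<longrightarrow> W = {0} \<or> W = U)"

text \<open>A diagonal form of signature (5,5) whose restrictions to \<open>vecs I33\<close> and \<open>vecs I22\<close> have
  signatures (3,3) and (2,2).\<close>

definition I33 :: "10 set" where "I33 = {0, 1, 2, 3, 4, 5}"

definition I22 :: "10 set" where "I22 = {6, 7, 8, 9}"

definition eta :: "10 \<Rightarrow> real" where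
  "eta i = (if i \<in> {0, 1, 2, 6, 7} then 1 else -1)"

abbreviation Spin55 :: "10 clifford set" where "Spin55 \<equiv> spin eta UNIV"

abbreviation Spin33 :: "10 clifford set" where "Spin33 \<equiv> spin eta I33"

abbreviation Spin22 :: "10 clifford set" where "Spin22 \<equiv> spin eta I22"

abbreviation spin_mult :: "10 clifford \<Rightarrow> 10 clifford \<Rightarrow> 10 clifford" (infixl "\<star>" 70)
  where "x \<star> y \<equiv> cl_mult eta x y"

section \<open>Tensor notation\<close>

definition SL :: "(real^'n^'n::finite) set" where
  "SL = {g. det g = 1}"

definition antisym_mats :: "(real^4^4) set" where
  "antisym_mats = {A. transpose A = - A}"

definition eps2 :: "2 \<Rightarrow> 2 \<Rightarrow> real" where
  "eps2 \<alpha> \<beta> = det (vector [axis \<alpha> 1, axis \<beta> 1] :: real^2^2)"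

definition eps4 :: "4 \<Rightarrow> 4 \<Rightarrow> 4 \<Rightarrow> 4 \<Rightarrow> real" where
  "eps4 a b c d = det (vector [axis a 1, axis b 1, axis c 1, axis d 1] :: real^4^4)"

definition dual_form :: "real^4^4 \<Rightarrow> real^4^4" where
  "dual_form A = (\<chi> a b. (1/2) * (\<Sum>c\<in>UNIV. \<Sum>d\<in>UNIV. eps4 a b c d * A$c$d))"

text \<open>In \<open>\<psi>$a$\<alpha>\<close> the index a is upper, in the second spinor \<open>\<xi>$a$\<alpha>\<close> it is lower; the SL(2) indices are upper.\<close>

definition A_psi_psi :: "real^4^4 \<Rightarrow> real^2^4 \<Rightarrow> real" where
  "A_psi_psi A \<psi> = (\<Sum>a\<in>UNIV. \<Sum>b\<in>UNIV. \<Sum>\<alpha>\<in>UNIV. \<Sum>\<beta>\<in>UNIV. A$a$b * eps2 \<alpha> \<beta> * \<psi>$a$\<alpha> * \<psi>$b$\<beta>)"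

definition A_chi_chi :: "real^4^4 \<Rightarrow> real^2^4 \<Rightarrow> real" where
  "A_chi_chi A \<xi> =
     (\<Sum>a\<in>UNIV. \<Sum>b\<in>UNIV. \<Sum>\<alpha>\<in>UNIV. \<Sum>\<beta>\<in>UNIV. dual_form A $ a $ b * eps2 \<alpha> \<beta> * \<xi>$a$\<alpha> * \<xi>$b$\<beta>)"

definition B_psi_chi :: "real^2^2 \<Rightarrow> real^2^4 \<Rightarrow> real^2^4 \<Rightarrow> real" where
  "B_psi_chi B \<psi> \<xi> = (\<Sum>a\<in>UNIV. \<Sum>\<alpha>\<in>UNIV. \<Sum>\<beta>\<in>UNIV. B$\<alpha>$\<beta> * \<psi>$a$\<alpha> * \<xi>$a$\<beta>)"

text \<open>The action of the group on an object with a dual (lower) index.\<close>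

abbreviation contragredient :: "real^'n^'n::finite \<Rightarrow> real^'n^'n" where
  "contragredient g \<equiv> transpose (matrix_inv g)"

end

theory Submission
  imports Defs
begin

text \<open>On spinors, the Clifford algebras of signatures (3,3) and (2,2) are full matrix algebras: a vector of
  signature (3,3) is an antisymmetric matrix \<open>A\<close> and acts on \<open>4 \<oplus> 4*\<close> by \<open>A\<close> and minus its dual, whose
  product is the Pfaffian; a vector of signature (2,2) is a 2 by 2 matrix \<open>B\<close> and acts on \<open>2 \<oplus> 2\<close>.
  The representation for (5,5) is their graded tensor product, whose even half is
  \<open>(4,2,1) \<oplus> (4*,1,2)\<close>.  All these representations \<open>\<rho>\<close> are faithful, by taking traces, and hence
  surjective, by counting dimensions, so every question on the spin groups becomes one on block
  matrices: an even \<open>x\<close> of signature (3,3) has \<open>\<rho> x = diag(g, h)\<close>, \<open>x rev(x) = 1\<close> says that \<open>h\<close> is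
  contragredient to \<open>g\<close>, and the vectors are preserved iff \<open>det g = 1\<close>.

  There is a bilinear form \<open>\<beta>\<close> on the spinors for which the adjoint of \<open>\<rho> x\<close>, with \<open>x\<close> even, is
  \<open>\<rho> (rev x)\<close>.  In suitable coordinates the spinor part of the cubic norm is \<open>\<beta>(w, v w) / 2\<close>, so it is
  invariant under \<open>w \<mapsto> s w\<close>, \<open>v \<mapsto> s v rev(s)\<close>.\<close>

section \<open>Matrix representations of Clifford algebras\<close>

text \<open>The Clifford product is given by a table of signs, from which neither its associativity
  nor the effect of \<open>cl_rev\<close> on products is evident. Neither is proved inside the
  Clifford algebra: \<open>rho\<close> turns the table into matrix multiplication, and since it is
  injective, identities are checked among matrices. In the other direction, the isomorphisms with
  the special linear groups are defined as preimages of block diagonal matrices.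

  Two signs shape the constructions. Vectors from the two orthogonal summands must anticommute,
  hence the grading \<open>omega\<close> in front of the (2,2) part of a (5,5) vector. And every
  (5,5) vector must be skew-adjoint for the form on spinors; since the (3,3) form anticommutes with
  \<open>omega\<close>, its (2,2) partner has to make the (2,2) vectors self-adjoint. Signature
  (2,2) on its own needs a skew-adjoint version, so two forms occur there.

  The parameter \<mu> enters whenever two l-components are multiplied, because l squares to \<mu>.
  This is why the second and third constants of the cubic norm contain \<mu> and the first does
  not.\<close>

lemma matrix_add_rdistrib: "(A + B) ** C = A ** C + B ** (C :: real^'k^'m)"
  by (simp add: matrix_matrix_mult_def vec_eq_iff sum.distrib distrib_right)

lemma linear_matrix_mult_left: "linear (\<lambda>A :: real^'m^'n. A ** B)"
  by (rule linearI) (simp_all add: matrix_add_rdistrib scalar_matrix_assoc)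

lemma linear_matrix_mult_right: "linear (\<lambda>B :: real^'k^'m. (A :: real^'m^'n) ** B)"
  by (rule linearI) (simp_all add: matrix_add_ldistrib matrix_scalar_ac scalar_matrix_assoc)

lemmas matrix_mult_sum_left = linear_sum[OF linear_matrix_mult_left]
lemmas matrix_mult_sum_right = linear_sum[OF linear_matrix_mult_right]
lemmas matrix_mult_minus_left = linear_neg[OF linear_matrix_mult_left]
lemmas matrix_mult_minus_right = linear_neg[OF linear_matrix_mult_right]
lemmas matrix_mult_scaleR_left = linear_scale[OF linear_matrix_mult_left]
lemmas matrix_mult_scaleR_right = linear_scale[OF linear_matrix_mult_right]

lemma linear_trace: "linear (trace :: real^'n^'n \<Rightarrow> real)"
  by (rule linearI) (simp_all add: trace_def sum.distrib sum_distrib_left)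

lemma linear_transpose: "linear (transpose :: real^'m^'n \<Rightarrow> real^'n^'m)"
  by (rule linearI) (simp_all add: transpose_def vec_eq_iff)

text \<open>The factor picked up when a single generator \<open>i\<close> is sorted into the ordered
  product over \<open>B\<close>. Splitting \<open>cl_sign\<close> into such factors makes it
  accessible to induction on its first set.\<close>

definition gen_sign :: "('n::{finite,linorder} \<Rightarrow> real) \<Rightarrow> 'n \<Rightarrow> 'n set \<Rightarrow> real" where
  "gen_sign \<eta> i B = (\<Prod>j\<in>B. if j < i then -1 else 1) * (if i \<in> B then \<eta> i else 1)"

text \<open>The number of inversions is a count of pairs, so its sign is a double product over
  \<open>A\<close> and \<open>B\<close>.\<close>

lemma cl_sign_eq_prod: "cl_sign \<eta> A B = (\<Prod>i\<in>A. gen_sign \<eta> i B)"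
proof -
  have "(\<Prod>i\<in>A. \<Prod>j\<in>B. if j < i then -1 else 1 :: real) = (\<Prod>(i, j)\<in>A \<times> B. if j < i then -1 else 1)"
    by (simp add: prod.cartesian_product)
  also have "\<dots> = (\<Prod>x\<in>A \<times> B. if x \<in> {(i, j). j < i} then -1 else 1)"
    by (rule prod.cong) auto
  also have "\<dots> = (-1) ^ card ((A \<times> B) \<inter> {(i, j). j < i})"
    by (simp add: prod.If_cases)
  also have "(A \<times> B) \<inter> {(i, j). j < i} = {(i, j). i \<in> A \<and> j \<in> B \<and> j < i}"
    by auto
  finally have "(\<Prod>i\<in>A. \<Prod>j\<in>B. if j < i then -1 else 1 :: real) =
    (-1) ^ card {(i, j). i \<in> A \<and> j \<in> B \<and> j < i}" .
  moreover have "(\<Prod>i\<in>A. if i \<in> B then \<eta> i else 1) = (\<Prod>i\<in>A \<inter> B. \<eta> i)"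
    by (simp add: prod.inter_restrict)
  ultimately show ?thesis
    by (simp add: cl_sign_def gen_sign_def prod.distrib)
qed

lemma cl_sign_insert: "m \<notin> A \<Longrightarrow> cl_sign \<eta> (insert m A) B = gen_sign \<eta> m B * cl_sign \<eta> A B"
  by (simp add: cl_sign_eq_prod)

lemma cl_sign_empty [simp]: "cl_sign \<eta> {} B = 1"
  by (simp add: cl_sign_eq_prod)

text \<open>All elements in which \<open>B\<close> and the symmetric difference disagree lie in
  \<open>A\<close>, hence above \<open>m\<close>, and contribute neither an inversion nor a
  repetition. This closes the sign recursion in \<open>mon_mult\<close>.\<close>

lemma gen_sign_sym_diff:
  assumes "\<forall>a\<in>A. m < a"
  shows "gen_sign \<eta> m (sym_diff A B) = gen_sign \<eta> m B"
proof -
  have "(\<Prod>j\<in>sym_diff A B. if j < m then -1 else 1 :: real) = (\<Prod>j\<in>B. if j < m then -1 else 1)"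
    using assms by (intro prod.mono_neutral_cong) auto
  then show ?thesis
    using assms by (auto simp: gen_sign_def)
qed

lemma gen_sign_less: "\<forall>b\<in>B. i < b \<Longrightarrow> gen_sign \<eta> i B = 1"
  by (auto simp: gen_sign_def intro!: prod.neutral)

primrec list_prod :: "('i \<Rightarrow> real^'s^'s) \<Rightarrow> 'i list \<Rightarrow> real^'s^'s" where
  "list_prod g [] = mat 1"
| "list_prod g (i # is) = g i ** list_prod g is"

lemma list_prod_append: "list_prod g (xs @ ys) = list_prod g xs ** list_prod g ys"
  by (induction xs) (simp_all add: matrix_mul_assoc)

lemma list_prod_anticommute:
  assumes "\<forall>i\<in>set xs. A ** g i = - (g i ** A)"
  shows "A ** list_prod g xs = (-1) ^ length xs *\<^sub>R (list_prod g xs ** A)"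
  using assms
proof (induction xs)
  case (Cons x xs)
  have "A ** list_prod g (x # xs) = - (g x ** (A ** list_prod g xs))"
    using Cons.prems by (simp add: matrix_mul_assoc matrix_mult_minus_left)
  also have "\<dots> = (-1) ^ length (x # xs) *\<^sub>R (list_prod g (x # xs) ** A)"
    using Cons by (simp add: matrix_mult_scaleR_right matrix_mul_assoc)
  finally show ?case .
qed simp

text \<open>Reversal of k anticommuting factors is made of k (k - 1) / 2 transpositions: in the
  induction the first factor moves past all others. The sign is the one in
  \<open>cl_rev\<close>.\<close>

lemma list_prod_rev:
  assumes "distinct xs" "\<forall>i\<in>set xs. \<forall>j\<in>set xs. i \<noteq> j \<longrightarrow> g i ** g j = - (g j ** g i)"
  shows "list_prod g (rev xs) = (-1) ^ (length xs * (length xs - 1) div 2) *\<^sub>R list_prod g xs"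
  using assms
proof (induction xs)
  case (Cons x xs)
  define k where "k = length xs"
  have k: "length (x # xs) * (length (x # xs) - 1) div 2 = k * (k - 1) div 2 + k"
    by (cases k) (simp_all add: k_def algebra_simps)
  have "g x ** list_prod g xs = (-1) ^ k *\<^sub>R (list_prod g xs ** g x)"
    using Cons.prems unfolding k_def by (intro list_prod_anticommute) auto
  then have flip: "list_prod g xs ** g x = (-1) ^ k *\<^sub>R (g x ** list_prod g xs)"
    by simp
  have IH: "list_prod g (rev xs) = (-1) ^ (k * (k - 1) div 2) *\<^sub>R list_prod g xs"
    unfolding k_def
  proof (rule Cons.IH)
    show "distinct xs"
      using Cons.prems(1) by simp
    show "\<forall>i\<in>set xs. \<forall>j\<in>set xs. i \<noteq> j \<longrightarrow> g i ** g j = - (g j ** g i)"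
      by (intro ballI impI Cons.prems(2)[rule_format]) simp_all
  qed
  have "list_prod g (rev (x # xs)) = (-1) ^ (k * (k - 1) div 2) *\<^sub>R (list_prod g xs ** g x)"
    using IH by (simp add: list_prod_append matrix_mult_scaleR_left)
  also have "\<dots> = (-1) ^ (k * (k - 1) div 2 + k) *\<^sub>R list_prod g (x # xs)"
    unfolding flip by (simp add: power_add)
  finally show ?case
    unfolding k .
qed simp

text \<open>Each generator crosses \<open>C\<close> at the cost of a sign and a transpose, and
  transposing a product reverses it. On products of even length the signs cancel.\<close>

lemma list_prod_adjoint:
  assumes "\<forall>i\<in>set xs. C ** g i = - (transpose (g i) ** C)"
  shows "C ** list_prod g xs = (-1) ^ length xs *\<^sub>R (transpose (list_prod g (rev xs)) ** C)"
  using assms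
proof (induction xs)
  case (Cons x xs)
  have "C ** list_prod g (x # xs) = - (transpose (g x) ** (C ** list_prod g xs))"
    using Cons.prems by (simp add: matrix_mul_assoc matrix_mult_minus_left)
  also have "\<dots> = (-1) ^ length (x # xs) *\<^sub>R (transpose (list_prod g (rev (x # xs))) ** C)"
    using Cons by (simp add: list_prod_append matrix_transpose_mul matrix_mult_scaleR_right matrix_mul_assoc)
  finally show ?case .
qed (simp add: transpose_mat)

text \<open>The Clifford algebra of the subspace \<open>vecs I\<close>, even and odd part together,
  inside the ambient one.\<close>

definition cl_carrier :: "'n set \<Rightarrow> 'n::finite clifford set" where
  "cl_carrier I = {x. \<forall>A. x$A \<noteq> 0 \<longrightarrow> A \<subseteq> I}"

lemma even_cl_subset_carrier: "even_cl I \<subseteq> cl_carrier I"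
  by (auto simp: even_cl_def cl_carrier_def)

lemma subspace_cl_carrier: "subspace (cl_carrier I :: 'n::finite clifford set)"
proof (rule subspaceI)
  fix x y :: "'n clifford"
  assume *: "x \<in> cl_carrier I" "y \<in> cl_carrier I"
  have "A \<subseteq> I" if "(x + y)$A \<noteq> 0" for A
    using * that by (cases "x$A = 0") (auto simp: cl_carrier_def)
  then show "x + y \<in> cl_carrier I"
    by (simp add: cl_carrier_def)
qed (simp_all add: cl_carrier_def)

lemma subspace_even_cl: "subspace (even_cl I :: 'n::finite clifford set)"
proof (rule subspaceI)
  fix x y :: "'n clifford"
  assume *: "x \<in> even_cl I" "y \<in> even_cl I"
  have "A \<subseteq> I \<and> even (card A)" if "(x + y)$A \<noteq> 0" for A
    using * that by (cases "x$A = 0") (auto simp: even_cl_def)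
  then show "x + y \<in> even_cl I"
    by (simp add: even_cl_def)
qed (simp_all add: even_cl_def)

lemma axis_in_even_cl: "A \<subseteq> I \<Longrightarrow> even (card A) \<Longrightarrow> axis A c \<in> even_cl I"
  by (auto simp: even_cl_def axis_def)

lemma card_sym_diff_parity: "even (card (sym_diff A B)) \<longleftrightarrow> even (card A + card (B :: 'n::finite set))"
proof -
  have "card (sym_diff A B) = card (A - B) + card (B - A)"
    by (intro card_Un_disjoint) auto
  moreover have "card A = card (A - B) + card (A \<inter> B)"
    by (subst card_Un_disjoint[symmetric]) (auto intro: arg_cong[of _ _ card])
  moreover have "card B = card (B - A) + card (A \<inter> B)"
    by (subst card_Un_disjoint[symmetric]) (auto intro: arg_cong[of _ _ card])
  ultimately show ?thesis by (auto simp: even_add)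
qed

lemma cl_mult_carrier:
  assumes "x \<in> cl_carrier I" "y \<in> cl_carrier I"
  shows "cl_mult \<eta> x y \<in> cl_carrier I"
  unfolding cl_mult_def
proof (intro subspace_sum[OF subspace_cl_carrier])
  fix A B
  show "(cl_sign \<eta> A B * x$A * y$B) *\<^sub>R axis (sym_diff A B) 1 \<in> cl_carrier I"
    using assms by (cases "x$A = 0 \<or> y$B = 0")
      (auto simp: subspace_0[OF subspace_cl_carrier] cl_carrier_def axis_def)
qed

lemma cl_mult_even:
  assumes "x \<in> even_cl I" "y \<in> even_cl I"
  shows "cl_mult \<eta> x y \<in> even_cl I"
  unfolding cl_mult_def
proof (intro subspace_sum[OF subspace_even_cl])
  fix A B
  show "(cl_sign \<eta> A B * x$A * y$B) *\<^sub>R axis (sym_diff A B) 1 \<in> even_cl I"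
  proof (cases "x$A = 0 \<or> y$B = 0")
    case False
    then have "sym_diff A B \<subseteq> I" "even (card (sym_diff A B))"
      using assms unfolding card_sym_diff_parity by (auto simp: even_cl_def)
    then show ?thesis
      by (intro subspace_scale[OF subspace_even_cl] axis_in_even_cl)
  qed (auto simp: subspace_0[OF subspace_even_cl])
qed

lemma cl_one_even: "cl_one \<in> even_cl I"
  unfolding cl_one_def by (rule axis_in_even_cl) simp_all

lemma cl_rev_even: "x \<in> even_cl I \<Longrightarrow> cl_rev x \<in> even_cl I"
  by (auto simp: even_cl_def cl_rev_def)

lemma linear_cl_vec: "linear cl_vec"
  by (rule linearI) (simp_all add: cl_vec_def scaleR_add_left sum.distrib scaleR_sum_right)

lemma cl_vec_nth: "cl_vec v $ {i} = v $ i"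
proof -
  have "cl_vec v $ {i} = (\<Sum>j\<in>UNIV. if j = i then v$i else 0)"
    unfolding cl_vec_def sum_component by (intro sum.cong) (auto simp: axis_def)
  then show ?thesis by simp
qed

lemma cl_vec_carrier: "v \<in> vecs I \<Longrightarrow> cl_vec v \<in> cl_carrier I"
  unfolding cl_vec_def
proof (intro subspace_sum[OF subspace_cl_carrier])
  fix i assume "v \<in> vecs I"
  then show "v$i *\<^sub>R axis {i} 1 \<in> cl_carrier I"
    by (cases "i \<in> I") (auto simp: vecs_def subspace_0[OF subspace_cl_carrier] cl_carrier_def axis_def)
qed

lemma cl_volume_even: "even (card I) \<Longrightarrow> cl_volume I \<in> even_cl I"
  unfolding cl_volume_def by (rule axis_in_even_cl) simp_all

lemma spin_subset_even: "spin \<eta> I \<subseteq> even_cl I"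
  by (auto simp: spin_def)

lemma subspace_vecs: "subspace (vecs I)"
  by (auto simp: subspace_def vecs_def)

lemma axis_in_vecs: "i \<in> I \<Longrightarrow> axis i c \<in> vecs I"
  by (auto simp: vecs_def axis_def)

lemma vec_eq_sum_axis: "v = (\<Sum>i\<in>UNIV. v$i *\<^sub>R axis i (1::real))"
  using basis_expansion[of v] by (simp add: scalar_mult_eq_scaleR)

text \<open>The assumption \<open>card_index\<close> makes the matrices as large a space as the Clifford algebra of
  \<open>vecs I\<close>; \<open>\<omega>\<close> is the grading of the spinors.\<close>

locale clifford_rep =
  fixes \<eta> :: "'n::{finite,linorder} \<Rightarrow> real" and I :: "'n set"
    and \<gamma> :: "(real, 'n) vec \<Rightarrow> real^'s^'s::finite" and \<omega> :: "real^'s^'s"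
  assumes linear: "linear \<gamma>"
    and square: "v \<in> vecs I \<Longrightarrow> \<gamma> v ** \<gamma> v = (\<Sum>i\<in>I. \<eta> i * (v$i)\<^sup>2) *\<^sub>R mat 1"
    and eta: "i \<in> I \<Longrightarrow> \<eta> i = 1 \<or> \<eta> i = -1"
    and even_card: "even (card I)"
    and card_index: "CARD('s)\<^sup>2 = 2 ^ card I"
    and omega_square: "\<omega> ** \<omega> = mat 1"
    and omega_anti: "\<omega> ** \<gamma> v = - (\<gamma> v ** \<omega>)"
begin

definition gen :: "'n \<Rightarrow> real^'s^'s" where
  "gen i = \<gamma> (axis i 1)"

definition mon :: "'n set \<Rightarrow> real^'s^'s" where
  "mon A = list_prod gen (sorted_list_of_set A)"

definition rho :: "'n clifford \<Rightarrow> real^'s^'s" where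
  "rho x = (\<Sum>A\<in>UNIV. x$A *\<^sub>R mon A)"

lemma gen_square: "i \<in> I \<Longrightarrow> gen i ** gen i = \<eta> i *\<^sub>R mat 1"
proof -
  assume i: "i \<in> I"
  have "(\<Sum>k\<in>I. \<eta> k * (axis i 1 $ k)\<^sup>2) = (\<Sum>k\<in>I. if k = i then \<eta> i else 0)"
    by (intro sum.cong) (auto simp: axis_def)
  also have "\<dots> = \<eta> i"
    using i by simp
  finally show ?thesis
    using square[OF axis_in_vecs[OF i]] by (simp add: gen_def)
qed

text \<open>Polarisation: the square at a sum of two basis vectors is compared with the squares at
  each of them.\<close>

lemma gen_anti:
  assumes "i \<in> I" "j \<in> I" "i \<noteq> j"
  shows "gen i ** gen j = - (gen j ** gen i)"
proof -
  let ?v = "axis i 1 + axis j 1 :: (real, 'n) vec"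
  have v: "?v \<in> vecs I"
    using assms by (auto intro: subspace_add[OF subspace_vecs] axis_in_vecs)
  have "(\<Sum>k\<in>I. \<eta> k * (?v$k)\<^sup>2) = (\<Sum>k\<in>I. (if k = i then \<eta> i else 0) + (if k = j then \<eta> j else 0))"
    using assms by (intro sum.cong) (auto simp: axis_def)
  also have "\<dots> = \<eta> i + \<eta> j"
    using assms by (simp add: sum.distrib)
  finally have "(gen i + gen j) ** (gen i + gen j) = (\<eta> i + \<eta> j) *\<^sub>R mat 1"
    using square[OF v] linear by (simp add: gen_def linear_add)
  then show ?thesis
    using assms by (simp add: matrix_add_ldistrib matrix_add_rdistrib gen_square algebra_simps eq_neg_iff_add_eq_0)
qed

lemma mon_empty [simp]: "mon {} = mat 1"
  by (simp add: mon_def)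

lemma mon_insert: "\<forall>a\<in>A. m < a \<Longrightarrow> mon (insert m A) = gen m ** mon A"
proof -
  assume m: "\<forall>a\<in>A. m < a"
  then have "m \<notin> A" by auto
  moreover have "insort m (sorted_list_of_set A) = m # sorted_list_of_set A"
    using m by (intro insort_is_Cons) auto
  ultimately show ?thesis
    by (simp add: mon_def)
qed

lemma mon_singleton: "mon {i} = gen i"
  using mon_insert[of "{}" i] by simp

text \<open>One step of insertion sort. With \<open>b\<close> the least element of the set, a
  generator below \<open>b\<close> is simply prepended, one equal to \<open>b\<close> cancels
  against it and leaves \<open>\<eta> b\<close>, and one above \<open>b\<close> anticommutes past it
  into the smaller product.\<close>

lemma gen_mon:
  assumes "i \<in> I" "B \<subseteq> I"
  shows "gen i ** mon B = gen_sign \<eta> i B *\<^sub>R mon (sym_diff {i} B)"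
proof -
  have "finite B" by simp
  then show ?thesis
    using assms(2)
  proof (induction B rule: finite_linorder_min_induct)
    case empty
    then show ?case
      by (simp add: gen_sign_less mon_singleton)
  next
    case (insert b B)
    then have b: "b \<in> I" "b \<notin> B" by auto
    consider "i < b" | "i = b" | "b < i" by force
    then show ?case
    proof cases
      case 1
      then have *: "\<forall>a\<in>insert b B. i < a"
        using insert by auto
      have "sym_diff {i} (insert b B) = insert i (insert b B)"
        using * by auto
      then show ?thesis
        using mon_insert[OF *] gen_sign_less[OF *] by simp
    next
      case 2
      have "gen_sign \<eta> i (insert b B) = \<eta> b"
      proof -
        have "(\<Prod>j\<in>insert b B. if j < i then -1 else 1 :: real) = 1"
          using 2 insert by (intro prod.neutral) auto
        then show ?thesis by (simp add: gen_sign_def 2)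
      qed
      moreover have "sym_diff {i} (insert b B) = B"
        using 2 b by auto
      ultimately show ?thesis
        using 2 b insert by (simp add: mon_insert matrix_mul_assoc gen_square matrix_mult_scaleR_left)
    next
      case 3
      have "gen i ** mon (insert b B) = - (gen b ** (gen i ** mon B))"
        using 3 b assms(1) insert.hyps
        by (simp add: mon_insert matrix_mul_assoc gen_anti[of i b] matrix_mult_minus_left
            matrix_mult_minus_right)
      also have "\<dots> = - (gen_sign \<eta> i B *\<^sub>R (gen b ** mon (sym_diff {i} B)))"
        using insert by (simp only: insert_subset simp_thms matrix_mult_scaleR_right)
      also have "gen b ** mon (sym_diff {i} B) = mon (insert b (sym_diff {i} B))"
        using 3 insert by (intro mon_insert[symmetric]) auto
      also have "insert b (sym_diff {i} B) = sym_diff {i} (insert b B)"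
        using 3 b by auto
      also have "- (gen_sign \<eta> i B *\<^sub>R mon (sym_diff {i} (insert b B))) =
        gen_sign \<eta> i (insert b B) *\<^sub>R mon (sym_diff {i} (insert b B))"
        using 3 b by (simp add: gen_sign_def)
      finally show ?thesis .
    qed
  qed
qed

text \<open>The ordered matrix products obey the multiplication table of the Clifford algebra. The
  least elements of \<open>A\<close> are peeled off, each acting through
  \<open>gen_mon\<close>.\<close>

lemma mon_mult:
  assumes "A \<subseteq> I" "B \<subseteq> I"
  shows "mon A ** mon B = cl_sign \<eta> A B *\<^sub>R mon (sym_diff A B)"
proof -
  have "finite A" by simp
  then show ?thesis
    using assms(1)
  proof (induction A rule: finite_linorder_min_induct)
    case (insert m A)
    then have m: "m \<in> I" "m \<notin> A" by auto
    have "mon (insert m A) ** mon B = gen m ** (mon A ** mon B)"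
      using insert by (simp add: mon_insert matrix_mul_assoc[symmetric])
    also have "\<dots> = cl_sign \<eta> A B *\<^sub>R (gen m ** mon (sym_diff A B))"
      using insert by (simp only: insert_subset simp_thms matrix_mult_scaleR_right)
    also have "gen m ** mon (sym_diff A B) =
      gen_sign \<eta> m (sym_diff A B) *\<^sub>R mon (sym_diff {m} (sym_diff A B))"
      using insert assms by (intro gen_mon) auto
    also have "gen_sign \<eta> m (sym_diff A B) = gen_sign \<eta> m B"
      by (rule gen_sign_sym_diff) (use insert in auto)
    also have "sym_diff {m} (sym_diff A B) = sym_diff (insert m A) B"
      using m by auto
    finally show ?case
      using m by (simp add: cl_sign_insert mult.commute)
  qed simp
qed

lemma linear_rho: "linear rho"
  by (rule linearI) (simp_all add: rho_def scaleR_add_left sum.distrib scaleR_sum_right)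

lemma rho_axis: "rho (axis A 1) = mon A"
proof -
  have "rho (axis A 1) = (\<Sum>B\<in>UNIV. if B = A then mon A else 0)"
    unfolding rho_def by (intro sum.cong) (auto simp: axis_def)
  then show ?thesis by simp
qed

lemma rho_one [simp]: "rho cl_one = mat 1"
  by (simp add: cl_one_def rho_axis)

lemma rho_vec: "rho (cl_vec v) = \<gamma> v"
proof -
  have "rho (cl_vec v) = (\<Sum>i\<in>UNIV. v$i *\<^sub>R gen i)"
    by (simp add: cl_vec_def linear_sum[OF linear_rho] linear_scale[OF linear_rho] rho_axis mon_singleton)
  also have "\<dots> = \<gamma> (\<Sum>i\<in>UNIV. v$i *\<^sub>R axis i 1)"
    by (simp add: gen_def linear_sum[OF linear] linear_scale[OF linear])
  finally show ?thesis
    using vec_eq_sum_axis[of v] by simp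
qed

lemma rho_mult:
  assumes "x \<in> cl_carrier I" "y \<in> cl_carrier I"
  shows "rho (cl_mult \<eta> x y) = rho x ** rho y"
proof -
  have "rho x ** rho y = (\<Sum>A\<in>UNIV. \<Sum>B\<in>UNIV. (x$A * y$B) *\<^sub>R (mon A ** mon B))"
    unfolding rho_def
    by (simp only: matrix_mult_sum_left matrix_mult_scaleR_left)
      (simp only: matrix_mult_sum_right matrix_mult_scaleR_right scaleR_sum_right scaleR_scaleR)
  also have "\<dots> = (\<Sum>A\<in>UNIV. \<Sum>B\<in>UNIV. (cl_sign \<eta> A B * x$A * y$B) *\<^sub>R mon (sym_diff A B))"
  proof (intro sum.cong refl)
    fix A B
    show "(x$A * y$B) *\<^sub>R (mon A ** mon B) = (cl_sign \<eta> A B * x$A * y$B) *\<^sub>R mon (sym_diff A B)"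
    proof (cases "x$A = 0 \<or> y$B = 0")
      case False
      then have "A \<subseteq> I" "B \<subseteq> I"
        using assms by (auto simp: cl_carrier_def)
      then show ?thesis by (simp add: mon_mult mult_ac)
    qed auto
  qed
  also have "\<dots> = rho (cl_mult \<eta> x y)"
    by (simp add: cl_mult_def linear_sum[OF linear_rho] linear_scale[OF linear_rho] rho_axis)
  finally show ?thesis ..
qed

end

section \<open>Traces of monomials, faithfulness, and simplicity of the spinor modules\<close>

lemma mat_1_neq_0: "(mat 1 :: real^'n^'n) \<noteq> 0"
  by (simp add: mat_def vec_eq_iff)

text \<open>\<open>X\<close> is invertible and conjugation by it, which preserves traces, sends
  \<open>M\<close> to \<open>- M\<close>.\<close>

lemma trace_zero_of_anticommute:
  fixes X M :: "real^'n^'n"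
  assumes "X ** M = - (M ** X)" "X ** X = c *\<^sub>R mat 1" "c \<noteq> 0"
  shows "trace M = 0"
proof -
  have "c * trace M = trace (M ** (X ** X))"
    by (simp add: assms(2) matrix_mult_scaleR_right linear_scale[OF linear_trace])
  also have "\<dots> = trace (X ** M ** X)"
    by (metis matrix_mul_assoc trace_mul_sym)
  also have "\<dots> = - trace (M ** (X ** X))"
    unfolding assms(1) by (simp add: matrix_mult_minus_left linear_neg[OF linear_trace] matrix_mul_assoc)
  also have "\<dots> = - (c * trace M)"
    by (simp add: assms(2) matrix_mult_scaleR_right linear_scale[OF linear_trace])
  finally show ?thesis
    using assms(3) by simp
qed

text \<open>Carrying the generator \<open>i\<close> from the left to the right of a monomial costs
  one sign for each other generator in it; a factor \<open>\<eta> i\<close> occurs on both sides or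
  on neither.\<close>

lemma cl_sign_singleton_commute:
  "cl_sign \<eta> {i} A = (-1) ^ card (A - {i}) * cl_sign \<eta> A {i}"
proof -
  have A: "cl_sign \<eta> A {i} = (\<Prod>j\<in>A. if i < j then -1 else 1) * (if i \<in> A then \<eta> i else 1)"
    by (simp add: cl_sign_eq_prod gen_sign_def prod.distrib cong: if_cong)
  have "(\<Prod>j\<in>A. if j < i then -1 else 1 :: real) =
    (\<Prod>j\<in>A. (if j \<in> {j. j \<noteq> i} then -1 else 1) * (if i < j then -1 else 1))"
    by (intro prod.cong) auto
  also have "\<dots> = (-1) ^ card (A \<inter> {j. j \<noteq> i}) * (\<Prod>j\<in>A. if i < j then -1 else 1)"
    by (simp only: prod.distrib prod.If_cases finite_code) simp
  also have "A \<inter> {j. j \<noteq> i} = A - {i}" by auto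
  finally show ?thesis
    unfolding A by (simp add: cl_sign_eq_prod gen_sign_def)
qed

lemma dim_cl_carrier: "dim (cl_carrier I :: 'n::finite clifford set) = 2 ^ card I"
proof -
  let ?d = "(\<lambda>A. axis A (1::real)) ` Pow I"
  have "cl_carrier I = {x :: 'n clifford. \<forall>b\<in>Basis. b \<notin> ?d \<longrightarrow> x \<bullet> b = 0}"
    by (fastforce simp: cl_carrier_def Basis_vec_def inner_axis axis_eq_axis)
  also have "dim \<dots> = card ?d"
    by (intro dim_substandard) (auto simp: Basis_vec_def)
  also have "\<dots> = card (Pow I)"
    by (intro card_image inj_onI) (simp add: axis_eq_axis)
  finally show ?thesis by (simp add: card_Pow)
qed

context clifford_rep
begin

lemma cl_sign_self: "A \<subseteq> I \<Longrightarrow> cl_sign \<eta> A A = 1 \<or> cl_sign \<eta> A A = -1"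
proof -
  assume "A \<subseteq> I"
  then have "(\<Prod>i\<in>A. \<eta> i) = 1 \<or> (\<Prod>i\<in>A. \<eta> i) = -1"
  proof (induction A rule: infinite_finite_induct)
    case (insert i A)
    then show ?case using eta[of i] by auto
  qed simp_all
  then show ?thesis
    by (auto simp: cl_sign_def minus_one_power_iff)
qed

lemma gen_mon_commute:
  assumes "i \<in> I" "A \<subseteq> I"
  shows "gen i ** mon A = (-1) ^ card (A - {i}) *\<^sub>R (mon A ** gen i)"
  using mon_mult[of "{i}" A] mon_mult[of A "{i}"] assms
  by (simp add: mon_singleton cl_sign_singleton_commute Un_commute)

lemma omega_mon: "\<omega> ** mon A = (-1) ^ card A *\<^sub>R (mon A ** \<omega>)"
  unfolding mon_def
  using list_prod_anticommute[of "sorted_list_of_set A" \<omega> gen] by (simp add: gen_def omega_anti)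

text \<open>Something invertible anticommutes with every nonempty monomial: one of its own
  generators if the degree is even, because that generator passes an odd number of others, and the
  grading \<open>\<omega>\<close> if the degree is odd.\<close>

lemma trace_mon:
  assumes "A \<subseteq> I" "A \<noteq> {}"
  shows "trace (mon A) = 0"
proof (cases "even (card A)")
  case True
  obtain i where i: "i \<in> A" using assms by auto
  then have "odd (card (A - {i}))"
    using True card_Suc_Diff1[of A i] by (metis even_Suc finite)
  then have "gen i ** mon A = - (mon A ** gen i)"
    using gen_mon_commute[of i A] i assms by auto
  then show ?thesis
    using eta[of i] i assms gen_square[of i]
    by (intro trace_zero_of_anticommute[of "gen i" _ "\<eta> i"]) auto
next
  case False
  then show ?thesis
    using omega_mon[of A] omega_square by (intro trace_zero_of_anticommute[of \<omega> _ 1]) auto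
qed

text \<open>Only the empty monomial has a nonzero trace, so the coefficients of \<open>x\<close> can be read off \<open>rho x\<close>.\<close>

lemma trace_rho_mon:
  assumes "x \<in> cl_carrier I" "A \<subseteq> I"
  shows "trace (rho x ** mon A) = x$A * cl_sign \<eta> A A * CARD('s)"
proof -
  have "trace (rho x ** mon A) = (\<Sum>B\<in>UNIV. x$B * trace (mon B ** mon A))"
    by (simp add: rho_def matrix_mult_sum_left matrix_mult_scaleR_left
        linear_sum[OF linear_trace] linear_scale[OF linear_trace])
  also have "\<dots> = (\<Sum>B\<in>UNIV. if B = A then x$A * cl_sign \<eta> A A * CARD('s) else 0)"
  proof (intro sum.cong refl)
    fix B
    show "x$B * trace (mon B ** mon A) = (if B = A then x$A * cl_sign \<eta> A A * CARD('s) else 0)"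
    proof (cases "x$B = 0")
      case False
      then have B: "B \<subseteq> I"
        using assms by (auto simp: cl_carrier_def)
      have "trace (mon (sym_diff B A)) = (if B = A then CARD('s) else 0)"
        using trace_mon[of "sym_diff B A"] B assms(2) by (auto simp: trace_I)
      then show ?thesis
        using B assms(2) by (simp add: mon_mult linear_scale[OF linear_trace])
    qed auto
  qed
  finally show ?thesis by simp
qed

lemma inj_rho: "inj_on rho (cl_carrier I)"
proof -
  have "x = 0" if x: "x \<in> cl_carrier I" "rho x = 0" for x
  proof -
    have "x$A = 0" for A
    proof (cases "A \<subseteq> I")
      case True
      then have "x$A * cl_sign \<eta> A A * CARD('s) = 0"
        using trace_rho_mon[OF x(1) True] x(2) by (simp add: linear_0[OF linear_trace])
      then show ?thesis
        using cl_sign_self[OF True] by auto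
    qed (use x in \<open>auto simp: cl_carrier_def\<close>)
    then show ?thesis by (simp add: vec_eq_iff)
  qed
  then show ?thesis
    using linear_injective_on_subspace_0[OF linear_rho subspace_cl_carrier] by blast
qed

lemma rho_eq_iff:
  "x \<in> cl_carrier I \<Longrightarrow> y \<in> cl_carrier I \<Longrightarrow> rho x = rho y \<longleftrightarrow> x = y"
  using inj_rho by (auto simp: inj_on_def)

lemma surj_rho: "rho ` cl_carrier I = UNIV"
proof -
  have "dim (rho ` cl_carrier I) = dim (cl_carrier I)"
    by (intro dim_image_eq linear_rho) (use inj_rho subspace_cl_carrier span_eq_iff in metis)
  also have "\<dots> = DIM(real^'s^'s)"
    using card_index by (simp add: dim_cl_carrier power2_eq_square)
  finally have "span (rho ` cl_carrier I) = UNIV"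
    by (subst dim_eq_full[symmetric]) simp
  then show ?thesis
    by (metis linear_rho linear_subspace_image span_eq_iff subspace_cl_carrier)
qed

lemma omega_rho_even:
  assumes "x \<in> even_cl I"
  shows "\<omega> ** rho x = rho x ** \<omega>"
  unfolding rho_def matrix_mult_sum_left matrix_mult_sum_right matrix_mult_scaleR_left matrix_mult_scaleR_right
proof (intro sum.cong refl)
  fix A
  show "x$A *\<^sub>R (\<omega> ** mon A) = x$A *\<^sub>R (mon A ** \<omega>)"
    using assms by (cases "x$A = 0") (auto simp: even_cl_def omega_mon)
qed

text \<open>The odd part of a preimage is sent to a matrix that anticommutes with
  \<open>\<omega>\<close>; here it also commutes, so it vanishes. Thus the even algebra is mapped
  onto all matrices commuting with the grading.\<close>

lemma rho_even_exists:
  assumes "\<omega> ** M = M ** \<omega>"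
  obtains x where "x \<in> even_cl I" "rho x = M"
proof -
  obtain z where z: "z \<in> cl_carrier I" "rho z = M"
    using surj_rho by (metis UNIV_I imageE)
  define x where "x = (\<chi> A. if even (card A) then z$A else 0)"
  define y where "y = (\<chi> A. if odd (card A) then z$A else 0)"
  have x: "x \<in> even_cl I"
    using z(1) by (auto simp: x_def even_cl_def cl_carrier_def split: if_splits)
  have y: "y \<in> cl_carrier I"
    using z(1) by (auto simp: y_def cl_carrier_def split: if_splits)
  have "z = x + y"
    by (simp add: x_def y_def vec_eq_iff)
  then have M: "M = rho x + rho y"
    using z(2) linear_add[OF linear_rho] by metis
  have "\<omega> ** rho y = - (rho y ** \<omega>)"
    unfolding rho_def matrix_mult_sum_left matrix_mult_sum_right matrix_mult_scaleR_left
      matrix_mult_scaleR_right sum_negf[symmetric]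
    by (intro sum.cong) (auto simp: y_def omega_mon)
  moreover have "\<omega> ** rho y = rho y ** \<omega>"
    using assms omega_rho_even[OF x] unfolding M by (simp add: matrix_add_ldistrib matrix_add_rdistrib)
  ultimately have "rho y ** \<omega> = 0"
    by (metis add_eq_0_iff2 eq_neg_iff_add_eq_0 scaleR_2 scaleR_eq_0_iff zero_neq_numeral)
  then have "rho y = 0"
    by (metis omega_square matrix_mul_assoc matrix_mul_rid times0_left)
  then show ?thesis
    using that[OF x] M by simp
qed

text \<open>The grading anticommutes with all generators, as does the volume element. For each
  proper subset \<open>A\<close> of \<open>I\<close> some generator commutes with
  \<open>mon A\<close> (one inside \<open>A\<close> if the degree is odd, one outside if it is
  even), hence anticommutes with \<open>\<omega> ** mon A\<close> and annihilates its trace. Only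
  the coefficient at \<open>I\<close> survives, and squaring shows that it is a sign.\<close>

lemma rho_volume:
  obtains \<sigma> :: real where "\<sigma> \<in> {1, -1}" "rho (cl_volume I) = \<sigma> *\<^sub>R \<omega>"
proof -
  obtain y where y: "y \<in> cl_carrier I" "rho y = \<omega>"
    using surj_rho by (metis UNIV_I imageE)
  have "y$A = 0" if A: "A \<noteq> I" for A
  proof (cases "A \<subseteq> I")
    case True
    obtain i where i: "i \<in> I" "even (card (A - {i}))"
    proof (cases "even (card A)")
      case False
      then obtain i where "i \<in> A" by fastforce
      then show ?thesis
        using that[of i] True False by (auto simp: card_Diff_singleton)
    next
      case even: True
      obtain i where "i \<in> I" "i \<notin> A"
        using A True by auto
      then show ?thesis
        using that[of i] even by simp
    qed
    have "gen i ** (\<omega> ** mon A) = - (\<omega> ** (gen i ** mon A))"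
      using omega_anti[of "axis i 1"] by (simp add: gen_def matrix_mul_assoc matrix_mult_minus_left)
    also have "\<dots> = - ((\<omega> ** mon A) ** gen i)"
      using gen_mon_commute[OF i(1) True] i(2) by (simp add: matrix_mul_assoc)
    finally have "trace (\<omega> ** mon A) = 0"
      using eta[OF i(1)] gen_square[OF i(1)]
      by (intro trace_zero_of_anticommute[of "gen i" _ "\<eta> i"]) auto
    then show ?thesis
      using trace_rho_mon[OF y(1) True] y(2) cl_sign_self[OF True] by auto
  qed (use y in \<open>auto simp: cl_carrier_def\<close>)
  then have "y = y$I *\<^sub>R axis I 1"
    by (simp add: vec_eq_iff axis_def)
  then have omega: "\<omega> = y$I *\<^sub>R mon I"
    using y(2) linear_scale[OF linear_rho] rho_axis by metis
  have "mat 1 = (y$I *\<^sub>R mon I) ** (y$I *\<^sub>R mon I)"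
    using omega_square omega by simp
  also have "\<dots> = ((y$I)\<^sup>2 * cl_sign \<eta> I I) *\<^sub>R mat 1"
    by (simp add: matrix_mult_scaleR_left matrix_mult_scaleR_right mon_mult power2_eq_square)
  finally have "(y$I)\<^sup>2 * cl_sign \<eta> I I = 1"
    by (metis scaleR_one real_vector.scale_right_imp_eq mat_1_neq_0)
  then have "(y$I)\<^sup>2 = 1"
  proof (cases "cl_sign \<eta> I I = 1")
    case False
    then have "cl_sign \<eta> I I = -1"
      using cl_sign_self[of I] by simp
    then have "(y$I)\<^sup>2 = -1"
      using \<open>(y$I)\<^sup>2 * cl_sign \<eta> I I = 1\<close> by simp
    then show ?thesis
      using zero_le_power2[of "y$I"] by linarith
  qed simp
  then have "y$I \<in> {1, -1}"
    by (simp add: power2_eq_1_iff)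
  moreover have "mon I = y$I *\<^sub>R \<omega>"
    using omega \<open>(y$I)\<^sup>2 = 1\<close> by (metis power2_eq_square scaleR_one scaleR_scaleR)
  ultimately show ?thesis
    using that[of "y$I"] by (simp add: cl_volume_def rho_axis)
qed

text \<open>Even elements commute with the grading, so its eigenspaces are submodules. They are
  simple because the even algebra acts by all matrices that commute with the grading. The sign
  \<sigma>, which compares the volume element with the grading, is left undetermined; only the
  opposition of the two eigenvalues matters.\<close>

lemma weyl_module_rho:
  obtains \<sigma> :: real where "\<sigma> \<in> {1, -1}"
    "\<And>\<tau>. \<tau> \<in> {1, -1} \<Longrightarrow> {w. \<omega> *v w = \<tau> *\<^sub>R w} \<noteq> {0} \<Longrightarrow>
      weyl_module \<eta> I (\<sigma> * \<tau>) {w. \<omega> *v w = \<tau> *\<^sub>R w} (\<lambda>x w. rho x *v w)"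
proof -
  obtain \<sigma> :: real where \<sigma>: "\<sigma> \<in> {1, -1}" "rho (cl_volume I) = \<sigma> *\<^sub>R \<omega>"
    by (rule rho_volume)
  have "weyl_module \<eta> I (\<sigma> * \<tau>) {w. \<omega> *v w = \<tau> *\<^sub>R w} (\<lambda>x w. rho x *v w)"
    if \<tau>: "\<tau> \<in> {1, -1}" and nz: "{w. \<omega> *v w = \<tau> *\<^sub>R w} \<noteq> {0}" for \<tau>
    unfolding weyl_module_def
  proof (intro conjI ballI allI impI)
    let ?U = "{w. \<omega> *v w = \<tau> *\<^sub>R w}"
    show "subspace ?U"
      by (auto simp: subspace_def matrix_vector_right_distrib matrix_vector_mult_scaleR scaleR_add_right)
    show "?U \<noteq> {0}" by (rule nz)
    fix x y u v c
    assume x: "x \<in> even_cl I" and y: "y \<in> even_cl I" and u: "u \<in> ?U"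
    have carrier: "x \<in> cl_carrier I" "y \<in> cl_carrier I"
      using x y even_cl_subset_carrier by auto
    have "\<omega> *v (rho x *v u) = rho x *v (\<omega> *v u)"
      using omega_rho_even[OF x] by (simp add: matrix_vector_mul_assoc)
    then show "rho x *v u \<in> ?U"
      using u by (simp add: matrix_vector_mult_scaleR)
    show "rho x *v (u + v) = rho x *v u + rho x *v v" "rho x *v (c *\<^sub>R u) = c *\<^sub>R (rho x *v u)"
      "rho cl_one *v u = u"
      by (simp_all add: matrix_vector_right_distrib matrix_vector_mult_scaleR)
    show "rho (x + y) *v u = rho x *v u + rho y *v u"
      by (simp add: linear_add[OF linear_rho] matrix_vector_mult_add_rdistrib)
    show "rho (c *\<^sub>R x) *v u = c *\<^sub>R (rho x *v u)"
      by (simp add: linear_scale[OF linear_rho] scaleR_matrix_vector_assoc)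
    show "rho (cl_mult \<eta> x y) *v u = rho x *v (rho y *v u)"
      by (simp add: rho_mult carrier matrix_vector_mul_assoc)
  next
    fix u assume "u \<in> {w. \<omega> *v w = \<tau> *\<^sub>R w}"
    then show "rho (cl_volume I) *v u = (\<sigma> * \<tau>) *\<^sub>R u"
      by (simp add: \<sigma>(2) scaleR_matrix_vector_assoc[symmetric])
  next
    fix W
    assume W: "subspace W \<and> W \<subseteq> {w. \<omega> *v w = \<tau> *\<^sub>R w} \<and> (\<forall>x\<in>even_cl I. \<forall>w\<in>W. rho x *v w \<in> W)"
    show "W = {0} \<or> W = {w. \<omega> *v w = \<tau> *\<^sub>R w}"
    proof (cases "W = {0}")
      case False
      moreover have "0 \<in> W"
        using W by (simp add: subspace_0)
      ultimately obtain w where w: "w \<in> W" "w \<noteq> 0"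
        by fast
      have "u \<in> W" if u: "\<omega> *v u = \<tau> *\<^sub>R u" for u
      proof -
        \<comment> \<open>The rank one matrix that sends \<open>w\<close> to
          \<open>u\<close>.\<close>
        define M where "M = (\<chi> i j. u$i * w$j / (w \<bullet> w))"
        have "(M *v w)$i = u$i * (w \<bullet> w) / (w \<bullet> w)" for i
          unfolding M_def matrix_vector_mult_def inner_vec_def[of w w]
          by (simp add: sum_divide_distrib sum_distrib_left mult_ac)
        then have Mw: "M *v w = u"
          using w(2) by (intro vec_eq_iff[THEN iffD2] allI) (simp del: inner_eq_zero_iff add: inner_eq_zero_iff[of w])
        \<comment> \<open>averaging \<open>M\<close> makes it commute with \<open>\<omega>\<close> and still map \<open>w\<close> to \<open>u\<close>\<close>
        define N where "N = (1/2) *\<^sub>R (M + \<omega> ** M ** \<omega>)"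
        have "\<omega> ** N = N ** \<omega>"
          by (simp add: N_def matrix_mult_scaleR_left matrix_mult_scaleR_right matrix_add_ldistrib
              matrix_add_rdistrib matrix_mul_assoc omega_square)
            (simp add: matrix_mul_assoc[symmetric] omega_square add.commute)
        then obtain x where x: "x \<in> even_cl I" "rho x = N"
          by (rule rho_even_exists)
        have "\<omega> *v w = \<tau> *\<^sub>R w"
          using W w by auto
        then have "N *v w = (1/2) *\<^sub>R (u + \<tau> *\<^sub>R (\<omega> *v u))"
          by (simp add: N_def scaleR_matrix_vector_assoc[symmetric] matrix_vector_mult_add_rdistrib
              matrix_vector_mul_assoc[symmetric] matrix_vector_mult_scaleR Mw)
        also have "\<dots> = u"
          using u \<tau> by (auto simp: scaleR_2[symmetric])
        finally show "u \<in> W"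
          using W w(1) x by metis
      qed
      then show ?thesis using W by auto
    qed simp
  qed
  with \<sigma>(1) show ?thesis using that by blast
qed

text \<open>On an even monomial the signs from moving \<open>C\<close> across cancel, and the
  transposed product is the reversed one, whose sign \<open>cl_rev\<close> records. So
  \<open>cl_rev\<close> is the adjoint for the form \<open>C\<close>.\<close>

lemma rho_rev:
  assumes "x \<in> even_cl I" and C: "\<And>v. C ** \<gamma> v = - (transpose (\<gamma> v) ** C)"
  shows "C ** rho x = transpose (rho (cl_rev x)) ** C"
proof -
  have mon: "x$A *\<^sub>R (C ** mon A) = cl_rev x $ A *\<^sub>R (transpose (mon A) ** C)" for A
  proof (cases "x$A = 0")
    case False
    then have A: "A \<subseteq> I" "even (card A)"
      using assms(1) by (auto simp: even_cl_def)
    define k where "k = card A * (card A - 1) div 2"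
    let ?xs = "sorted_list_of_set A"
    have anti: "\<forall>i\<in>set ?xs. \<forall>j\<in>set ?xs. i \<noteq> j \<longrightarrow> gen i ** gen j = - (gen j ** gen i)"
      using A by (intro ballI impI gen_anti) auto
    have "list_prod gen (rev ?xs) = (-1) ^ k *\<^sub>R mon A"
      using list_prod_rev[OF distinct_sorted_list_of_set anti] unfolding k_def mon_def by simp
    moreover have "C ** mon A = transpose (list_prod gen (rev ?xs)) ** C"
      using list_prod_adjoint[of ?xs C gen] A(2) unfolding mon_def by (simp add: gen_def C)
    ultimately show ?thesis
      by (simp add: cl_rev_def k_def linear_scale[OF linear_transpose] matrix_mult_scaleR_left)
  qed (simp add: cl_rev_def)
  show ?thesis
    unfolding rho_def
    by (simp add: matrix_mult_sum_left matrix_mult_sum_right matrix_mult_scaleR_left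
        matrix_mult_scaleR_right linear_sum[OF linear_transpose] linear_scale[OF linear_transpose] mon)
qed

lemma spin_iff:
  assumes "x \<in> even_cl I"
  shows "x \<in> spin \<eta> I \<longleftrightarrow> rho x ** rho (cl_rev x) = mat 1 \<and>
    (\<forall>v\<in>vecs I. \<exists>w\<in>vecs I. rho x ** \<gamma> v ** rho (cl_rev x) = \<gamma> w)"
proof -
  have x: "x \<in> cl_carrier I" "cl_rev x \<in> cl_carrier I"
    using assms cl_rev_even even_cl_subset_carrier by auto
  have "cl_mult \<eta> x (cl_rev x) = cl_one \<longleftrightarrow> rho x ** rho (cl_rev x) = mat 1"
    using rho_eq_iff[of "cl_mult \<eta> x (cl_rev x)" cl_one] x cl_one_even even_cl_subset_carrier
    by (auto simp: cl_mult_carrier rho_mult)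
  moreover have "cl_mult \<eta> (cl_mult \<eta> x (cl_vec v)) (cl_rev x) = cl_vec w \<longleftrightarrow>
    rho x ** \<gamma> v ** rho (cl_rev x) = \<gamma> w" if "v \<in> vecs I" "w \<in> vecs I" for v w
    using rho_eq_iff[of "cl_mult \<eta> (cl_mult \<eta> x (cl_vec v)) (cl_rev x)" "cl_vec w"] x that
    by (simp add: cl_mult_carrier rho_mult cl_vec_carrier rho_vec)
  ultimately show ?thesis
    using assms unfolding spin_def by blast
qed

end

section \<open>Block matrices and Kronecker products\<close>

lemma sum_UNIV_Plus: "(\<Sum>i\<in>(UNIV :: ('a::finite + 'b::finite) set). f i) = (\<Sum>a\<in>UNIV. f (Inl a)) + (\<Sum>b\<in>UNIV. f (Inr b))"
  by (simp only: UNIV_Plus_UNIV[symmetric] sum.Plus finite o_def)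

lemma sum_UNIV_prod: "(\<Sum>i\<in>(UNIV :: ('a::finite \<times> 'b::finite) set). f i) = (\<Sum>a\<in>UNIV. \<Sum>b\<in>UNIV. f (a, b))"
  by (simp only: UNIV_Times_UNIV[symmetric] sum.cartesian_product case_prod_eta)

definition blk :: "real^'c^'a \<Rightarrow> real^'d^'a \<Rightarrow> real^'c^'b \<Rightarrow> real^'d^'b \<Rightarrow> real^('c + 'd)^('a + 'b)" where
  "blk A B C D = (\<chi> i j. case i of
     Inl a \<Rightarrow> (case j of Inl c \<Rightarrow> A$a$c | Inr d \<Rightarrow> B$a$d)
   | Inr b \<Rightarrow> (case j of Inl c \<Rightarrow> C$b$c | Inr d \<Rightarrow> D$b$d))"

definition join :: "real^'a \<Rightarrow> real^'b \<Rightarrow> real^('a + 'b)" where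
  "join u v = (\<chi> i. case i of Inl a \<Rightarrow> u$a | Inr b \<Rightarrow> v$b)"

lemma blk_nth [simp]:
  "blk A B C D $ Inl a $ Inl c = A$a$c" "blk A B C D $ Inl a $ Inr d = B$a$d"
  "blk A B C D $ Inr b $ Inl c = C$b$c" "blk A B C D $ Inr b $ Inr d = D$b$d"
  by (simp_all add: blk_def)

lemma join_nth [simp]: "join u v $ Inl a = u$a" "join u v $ Inr b = v$b"
  by (simp_all add: join_def)

lemma forall_Plus: "(\<forall>i :: 'a + 'b. P i) \<longleftrightarrow> (\<forall>a. P (Inl a)) \<and> (\<forall>b. P (Inr b))"
  by (metis sum.exhaust)

lemmas blk_simps = vec_eq_iff forall_Plus

lemma blk_eq_iff [simp]: "blk A B C D = blk A' B' C' D' \<longleftrightarrow> A = A' \<and> B = B' \<and> C = C' \<and> D = D'"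
  by (simp only: blk_simps blk_nth) metis

lemma join_eq_iff [simp]: "join u v = join u' v' \<longleftrightarrow> u = u' \<and> v = v'"
  by (simp add: blk_simps)

lemma blk_cases: obtains A B C D where "M = blk A B C D"
proof
  show "M = blk (\<chi> a c. M$Inl a$Inl c) (\<chi> a d. M$Inl a$Inr d) (\<chi> b c. M$Inr b$Inl c) (\<chi> b d. M$Inr b$Inr d)"
    by (simp add: blk_simps)
qed

lemma join_cases: obtains u v where "w = join u v"
proof
  show "w = join (\<chi> a. w$Inl a) (\<chi> b. w$Inr b)"
    by (simp add: blk_simps)
qed

lemma blk_mult: "blk A B C D ** blk A' B' C' D' =
    blk (A ** A' + B ** C') (A ** B' + B ** D') (C ** A' + D ** C') (C ** B' + D ** D')"
  by (simp add: blk_simps matrix_matrix_mult_def sum_UNIV_Plus)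

lemma blk_mult_vec: "blk A B C D *v join u v = join (A *v u + B *v v) (C *v u + D *v v)"
  by (simp add: blk_simps matrix_vector_mult_def sum_UNIV_Plus)

lemma blk_add: "blk A B C D + blk A' B' C' D' = blk (A + A') (B + B') (C + C') (D + D')"
  by (simp add: blk_simps)

lemma blk_minus: "- blk A B C D = blk (- A) (- B) (- C) (- D)"
  by (simp add: blk_simps)

lemma blk_scaleR: "c *\<^sub>R blk A B C D = blk (c *\<^sub>R A) (c *\<^sub>R B) (c *\<^sub>R C) (c *\<^sub>R D)"
  by (simp add: blk_simps)

lemma blk_one: "mat 1 = blk (mat 1) 0 0 (mat 1)"
  by (simp add: blk_simps mat_def)

lemma blk_transpose: "transpose (blk A B C D) = blk (transpose A) (transpose C) (transpose B) (transpose D)"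
  by (simp add: blk_simps transpose_def)

lemma blk_inner: "blk A B C D \<bullet> blk A' B' C' D' = A \<bullet> A' + B \<bullet> B' + C \<bullet> C' + D \<bullet> D'"
  by (simp add: inner_vec_def sum_UNIV_Plus sum.distrib)

lemma join_zero: "0 = join 0 0"
  by (simp add: blk_simps)

definition kron :: "real^'c^'a \<Rightarrow> real^'d^'b \<Rightarrow> real^('c \<times> 'd)^('a \<times> 'b)" where
  "kron M N = (\<chi> i j. M $ fst i $ fst j * N $ snd i $ snd j)"

text \<open>Tensors in a product of two spaces, written as matrices: \<open>kron M N\<close> then
  acts by multiplication with \<open>M\<close> on the left and the transpose of \<open>N\<close> on
  the right.\<close>

definition vecm :: "real^'t^'s \<Rightarrow> real^('s \<times> 't)" where
  "vecm W = (\<chi> i. W $ fst i $ snd i)"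

lemma kron_nth [simp]: "kron M N $ (a, b) $ (c, d) = M$a$c * N$b$d"
  by (simp add: kron_def)

lemma vecm_nth [simp]: "vecm W $ (s, t) = W$s$t"
  by (simp add: vecm_def)

lemma linear_vecm: "linear vecm"
  by (rule linearI) (simp_all add: vec_eq_iff)

lemma vecm_eq_iff [simp]: "vecm W = vecm W' \<longleftrightarrow> W = W'"
  by (simp add: vec_eq_iff)

lemma vecm_cases: obtains W where "w = vecm W"
proof
  show "w = vecm (\<chi> s t. w$(s, t))"
    by (simp add: vec_eq_iff)
qed

lemma linear_kron_left: "linear (\<lambda>M. kron M N)"
  and linear_kron_right: "linear (\<lambda>N. kron M N)"
  by (rule linearI; simp add: vec_eq_iff algebra_simps)+

lemmas kron_simps =
  linear_add[OF linear_kron_left] linear_add[OF linear_kron_right]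
  linear_neg[OF linear_kron_left] linear_neg[OF linear_kron_right]
  linear_scale[OF linear_kron_left] linear_scale[OF linear_kron_right]

lemma kron_one: "kron (mat 1) (mat 1) = mat 1"
  by (simp add: vec_eq_iff mat_def)

lemma kron_mult: "kron M N ** kron M' N' = kron (M ** M') (N ** N')"
  by (simp add: vec_eq_iff matrix_matrix_mult_def sum_UNIV_prod sum_product mult_ac)

lemma kron_transpose: "transpose (kron M N) = kron (transpose M) (transpose N)"
  by (simp add: vec_eq_iff transpose_def)

lemma kron_vecm: "kron M N *v vecm W = vecm (M ** W ** transpose N)"
proof -
  have "(\<Sum>c\<in>UNIV. \<Sum>d\<in>UNIV. M$a$c * N$b$d * W$c$d) = (\<Sum>d\<in>UNIV. (\<Sum>c\<in>UNIV. M$a$c * W$c$d) * N$b$d)" for a b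
    by (subst sum.swap) (simp add: sum_distrib_left sum_distrib_right mult_ac)
  then show ?thesis
    by (simp add: vec_eq_iff matrix_vector_mult_def matrix_matrix_mult_def transpose_def sum_UNIV_prod)
qed

lemma vecm_inner: "vecm W \<bullet> vecm W' = W \<bullet> W'"
  by (simp add: inner_vec_def sum_UNIV_prod)

section \<open>Four-dimensional epsilon tensors\<close>

lemma vector_4_nth [simp]:
  "(vector [a, b, c, d] :: 'a::zero^4) $ 1 = a" "(vector [a, b, c, d] :: 'a::zero^4) $ 2 = b"
  "(vector [a, b, c, d] :: 'a::zero^4) $ 3 = c" "(vector [a, b, c, d] :: 'a::zero^4) $ 4 = d"
  by (simp_all add: vector_def)

lemma det_4: "det (A :: real^4^4) =
    A$1$1 * (A$2$2 * (A$3$3 * A$4$4 - A$3$4 * A$4$3) - A$2$3 * (A$3$2 * A$4$4 - A$3$4 * A$4$2)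
      + A$2$4 * (A$3$2 * A$4$3 - A$3$3 * A$4$2))
  - A$1$2 * (A$2$1 * (A$3$3 * A$4$4 - A$3$4 * A$4$3) - A$2$3 * (A$3$1 * A$4$4 - A$3$4 * A$4$1)
      + A$2$4 * (A$3$1 * A$4$3 - A$3$3 * A$4$1))
  + A$1$3 * (A$2$1 * (A$3$2 * A$4$4 - A$3$4 * A$4$2) - A$2$2 * (A$3$1 * A$4$4 - A$3$4 * A$4$1)
      + A$2$4 * (A$3$1 * A$4$2 - A$3$2 * A$4$1))
  - A$1$4 * (A$2$1 * (A$3$2 * A$4$3 - A$3$3 * A$4$2) - A$2$2 * (A$3$1 * A$4$3 - A$3$3 * A$4$1)
      + A$2$3 * (A$3$1 * A$4$2 - A$3$2 * A$4$1))"
proof -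
  have f1: "finite {2::4, 3, 4}" "1 \<notin> {2::4, 3, 4}" by auto
  have f2: "finite {3::4, 4}" "2 \<notin> {3::4, 4}" by auto
  have f3: "finite {4::4}" "3 \<notin> {4::4}" by auto
  show ?thesis
    unfolding det_def UNIV_4
    unfolding sum_over_permutations_insert[OF f1]
    unfolding sum_over_permutations_insert[OF f2]
    unfolding sum_over_permutations_insert[OF f3]
    unfolding permutes_sing
    by (simp add: sign_swap_id permutation_swap_id permutation_compose sign_compose sign_id swap_id_eq)
      (simp add: algebra_simps)
qed

lemma eps4_zero:
  "eps4 a a c d = 0" "eps4 a b a d = 0" "eps4 a b c a = 0"
  "eps4 a b b d = 0" "eps4 a b c b = 0" "eps4 a b c c = 0"
  by (simp_all add: eps4_def det_4 algebra_simps)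

lemma eps4_values:
  "eps4 1 2 3 4 = 1" "eps4 1 2 4 3 = -1" "eps4 1 3 2 4 = -1" "eps4 1 3 4 2 = 1"
  "eps4 1 4 2 3 = 1" "eps4 1 4 3 2 = -1" "eps4 2 1 3 4 = -1" "eps4 2 1 4 3 = 1"
  "eps4 2 3 1 4 = 1" "eps4 2 3 4 1 = -1" "eps4 2 4 1 3 = -1" "eps4 2 4 3 1 = 1"
  "eps4 3 1 2 4 = 1" "eps4 3 1 4 2 = -1" "eps4 3 2 1 4 = -1" "eps4 3 2 4 1 = 1"
  "eps4 3 4 1 2 = 1" "eps4 3 4 2 1 = -1" "eps4 4 1 2 3 = -1" "eps4 4 1 3 2 = 1"
  "eps4 4 2 1 3 = 1" "eps4 4 2 3 1 = -1" "eps4 4 3 1 2 = -1" "eps4 4 3 2 1 = 1"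
  by (simp_all add: eps4_def det_4 axis_def)

definition skew :: "real \<Rightarrow> real \<Rightarrow> real \<Rightarrow> real \<Rightarrow> real \<Rightarrow> real \<Rightarrow> real^4^4" where
  "skew a b c d e f = vector [vector [0, a, b, c], vector [- a, 0, d, e],
     vector [- b, - d, 0, f], vector [- c, - e, - f, 0]]"

lemma skew_nth [simp]:
  "skew a b c d e f $ 1 $ 1 = 0" "skew a b c d e f $ 1 $ 2 = a"
  "skew a b c d e f $ 1 $ 3 = b" "skew a b c d e f $ 1 $ 4 = c"
  "skew a b c d e f $ 2 $ 1 = - a" "skew a b c d e f $ 2 $ 2 = 0"
  "skew a b c d e f $ 2 $ 3 = d" "skew a b c d e f $ 2 $ 4 = e"
  "skew a b c d e f $ 3 $ 1 = - b" "skew a b c d e f $ 3 $ 2 = - d"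
  "skew a b c d e f $ 3 $ 3 = 0" "skew a b c d e f $ 3 $ 4 = f"
  "skew a b c d e f $ 4 $ 1 = - c" "skew a b c d e f $ 4 $ 2 = - e"
  "skew a b c d e f $ 4 $ 3 = - f" "skew a b c d e f $ 4 $ 4 = 0"
  by (simp_all add: skew_def)

lemma skew_in_antisym: "skew a b c d e f \<in> antisym_mats"
  by (simp add: antisym_mats_def vec_eq_iff forall_4 transpose_def)

lemma antisym_eq_skew:
  assumes "A \<in> antisym_mats"
  shows "A = skew (A$1$2) (A$1$3) (A$1$4) (A$2$3) (A$2$4) (A$3$4)"
proof -
  have *: "A$j$i = - A$i$j" for i j
  proof -
    have "transpose A $ i $ j = (- A) $ i $ j"
      using assms by (simp only: antisym_mats_def mem_Collect_eq)
    then show ?thesis by (simp add: transpose_def)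
  qed
  have "A$i$i = 0" for i
    using *[of i i] by linarith
  then show ?thesis
    using *[of 1 2] *[of 1 3] *[of 1 4] *[of 2 3] *[of 2 4] *[of 3 4] by (simp add: vec_eq_iff forall_4)
qed

lemma dual_skew: "dual_form (skew a b c d e f) = skew f (- e) d c (- b) a"
  by (simp add: dual_form_def vec_eq_iff forall_4 sum_4 eps4_zero eps4_values)

lemma linear_dual_form: "linear dual_form"
  by (rule linearI)
    (simp_all add: dual_form_def vec_eq_iff algebra_simps sum.distrib sum_distrib_left)

lemma matrix_mult_4: "((A :: real^4^4) ** (B :: real^'n^4)) $ i $ j = A$i$1 * B$1$j + A$i$2 * B$2$j + A$i$3 * B$3$j + A$i$4 * B$4$j"
  by (simp add: matrix_matrix_mult_def sum_4)

definition pf :: "real^4^4 \<Rightarrow> real" where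
  "pf A = A$1$2 * A$3$4 - A$1$3 * A$2$4 + A$1$4 * A$2$3"

text \<open>The minus sign here is the reason why \<open>gamma33\<close> pairs a matrix with minus
  its dual.\<close>

lemma antisym_mult_dual:
  assumes "A \<in> antisym_mats"
  shows "A ** dual_form A = - pf A *\<^sub>R mat 1" "dual_form A ** A = - pf A *\<^sub>R mat 1"
  by (subst (1 2) antisym_eq_skew[OF assms];
      simp add: dual_skew vec_eq_iff forall_4 matrix_mult_4 mat_def pf_def algebra_simps)+

lemma antisym_congruence: "A \<in> antisym_mats \<Longrightarrow> transpose h ** A ** h \<in> antisym_mats"
  by (simp add: antisym_mats_def matrix_transpose_mul matrix_mul_assoc matrix_mult_minus_left matrix_mult_minus_right)

text \<open>Contracting all four indices of the epsilon tensor with \<open>h\<close> multiplies it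
  by \<open>det h\<close>. In coordinates, the entries of \<open>K\<close> are combinations of 2 by
  2 minors of \<open>h\<close>, and the claim becomes Laplace expansion along two rows.\<close>

lemma dual_congruence:
  assumes "A \<in> antisym_mats"
  shows "transpose h ** dual_form (h ** A ** transpose h) ** h = det h *\<^sub>R dual_form A"
proof -
  define K where "K = h ** A ** transpose h"
  have "K \<in> antisym_mats"
    using antisym_congruence[OF assms, of "transpose h"] by (simp add: K_def)
  then have dual_K: "dual_form K = skew (K$3$4) (- K$2$4) (K$2$3) (K$1$4) (- K$1$3) (K$1$2)"
    by (subst antisym_eq_skew) (simp_all add: dual_skew)
  obtain a b c d e f where A: "A = skew a b c d e f"
    using antisym_eq_skew[OF assms] by blast
  have K: "K$i$j = a * (h$i$1 * h$j$2 - h$i$2 * h$j$1) + b * (h$i$1 * h$j$3 - h$i$3 * h$j$1)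
     + c * (h$i$1 * h$j$4 - h$i$4 * h$j$1) + d * (h$i$2 * h$j$3 - h$i$3 * h$j$2)
     + e * (h$i$2 * h$j$4 - h$i$4 * h$j$2) + f * (h$i$3 * h$j$4 - h$i$4 * h$j$3)" for i j
    by (simp add: K_def A matrix_mult_4 transpose_def algebra_simps)
  show ?thesis
    unfolding K_def[symmetric] dual_K
    by (simp add: A dual_skew vec_eq_iff forall_4 matrix_mult_4 transpose_def det_4 K)
      (intro conjI; simp add: algebra_simps)
qed

section \<open>Coordinates on the ten-dimensional space, and inverses in the special linear
  groups\<close>

lemma UNIV_10: "(UNIV :: 10 set) = {0, 1, 2, 3, 4, 5, 6, 7, 8, 9}"
proof -
  have "card {0, 1, 2, 3, 4, 5, 6, 7, 8, 9 :: 10} = CARD(10)"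
    by simp
  then show ?thesis
    by (metis card_subset_eq finite_code subset_UNIV)
qed

lemma sum_10: "(\<Sum>j\<in>(UNIV :: 10 set). f j) = f 0 + f 1 + f 2 + f 3 + f 4 + f 5 + f 6 + f 7 + f 8 + f 9"
  unfolding UNIV_10 by (simp add: add.assoc)

lemma forall_10: "(\<forall>j :: 10. P j) \<longleftrightarrow> P 0 \<and> P 1 \<and> P 2 \<and> P 3 \<and> P 4 \<and> P 5 \<and> P 6 \<and> P 7 \<and> P 8 \<and> P 9"
  using UNIV_10 by (metis (no_types, lifting) UNIV_I empty_iff insertE)

lemma eta_values:
  "eta 0 = 1" "eta 1 = 1" "eta 2 = 1" "eta 3 = -1" "eta 4 = -1" "eta 5 = -1"
  "eta 6 = 1" "eta 7 = 1" "eta 8 = -1" "eta 9 = -1"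
  by (simp_all add: eta_def)

lemma card_I33: "card I33 = 6" and card_I22: "card I22 = 4"
  by (simp_all add: I33_def I22_def)

lemma sum_I33: "(\<Sum>j\<in>I33. f j) = f 0 + f 1 + f 2 + f 3 + f 4 + f 5"
  unfolding I33_def by (simp add: add.assoc)

lemma sum_I22: "(\<Sum>j\<in>I22. f j) = f 6 + f 7 + f 8 + f 9"
  unfolding I22_def by (simp add: add.assoc)

lemma I33_I22: "I33 \<inter> I22 = {}" "I33 \<union> I22 = UNIV"
  by (simp add: I33_def I22_def)
    (simp only: I33_def I22_def UNIV_10 Un_insert_left Un_empty_left)

lemma matrix_inv_eq:
  fixes A B :: "real^'n^'n"
  assumes "A ** B = mat 1"
  shows "matrix_inv A = B"
proof -
  have "B ** A = mat 1"
    using assms matrix_left_right_inverse by blast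
  have "A ** matrix_inv A = mat 1 \<and> matrix_inv A ** A = mat 1"
    unfolding matrix_inv_def by (rule someI[of _ B]) (simp add: assms \<open>B ** A = mat 1\<close>)
  then show ?thesis
    by (metis \<open>B ** A = mat 1\<close> matrix_mul_assoc matrix_mul_lid matrix_mul_rid)
qed

lemma SL_inv:
  assumes "g \<in> SL"
  shows "g ** matrix_inv g = mat 1" "matrix_inv g ** g = mat 1"
proof -
  have "invertible g"
    using assms by (simp add: SL_def invertible_det_nz)
  then obtain B where B: "g ** B = mat 1" "B ** g = mat 1"
    by (auto simp: invertible_def)
  then show "g ** matrix_inv g = mat 1" "matrix_inv g ** g = mat 1"
    using matrix_inv_eq[OF B(1)] by simp_all
qed

lemma contragredient_mult:
  assumes "g \<in> SL" "h \<in> SL"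
  shows "contragredient (g ** h) = contragredient g ** contragredient h"
proof -
  have "(g ** h) ** (matrix_inv h ** matrix_inv g) = g ** (h ** matrix_inv h) ** matrix_inv g"
    by (simp add: matrix_mul_assoc)
  then have "matrix_inv (g ** h) = matrix_inv h ** matrix_inv g"
    by (intro matrix_inv_eq) (simp add: SL_inv assms)
  then show ?thesis by (simp add: matrix_transpose_mul)
qed

lemma contragredient_inv:
  assumes "g \<in> SL"
  shows "g ** transpose (contragredient g) = mat 1" "transpose (contragredient g) ** g = mat 1"
    "contragredient g ** transpose g = mat 1" "transpose g ** contragredient g = mat 1"
  using SL_inv[OF assms] by (simp_all add: matrix_transpose_mul[symmetric] transpose_mat)

lemma det_contragredient: "g \<in> SL \<Longrightarrow> det (contragredient g) = 1"
  using contragredient_inv(3)[of g] det_mul[of "contragredient g" "transpose g"]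
  by (simp add: SL_def det_transpose)

definition sympl :: "real^2^2" where
  "sympl = vector [vector [0, 1], vector [-1, 0]]"

lemma sympl_nth [simp]: "sympl$1$1 = 0" "sympl$1$2 = 1" "sympl$2$1 = -1" "sympl$2$2 = 0"
  by (simp_all add: sympl_def)

lemmas mat2_simps = vec_eq_iff forall_2 matrix_mult_2 transpose_def qconj_nth mat_def det_2

lemma eps2_sympl: "eps2 \<alpha> \<beta> = sympl$\<alpha>$\<beta>"
proof -
  have "\<forall>\<alpha> \<beta>. eps2 \<alpha> \<beta> = sympl$\<alpha>$\<beta>"
    by (simp add: forall_2 eps2_def det_2 axis_def)
  then show ?thesis by blast
qed

lemma qconj_mult: "h ** qconj h = det h *\<^sub>R mat 1" "qconj h ** h = det h *\<^sub>R mat 1"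
  by (simp_all add: mat2_simps)

text \<open>For the symplectic form in dimension two the adjoint of a matrix is its
  adjugate.\<close>

lemma sympl_qconj: "h ** sympl = sympl ** transpose (qconj h)" "sympl ** h = transpose (qconj h) ** sympl"
  by (simp_all add: mat2_simps)

lemma sympl_square: "sympl ** sympl = - mat 1"
  by (simp add: mat2_simps)

lemma matrix_inv_2: "h \<in> SL \<Longrightarrow> matrix_inv h = qconj h"
  by (intro matrix_inv_eq) (simp add: qconj_mult SL_def)

section \<open>The spin representations in signatures (3,3), (2,2) and (5,5)\<close>

definition omega :: "real^('n::finite + 'n)^('n + 'n)" where
  "omega = blk (mat 1) 0 0 (- mat 1)"

text \<open>The coordinates are such that the Pfaffian of \<open>Amat v\<close>, and \<open>\<mu>\<close> times the determinant of
  \<open>Bmat \<mu> v\<close> if \<open>\<mu>\<^sup>2 = 1\<close>, are the restrictions of the form with diagonal entries \<open>eta\<close>.\<close>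

definition Amat :: "real^10 \<Rightarrow> real^4^4" where
  "Amat v = skew (- (v$0 + v$3)) (v$4 + v$1) (v$2 - v$5) (v$2 + v$5) (v$4 - v$1) (- (v$0 - v$3))"

definition Bmat :: "real \<Rightarrow> real^10 \<Rightarrow> real^2^2" where
  "Bmat \<mu> v = vector [vector [\<mu> * (v$6 + v$8), \<mu> * (v$9 + v$7)], vector [v$9 - v$7, v$6 - v$8]]"

definition gamma33 :: "real^10 \<Rightarrow> real^(4 + 4)^(4 + 4)" where
  "gamma33 v = blk 0 (- dual_form (Amat v)) (Amat v) 0"

text \<open>\<open>sympl ** B ** (sympl ** transpose B)\<close> is minus the determinant of
  \<open>B\<close>; the factor \<open>- \<mu>\<close> turns this into the norm
  \<open>\<mu> * det B\<close> of the corresponding element of the Jordan algebra.\<close>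

definition gamma22 :: "real \<Rightarrow> real^10 \<Rightarrow> real^(2 + 2)^(2 + 2)" where
  "gamma22 \<mu> v = blk 0 (- \<mu> *\<^sub>R (sympl ** Bmat \<mu> v)) (sympl ** transpose (Bmat \<mu> v)) 0"

text \<open>\<open>omega\<close> anticommutes with \<open>gamma33\<close>, so the cross terms cancel
  in the square and the two quadratic forms add up.\<close>

definition gamma55 :: "real \<Rightarrow> real^10 \<Rightarrow> real^((4 + 4) \<times> (2 + 2))^((4 + 4) \<times> (2 + 2))" where
  "gamma55 \<mu> v = kron (gamma33 v) (mat 1) + kron omega (gamma22 \<mu> v)"

lemma linear_Amat: "linear Amat"
  by (rule linearI) (simp_all add: Amat_def vec_eq_iff forall_4 algebra_simps)

lemma linear_Bmat: "linear (Bmat \<mu>)"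
  by (rule linearI) (simp_all add: Bmat_def vec_eq_iff forall_2 algebra_simps)

lemma Amat_antisym: "Amat v \<in> antisym_mats"
  by (simp add: Amat_def skew_in_antisym)

lemma omega_square: "omega ** omega = mat 1"
  by (simp add: omega_def blk_mult blk_one matrix_mult_minus_left matrix_mult_minus_right)

lemma linear_gamma33: "linear gamma33"
  by (rule linearI)
    (simp_all add: gamma33_def blk_add blk_scaleR linear_add[OF linear_Amat] linear_scale[OF linear_Amat]
      linear_add[OF linear_dual_form] linear_scale[OF linear_dual_form])

lemma linear_gamma22: "linear (gamma22 \<mu>)"
  by (rule linearI)
    (simp_all add: gamma22_def blk_add blk_scaleR linear_add[OF linear_Bmat] linear_scale[OF linear_Bmat]
      linear_add[OF linear_transpose] linear_scale[OF linear_transpose]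
      matrix_add_ldistrib matrix_mult_scaleR_right scaleR_add_right)

lemma linear_gamma55: "linear (gamma55 \<mu>)"
  by (rule linearI)
    (simp_all add: gamma55_def linear_add[OF linear_gamma33] linear_scale[OF linear_gamma33]
      linear_add[OF linear_gamma22] linear_scale[OF linear_gamma22] kron_simps scaleR_add_right)

lemma omega_gamma33: "omega ** gamma33 v = - (gamma33 v ** omega)"
  by (simp add: omega_def gamma33_def blk_mult blk_minus matrix_mult_minus_left matrix_mult_minus_right)

lemma omega_gamma22: "omega ** gamma22 \<mu> v = - (gamma22 \<mu> v ** omega)"
  by (simp add: omega_def gamma22_def blk_mult blk_minus matrix_mult_minus_left matrix_mult_minus_right)

lemma pf_Amat: "pf (Amat v) = (\<Sum>j\<in>I33. eta j * (v$j)\<^sup>2)"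
  by (simp add: pf_def Amat_def sum_I33 eta_values power2_eq_square algebra_simps)

lemma gamma33_square: "gamma33 v ** gamma33 v = (\<Sum>j\<in>I33. eta j * (v$j)\<^sup>2) *\<^sub>R mat 1"
  by (simp add: gamma33_def blk_mult blk_one blk_scaleR matrix_mult_minus_left matrix_mult_minus_right
      antisym_mult_dual[OF Amat_antisym] pf_Amat)

lemma Amat_surj:
  assumes "A \<in> antisym_mats"
  obtains v where "v \<in> vecs I33" "Amat v = A"
proof
  let ?v = "\<chi> j. if j = 0 then - (A$1$2 + A$3$4) / 2 else if j = 3 then (A$3$4 - A$1$2) / 2
    else if j = 4 then (A$1$3 + A$2$4) / 2 else if j = 1 then (A$1$3 - A$2$4) / 2
    else if j = 2 then (A$1$4 + A$2$3) / 2 else if j = 5 then (A$2$3 - A$1$4) / 2 else 0"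
  show "?v \<in> vecs I33"
    by (simp add: vecs_def I33_def)
  show "Amat ?v = A"
    by (subst (7) antisym_eq_skew[OF assms]) (simp add: Amat_def field_simps)
qed

lemma Amat_vecs_I22: "v \<in> vecs I22 \<Longrightarrow> Amat v = 0"
  by (simp add: Amat_def vecs_def I22_def vec_eq_iff forall_4)

lemma Bmat_vecs_I33: "v \<in> vecs I33 \<Longrightarrow> Bmat \<mu> v = 0"
  by (simp add: Bmat_def vecs_def I33_def vec_eq_iff forall_2)

lemma transpose_zero [simp]: "transpose (0 :: real^'m^'n) = 0"
  by (rule linear_0[OF linear_transpose])

interpretation R33: clifford_rep eta I33 gamma33 omega
proof (rule clifford_rep.intro)
  show "eta i = 1 \<or> eta i = -1" for i
    by (simp add: eta_def)
qed (simp_all add: linear_gamma33 gamma33_square card_I33 omega_square omega_gamma33)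

locale split_oct =
  fixes \<mu> :: real
  assumes mu: "\<mu> = 1 \<or> \<mu> = -1"
begin

lemma mu_square: "\<mu> * \<mu> = 1"
  using mu by auto

lemma det_Bmat: "\<mu> * det (Bmat \<mu> v) = (\<Sum>j\<in>I22. eta j * (v$j)\<^sup>2)"
proof -
  have "\<mu> * det (Bmat \<mu> v) = (\<mu> * \<mu>) * ((v$6 + v$8) * (v$6 - v$8) - (v$9 + v$7) * (v$9 - v$7))"
    by (simp add: Bmat_def det_2 algebra_simps)
  then show ?thesis
    by (simp add: mu_square sum_I22 eta_values power2_eq_square algebra_simps)
qed

lemma gamma22_square: "gamma22 \<mu> v ** gamma22 \<mu> v = (\<Sum>j\<in>I22. eta j * (v$j)\<^sup>2) *\<^sub>R mat 1"
proof -
  have "sympl ** B ** (sympl ** transpose B) = - det B *\<^sub>R mat 1"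
    "sympl ** transpose B ** (sympl ** B) = - det B *\<^sub>R mat 1" for B
    by (simp_all add: mat2_simps)
  then show ?thesis
    by (simp add: gamma22_def blk_mult blk_one blk_scaleR matrix_mult_scaleR_left matrix_mult_scaleR_right
        matrix_mult_minus_left matrix_mult_minus_right det_Bmat)
qed

lemma Bmat_surj:
  obtains v where "v \<in> vecs I22" "Bmat \<mu> v = B"
proof
  let ?v = "\<chi> j. if j = 6 then (\<mu> * B$1$1 + B$2$2) / 2 else if j = 8 then (\<mu> * B$1$1 - B$2$2) / 2
    else if j = 9 then (\<mu> * B$1$2 + B$2$1) / 2 else if j = 7 then (\<mu> * B$1$2 - B$2$1) / 2 else 0"
  show "?v \<in> vecs I22"
    by (simp add: vecs_def I22_def)
  have "\<mu> * (\<mu> * c) = c" for c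
    by (simp add: mu_square flip: mult.assoc)
  then show "Bmat \<mu> ?v = B"
    by (simp add: Bmat_def vec_eq_iff forall_2 add_divide_distrib diff_divide_distrib)
qed

sublocale R22: clifford_rep eta I22 "gamma22 \<mu>" omega
proof (rule clifford_rep.intro)
  show "eta i = 1 \<or> eta i = -1" for i
    by (simp add: eta_def)
qed (simp_all add: linear_gamma22 gamma22_square card_I22 omega_square omega_gamma22)

lemma gamma55_square: "gamma55 \<mu> v ** gamma55 \<mu> v = (\<Sum>j\<in>UNIV. eta j * (v$j)\<^sup>2) *\<^sub>R mat 1"
proof -
  have "(\<Sum>j\<in>UNIV. eta j * (v$j)\<^sup>2) = (\<Sum>j\<in>I33. eta j * (v$j)\<^sup>2) + (\<Sum>j\<in>I22. eta j * (v$j)\<^sup>2)"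
    unfolding sum_10 sum_I33 sum_I22 by simp
  then show ?thesis
    by (simp add: gamma55_def matrix_add_ldistrib matrix_add_rdistrib kron_mult omega_gamma33
        gamma33_square gamma22_square omega_square kron_simps kron_one scaleR_add_left)
qed

text \<open>The grading of the tensor product is the product of the gradings: each summand of a
  vector is odd in exactly one factor. The size condition reads 32^2 = 2^10.\<close>

sublocale R55: clifford_rep eta UNIV "gamma55 \<mu>" "kron omega omega"
proof (rule clifford_rep.intro)
  show "eta i = 1 \<or> eta i = -1" for i
    by (simp add: eta_def)
  show "kron omega omega ** gamma55 \<mu> v = - (gamma55 \<mu> v ** kron omega omega)" for v
    by (simp add: gamma55_def matrix_add_ldistrib matrix_add_rdistrib kron_mult omega_gamma33
        omega_gamma22 omega_square kron_simps)
qed (simp_all add: linear_gamma55 gamma55_square omega_square kron_mult kron_one)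

end

section \<open>Bilinear forms on spinors\<close>

definition C33 :: "real^(4 + 4)^(4 + 4)" where
  "C33 = blk 0 (mat 1) (mat 1) 0"

definition C22 :: "real \<Rightarrow> real^(2 + 2)^(2 + 2)" where
  "C22 c = blk sympl 0 0 (c *\<^sub>R sympl)"

lemma dual_antisym: "A \<in> antisym_mats \<Longrightarrow> dual_form A \<in> antisym_mats"
  by (subst antisym_eq_skew) (simp_all add: dual_skew skew_in_antisym)

lemma C33_gamma33: "C33 ** gamma33 v = - (transpose (gamma33 v) ** C33)"
  using Amat_antisym[of v] dual_antisym[OF Amat_antisym[of v]]
  by (simp add: C33_def gamma33_def blk_mult blk_transpose blk_minus linear_neg[OF linear_transpose] antisym_mats_def)

text \<open>The relative factor between the symplectic forms on the two doublets decides whether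
  vectors are skew-adjoint or self-adjoint. The skew case determines \<open>cl_rev\<close> in
  signature (2,2), the self-adjoint case is the one that enters \<open>C55\<close>.\<close>

lemma C22_gamma22:
  "C22 (-\<mu>) ** gamma22 \<mu> v = - (transpose (gamma22 \<mu> v) ** C22 (-\<mu>))"
  "C22 \<mu> ** gamma22 \<mu> v = transpose (gamma22 \<mu> v) ** C22 \<mu>"
proof -
  have "sympl ** (sympl ** B) = - B" for B :: "real^2^2"
    by (simp add: matrix_mul_assoc sympl_square matrix_mult_minus_left)
  moreover have "B ** transpose sympl ** sympl = B" for B :: "real^2^2"
    by (simp add: mat2_simps)
  ultimately show "C22 (-\<mu>) ** gamma22 \<mu> v = - (transpose (gamma22 \<mu> v) ** C22 (-\<mu>))"
    "C22 \<mu> ** gamma22 \<mu> v = transpose (gamma22 \<mu> v) ** C22 \<mu>"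
    by (simp_all add: C22_def gamma22_def blk_mult blk_transpose blk_minus linear_neg[OF linear_transpose]
        linear_scale[OF linear_transpose] matrix_mult_scaleR_left matrix_mult_scaleR_right
        matrix_mult_minus_left matrix_mult_minus_right matrix_transpose_mul)
qed

lemma C33_omega: "C33 ** omega = - (omega ** C33)"
  by (simp add: C33_def omega_def blk_mult blk_minus)

lemma transpose_omega: "transpose omega = omega"
  by (simp add: omega_def blk_transpose linear_neg[OF linear_transpose] transpose_mat)

definition C55 :: "real \<Rightarrow> real^((4 + 4) \<times> (2 + 2))^((4 + 4) \<times> (2 + 2))" where
  "C55 \<mu> = kron C33 (C22 \<mu>)"

text \<open>For a (3,3) vector the minus sign comes from \<open>C33_gamma33\<close>, for a (2,2)
  vector from moving \<open>C33\<close> past \<open>omega\<close>. As \<open>C55\<close> is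
  antisymmetric, its product with a vector is symmetric, so the cubic expression in
  \<open>N3_albert\<close> does not cancel.\<close>

lemma C55_gamma55: "C55 \<mu> ** gamma55 \<mu> v = - (transpose (gamma55 \<mu> v) ** C55 \<mu>)"
  by (simp add: C55_def gamma55_def matrix_add_ldistrib matrix_add_rdistrib kron_mult kron_transpose
      linear_add[OF linear_transpose] C33_gamma33 C22_gamma22 C33_omega transpose_omega transpose_mat kron_simps)

lemma omega_commute_blk:
  assumes "omega ** M = M ** omega"
  obtains g h where "M = blk g 0 0 h"
proof -
  obtain A B C D where M: "M = blk A B C D"
    by (rule blk_cases)
  have "B = - B" "C = - C"
    using assms unfolding M omega_def
    by (simp_all add: blk_mult matrix_mult_minus_left matrix_mult_minus_right)
  then have "B = 0" "C = 0"
    by (metis add.right_inverse scaleR_2 scaleR_eq_0_iff zero_neq_numeral)+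
  then show ?thesis
    using that M by blast
qed

lemma omega_commute_blk_diag: "omega ** blk g 0 0 h = blk g 0 0 h ** omega"
  by (simp add: omega_def blk_mult matrix_mult_minus_left matrix_mult_minus_right)

section \<open>The exceptional isomorphisms\<close>

text \<open>\<open>C33\<close> pairs the two half-spin spaces with each other, so the adjoint
  transposes the blocks and exchanges them.\<close>

lemma rho33_rev:
  assumes "x \<in> even_cl I33" "R33.rho x = blk g 0 0 h"
  shows "R33.rho (cl_rev x) = blk (transpose h) 0 0 (transpose g)"
proof -
  obtain a b where ab: "R33.rho (cl_rev x) = blk a 0 0 b"
    using omega_commute_blk R33.omega_rho_even cl_rev_even assms(1) by metis
  have "g = transpose b" "h = transpose a"
    using R33.rho_rev[OF assms(1) C33_gamma33] unfolding assms(2) ab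
    by (simp_all add: C33_def blk_mult blk_transpose)
  then show ?thesis using ab by simp
qed

text \<open>One block of \<open>gamma33 w\<close> transforms correctly by assumption; for the dual
  block this is \<open>dual_congruence\<close> with determinant one.\<close>

lemma gamma33_congruence:
  assumes "g ** transpose h = mat 1" "det h = 1" "Amat w = h ** Amat v ** transpose h"
  shows "blk g 0 0 h ** gamma33 v ** blk (transpose h) 0 0 (transpose g) = gamma33 w"
proof -
  have *: "h ** transpose g = mat 1"
    using arg_cong[OF assms(1), of transpose] by (simp add: matrix_transpose_mul transpose_mat)
  have "g ** dual_form (Amat v) ** transpose g = g ** (transpose h ** dual_form (Amat w) ** h) ** transpose g"
    using dual_congruence[OF Amat_antisym, of h v] assms by simp
  also have "\<dots> = (g ** transpose h) ** dual_form (Amat w) ** (h ** transpose g)"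
    by (simp add: matrix_mul_assoc)
  finally have "g ** dual_form (Amat v) ** transpose g = dual_form (Amat w)"
    using assms(1) * by simp
  then show ?thesis
    by (simp add: gamma33_def blk_mult matrix_mult_minus_left matrix_mult_minus_right assms(3))
qed

lemma spin33_iff:
  "x \<in> Spin33 \<longleftrightarrow> x \<in> even_cl I33 \<and> (\<exists>g\<in>SL. R33.rho x = blk g 0 0 (contragredient g))"
proof safe
  assume x: "x \<in> Spin33"
  then show even: "x \<in> even_cl I33"
    using spin_subset_even by auto
  obtain g h where gh: "R33.rho x = blk g 0 0 h"
    using omega_commute_blk R33.omega_rho_even[OF even] by metis
  note rev = rho33_rev[OF even gh]
  have "g ** transpose h = mat 1"
    using x unfolding R33.spin_iff[OF even] rev gh by (simp add: blk_mult blk_one)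
  then have h: "h = contragredient g" and hg: "transpose h ** g = mat 1"
    using matrix_inv_eq[of g "transpose h"] matrix_left_right_inverse[of g "transpose h"] by simp_all
  have gh': "transpose g ** h = mat 1"
    using arg_cong[OF hg, of transpose] by (simp add: matrix_transpose_mul transpose_mat)
  \<comment> \<open>A test vector with nonzero dual. The two blocks of its image belong to the same
    vector, and comparing them by \<open>dual_congruence\<close> forces
    \<open>det h = 1\<close>.\<close>
  obtain v where v: "v \<in> vecs I33" "Amat v = skew 1 0 0 0 0 0"
    using Amat_surj[OF skew_in_antisym] by metis
  obtain w where "R33.rho x ** gamma33 v ** R33.rho (cl_rev x) = gamma33 w"
    using x v(1) unfolding R33.spin_iff[OF even] by blast
  then have w: "dual_form (Amat w) = g ** dual_form (Amat v) ** transpose g"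
    "Amat w = h ** Amat v ** transpose h"
    unfolding rev gh gamma33_def by (simp_all add: blk_mult matrix_mult_minus_left matrix_mult_minus_right)
  have "det h *\<^sub>R dual_form (Amat v) = transpose h ** dual_form (Amat w) ** h"
    using dual_congruence[OF Amat_antisym, of h v] w(2) by simp
  also have "\<dots> = (transpose h ** g) ** dual_form (Amat v) ** (transpose g ** h)"
    unfolding w(1) by (simp add: matrix_mul_assoc)
  finally have "det h *\<^sub>R dual_form (Amat v) = dual_form (Amat v)"
    using hg gh' by simp
  then have "det h = 1"
    by (simp add: v(2) dual_skew vec_eq_iff forall_4)
  then have "det g = 1"
    using arg_cong[OF hg, of det] by (simp add: det_mul)
  then show "\<exists>g\<in>SL. R33.rho x = blk g 0 0 (contragredient g)"
    using gh h by (auto simp: SL_def)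
next
  fix g
  assume even: "x \<in> even_cl I33" and g: "g \<in> SL" and gh: "R33.rho x = blk g 0 0 (contragredient g)"
  note rev = rho33_rev[OF even gh]
  show "x \<in> Spin33"
    unfolding R33.spin_iff[OF even] rev gh
  proof (intro conjI ballI)
    show "blk g 0 0 (contragredient g) ** blk (transpose (contragredient g)) 0 0 (transpose g) = mat 1"
      using contragredient_inv[OF g] by (simp add: blk_mult blk_one)
    fix v
    obtain w where "w \<in> vecs I33" "Amat w = contragredient g ** Amat v ** transpose (contragredient g)"
      using Amat_surj[OF antisym_congruence[OF Amat_antisym, of "transpose (contragredient g)"]]
      by (metis transpose_transpose)
    then show "\<exists>w\<in>vecs I33. blk g 0 0 (contragredient g) ** gamma33 v **
        blk (transpose (contragredient g)) 0 0 (transpose g) = gamma33 w"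
      using gamma33_congruence[OF contragredient_inv(1)[OF g] det_contragredient[OF g]] by blast
  qed
qed

text \<open>A block diagonal matrix commutes with the grading, so it has a preimage in the even
  algebra, and only one because \<open>rho\<close> is faithful.\<close>

definition theta4 :: "real^4^4 \<Rightarrow> 10 clifford" where
  "theta4 g = inv_into (even_cl I33) R33.rho (blk g 0 0 (contragredient g))"

lemma theta4: "theta4 g \<in> even_cl I33" "R33.rho (theta4 g) = blk g 0 0 (contragredient g)"
proof -
  have "blk g 0 0 (contragredient g) \<in> R33.rho ` even_cl I33"
    using R33.rho_even_exists[OF omega_commute_blk_diag] by (metis imageI)
  then show "theta4 g \<in> even_cl I33" "R33.rho (theta4 g) = blk g 0 0 (contragredient g)"
    unfolding theta4_def by (auto intro: inv_into_into f_inv_into_f)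
qed

lemma theta4_spin: "g \<in> SL \<Longrightarrow> theta4 g \<in> Spin33"
  using theta4 spin33_iff by blast

lemma bij_theta4: "bij_betw theta4 SL Spin33"
proof (rule bij_betw_imageI)
  show "inj_on theta4 SL"
    by (rule inj_onI) (metis theta4(2) blk_eq_iff)
  show "theta4 ` SL = Spin33"
  proof (intro equalityI subsetI)
    fix x assume "x \<in> Spin33"
    then obtain g where g: "g \<in> SL" "x \<in> even_cl I33" "R33.rho x = R33.rho (theta4 g)"
      unfolding spin33_iff theta4(2) by blast
    then have "x = theta4 g"
      using R33.rho_eq_iff theta4(1) even_cl_subset_carrier by blast
    then show "x \<in> theta4 ` SL"
      using g(1) by blast
  qed (auto simp: theta4_spin)
qed

lemma theta4_mult:
  assumes "g \<in> SL" "h \<in> SL"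
  shows "theta4 (g ** h) = theta4 g \<star> theta4 h"
proof -
  have carrier: "theta4 f \<in> cl_carrier I33" for f
    using theta4(1) even_cl_subset_carrier by blast
  have "R33.rho (theta4 g \<star> theta4 h) = R33.rho (theta4 (g ** h))"
    by (simp add: R33.rho_mult carrier theta4(2) contragredient_mult assms blk_mult)
  then show ?thesis
    using R33.rho_eq_iff carrier cl_mult_carrier by metis
qed

section \<open>Spin(2,2) as a product of two copies of SL(2)\<close>

context split_oct
begin

text \<open>The form pairs each doublet with itself by a multiple of \<open>sympl\<close>, so the
  blocks stay in place and are replaced by their adjugates.\<close>

lemma rho22_rev:
  assumes "x \<in> even_cl I22" "R22.rho x = blk h 0 0 k"
  shows "R22.rho (cl_rev x) = blk (qconj h) 0 0 (qconj k)"
proof -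
  obtain a b where ab: "R22.rho (cl_rev x) = blk a 0 0 b"
    using omega_commute_blk R22.omega_rho_even cl_rev_even assms(1) by metis
  have "sympl ** h = transpose a ** sympl" "- \<mu> *\<^sub>R (sympl ** k) = - \<mu> *\<^sub>R (transpose b ** sympl)"
    using R22.rho_rev[OF assms(1) C22_gamma22(1)] unfolding assms(2) ab
    by (simp_all add: C22_def blk_mult blk_transpose matrix_mult_scaleR_left matrix_mult_scaleR_right
        matrix_mult_minus_left matrix_mult_minus_right)
  then have "transpose (qconj h) ** sympl = transpose a ** sympl" "transpose (qconj k) ** sympl = transpose b ** sympl"
    using mu by (auto simp: sympl_qconj(2))
  then have "a = qconj h" "b = qconj k"
    by (simp_all add: mat2_simps)
  then show ?thesis using ab by simp
qed

lemma gamma22_congruence: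
  assumes "Bmat \<mu> w = transpose (qconj h) ** Bmat \<mu> v ** qconj k"
  shows "blk h 0 0 k ** gamma22 \<mu> v ** blk (qconj h) 0 0 (qconj k) = gamma22 \<mu> w"
proof -
  have "h ** (sympl ** Bmat \<mu> v) ** qconj k = sympl ** Bmat \<mu> w"
    by (simp add: assms matrix_mul_assoc sympl_qconj(1))
  moreover have "k ** (sympl ** transpose (Bmat \<mu> v)) ** qconj h = sympl ** transpose (Bmat \<mu> w)"
    by (simp add: assms matrix_mul_assoc sympl_qconj(1) matrix_transpose_mul)
  ultimately show ?thesis
    by (simp add: gamma22_def blk_mult matrix_mult_scaleR_left matrix_mult_scaleR_right
        matrix_mult_minus_left matrix_mult_minus_right)
qed

text \<open>In contrast to signature (3,3), the norm condition already gives both determinants.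
  Preservation of vectors is then automatic, since every 2 by 2 matrix is \<open>Bmat\<close> of a
  vector.\<close>

lemma spin22_iff:
  "x \<in> Spin22 \<longleftrightarrow> x \<in> even_cl I22 \<and> (\<exists>h\<in>SL. \<exists>k\<in>SL. R22.rho x = blk h 0 0 k)"
proof safe
  assume x: "x \<in> Spin22"
  then show even: "x \<in> even_cl I22"
    using spin_subset_even by auto
  obtain h k where hk: "R22.rho x = blk h 0 0 k"
    using omega_commute_blk R22.omega_rho_even[OF even] by metis
  have "det h *\<^sub>R mat 1 = (mat 1 :: real^2^2)" "det k *\<^sub>R mat 1 = (mat 1 :: real^2^2)"
    using x unfolding R22.spin_iff[OF even] rho22_rev[OF even hk] hk
    by (simp_all add: blk_mult blk_one qconj_mult)
  then have "det h = 1" "det k = 1"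
    by (simp_all add: mat2_simps)
  then show "\<exists>h\<in>SL. \<exists>k\<in>SL. R22.rho x = blk h 0 0 k"
    using hk by (auto simp: SL_def)
next
  fix h k
  assume even: "x \<in> even_cl I22" and hk: "h \<in> SL" "k \<in> SL" "R22.rho x = blk h 0 0 k"
  show "x \<in> Spin22"
    unfolding R22.spin_iff[OF even] rho22_rev[OF even hk(3)] hk(3)
  proof (intro conjI ballI)
    show "blk h 0 0 k ** blk (qconj h) 0 0 (qconj k) = mat 1"
      using hk by (simp add: blk_mult blk_one qconj_mult SL_def)
    fix v
    obtain w where "w \<in> vecs I22" "Bmat \<mu> w = transpose (qconj h) ** Bmat \<mu> v ** qconj k"
      by (rule Bmat_surj)
    then show "\<exists>w\<in>vecs I22. blk h 0 0 k ** gamma22 \<mu> v ** blk (qconj h) 0 0 (qconj k) = gamma22 \<mu> w"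
      using gamma22_congruence by blast
  qed
qed

definition theta2 :: "real^2^2 \<Rightarrow> real^2^2 \<Rightarrow> 10 clifford" where
  "theta2 h k = inv_into (even_cl I22) R22.rho (blk h 0 0 k)"

lemma theta2: "theta2 h k \<in> even_cl I22" "R22.rho (theta2 h k) = blk h 0 0 k"
proof -
  have "blk h 0 0 k \<in> R22.rho ` even_cl I22"
    using R22.rho_even_exists[OF omega_commute_blk_diag] by (metis imageI)
  then show "theta2 h k \<in> even_cl I22" "R22.rho (theta2 h k) = blk h 0 0 k"
    unfolding theta2_def by (auto intro: inv_into_into f_inv_into_f)
qed

lemma theta2_spin: "h \<in> SL \<Longrightarrow> k \<in> SL \<Longrightarrow> theta2 h k \<in> Spin22"
  using theta2 spin22_iff by blast

lemma bij_theta2: "bij_betw (\<lambda>(h, k). theta2 h k) (SL \<times> SL) Spin22"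
proof (rule bij_betw_imageI)
  show "inj_on (\<lambda>(h, k). theta2 h k) (SL \<times> SL)"
    by (rule inj_onI) (metis (no_types, lifting) theta2(2) blk_eq_iff case_prod_beta prod_eqI)
  show "(\<lambda>(h, k). theta2 h k) ` (SL \<times> SL) = Spin22"
  proof (intro equalityI subsetI)
    fix x assume "x \<in> Spin22"
    then obtain h k where hk: "h \<in> SL" "k \<in> SL" "x \<in> even_cl I22" "R22.rho x = R22.rho (theta2 h k)"
      unfolding spin22_iff theta2(2) by blast
    then have "x = theta2 h k"
      using R22.rho_eq_iff theta2(1) even_cl_subset_carrier by blast
    then show "x \<in> (\<lambda>(h, k). theta2 h k) ` (SL \<times> SL)"
      using hk(1,2) by auto
  qed (auto simp: theta2_spin)
qed

lemma theta2_mult: "theta2 (h ** h') (k ** k') = theta2 h k \<star> theta2 h' k'"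
proof -
  have carrier: "theta2 f g \<in> cl_carrier I22" for f g
    using theta2(1) even_cl_subset_carrier by blast
  have "R22.rho (theta2 h k \<star> theta2 h' k') = R22.rho (theta2 (h ** h') (k ** k'))"
    by (simp add: R22.rho_mult carrier theta2(2) blk_mult)
  then show ?thesis
    using R22.rho_eq_iff carrier cl_mult_carrier by metis
qed

end

section \<open>The group Spin(5,5) and its commuting subgroups Spin(3,3) and Spin(2,2)\<close>

lemma cl_carrier_UNIV [simp]: "cl_carrier UNIV = UNIV"
  by (auto simp: cl_carrier_def)

lemma vecs_UNIV [simp]: "vecs UNIV = UNIV"
  by (auto simp: vecs_def)

lemma even_cl_mono: "I \<subseteq> J \<Longrightarrow> even_cl I \<subseteq> even_cl J"
  by (auto simp: even_cl_def)

lemma cl_rev_rev: "cl_rev (cl_rev x) = x"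
  by (simp add: cl_rev_def vec_eq_iff mult.assoc[symmetric] flip: power_add mult_2)

lemma list_prod_kron:
  "list_prod (\<lambda>i. kron (f i) (g i)) xs = kron (list_prod f xs) (list_prod g xs)"
  by (induction xs) (simp_all add: kron_mult kron_one)

lemma list_prod_cong: "\<forall>i\<in>set xs. f i = g i \<Longrightarrow> list_prod f xs = list_prod g xs"
  by (induction xs) auto

lemma list_prod_one: "list_prod (\<lambda>_. mat 1) xs = mat 1"
  by (induction xs) auto

lemma list_prod_involution:
  assumes "W ** W = mat 1"
  shows "list_prod (\<lambda>_. W) xs = (if even (length xs) then mat 1 else W)"
  by (induction xs) (auto simp: assms)

definition restrict_vec :: "'n set \<Rightarrow> real^'n \<Rightarrow> real^'n" where
  "restrict_vec I v = (\<chi> j. if j \<in> I then v$j else 0)"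

lemma restrict_vec_in_vecs: "restrict_vec I v \<in> vecs I"
  by (simp add: restrict_vec_def vecs_def)

lemma restrict_vec_split: "v = restrict_vec I33 v + restrict_vec I22 v"
proof -
  have "i \<in> I33 \<longleftrightarrow> i \<notin> I22" for i
    using I33_I22 by auto
  then show ?thesis
    by (simp add: restrict_vec_def vec_eq_iff)
qed

lemma I33_I22_scalar:
  assumes "x \<in> even_cl I33" "x \<in> even_cl I22"
  obtains c where "x = c *\<^sub>R cl_one"
proof
  have "x$A = 0" if "A \<noteq> {}" for A
    using assms that I33_I22(1) unfolding even_cl_def by blast
  then show "x = x${} *\<^sub>R cl_one"
    by (simp add: cl_one_def vec_eq_iff axis_def)
qed

lemma cl_rev_scalar: "cl_rev (c *\<^sub>R cl_one) = c *\<^sub>R cl_one"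
  by (simp add: cl_rev_def cl_one_def vec_eq_iff axis_def)

context split_oct
begin

lemma gamma55_I33: "v \<in> vecs I33 \<Longrightarrow> gamma55 \<mu> v = kron (gamma33 v) (mat 1)"
  using Bmat_vecs_I33[of v \<mu>] kron_simps(6)[of omega 0 "0 :: real^(2+2)^(2+2)"]
  by (simp add: gamma55_def gamma22_def) (simp add: vec_eq_iff blk_simps)

lemma gamma55_I22: "v \<in> vecs I22 \<Longrightarrow> gamma55 \<mu> v = kron omega (gamma22 \<mu> v)"
  using Amat_vecs_I22[of v] linear_0[OF linear_dual_form]
  by (simp add: gamma55_def gamma33_def) (simp add: vec_eq_iff blk_simps)

lemma rho55_I33:
  assumes "x \<in> cl_carrier I33"
  shows "R55.rho x = kron (R33.rho x) (mat 1)"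
proof -
  have "x$A *\<^sub>R R55.mon A = x$A *\<^sub>R kron (R33.mon A) (mat 1)" for A
  proof (cases "x$A = 0")
    case False
    then have "A \<subseteq> I33"
      using assms by (auto simp: cl_carrier_def)
    then have "\<forall>i\<in>set (sorted_list_of_set A). R55.gen i = kron (R33.gen i) (mat 1)"
      by (auto simp: R55.gen_def R33.gen_def intro!: gamma55_I33 axis_in_vecs)
    then have "R55.mon A = kron (R33.mon A) (mat 1)"
      by (simp add: R55.mon_def R33.mon_def list_prod_cong[where g = "\<lambda>i. kron (R33.gen i) (mat 1)"]
          list_prod_kron list_prod_one)
    then show ?thesis by simp
  qed simp
  then show ?thesis
    by (simp only: R55.rho_def R33.rho_def linear_sum[OF linear_kron_left] linear_scale[OF linear_kron_left])
qed

text \<open>Each generator contributes one factor \<open>omega\<close> on the (3,3) side; in an even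
  monomial they cancel. This is why evenness is assumed here, whereas \<open>rho55_I33\<close>
  covers the whole subalgebra.\<close>

lemma rho55_I22:
  assumes "x \<in> even_cl I22"
  shows "R55.rho x = kron (mat 1) (R22.rho x)"
proof -
  have "x$A *\<^sub>R R55.mon A = x$A *\<^sub>R kron (mat 1) (R22.mon A)" for A
  proof (cases "x$A = 0")
    case False
    then have A: "A \<subseteq> I22" "even (card A)"
      using assms by (auto simp: even_cl_def)
    then have "\<forall>i\<in>set (sorted_list_of_set A). R55.gen i = kron omega (R22.gen i)"
      by (auto simp: R55.gen_def R22.gen_def intro!: gamma55_I22 axis_in_vecs)
    then have "R55.mon A = kron (mat 1) (R22.mon A)"
      using A(2) by (simp add: R55.mon_def R22.mon_def list_prod_cong[where g = "\<lambda>i. kron omega (R22.gen i)"]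
          list_prod_kron list_prod_involution omega_square)
    then show ?thesis by simp
  qed simp
  then show ?thesis
    by (simp only: R55.rho_def R22.rho_def linear_sum[OF linear_kron_right] linear_scale[OF linear_kron_right])
qed

lemma rho55_inject: "R55.rho x = R55.rho y \<longleftrightarrow> x = y"
  using R55.rho_eq_iff by simp

lemma rho55_mult: "R55.rho (x \<star> y) = R55.rho x ** R55.rho y"
  using R55.rho_mult by simp

lemma gamma55_inject: "gamma55 \<mu> v = gamma55 \<mu> w \<longleftrightarrow> v = w"
  unfolding R55.rho_vec[symmetric] rho55_inject by (metis cl_vec_nth vec_eq_iff)

lemma rho55_rev: "x \<in> even_cl UNIV \<Longrightarrow> C55 \<mu> ** R55.rho x = transpose (R55.rho (cl_rev x)) ** C55 \<mu>"
  by (rule R55.rho_rev[OF _ C55_gamma55])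

lemma C55_square: "C55 \<mu> ** C55 \<mu> = - mat 1"
proof -
  have "C33 ** C33 = mat 1" "C22 \<mu> ** C22 \<mu> = - mat 1"
    using mu_square by (simp_all add: C33_def C22_def blk_mult blk_one blk_minus sympl_square
        matrix_mult_scaleR_left matrix_mult_scaleR_right)
  then show ?thesis
    by (simp add: C55_def kron_mult kron_simps kron_one)
qed

text \<open>Adjoints for an invertible form reverse products, and by \<open>rho55_rev\<close> the
  adjoint is what \<open>cl_rev\<close> computes on even elements.\<close>

lemma cl_rev_mult:
  assumes "x \<in> even_cl UNIV" "y \<in> even_cl UNIV"
  shows "R55.rho (cl_rev (x \<star> y)) = R55.rho (cl_rev y) ** R55.rho (cl_rev x)"
proof -
  have "C55 \<mu> ** R55.rho (x \<star> y) = transpose (R55.rho (cl_rev y) ** R55.rho (cl_rev x)) ** C55 \<mu>"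
  proof -
    have "C55 \<mu> ** R55.rho (x \<star> y) = (C55 \<mu> ** R55.rho x) ** R55.rho y"
      by (simp only: rho55_mult matrix_mul_assoc)
    also have "\<dots> = transpose (R55.rho (cl_rev x)) ** (C55 \<mu> ** R55.rho y)"
      by (simp only: rho55_rev[OF assms(1)] matrix_mul_assoc)
    also have "\<dots> = transpose (R55.rho (cl_rev y) ** R55.rho (cl_rev x)) ** C55 \<mu>"
      by (simp only: rho55_rev[OF assms(2)] matrix_mul_assoc matrix_transpose_mul)
    finally show ?thesis .
  qed
  then have "transpose (R55.rho (cl_rev (x \<star> y))) ** C55 \<mu> = transpose (R55.rho (cl_rev y) ** R55.rho (cl_rev x)) ** C55 \<mu>"
    using rho55_rev[OF cl_mult_even[OF assms]] by simp
  then have "transpose (R55.rho (cl_rev (x \<star> y))) ** (C55 \<mu> ** C55 \<mu>) =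
    transpose (R55.rho (cl_rev y) ** R55.rho (cl_rev x)) ** (C55 \<mu> ** C55 \<mu>)"
    by (simp only: matrix_mul_assoc)
  then show ?thesis
    by (simp add: C55_square matrix_mult_minus_right)
qed

lemma spin55_even: "s \<in> Spin55 \<Longrightarrow> s \<in> even_cl UNIV"
  using spin_subset_even by blast

lemma spin55_rev:
  assumes "s \<in> Spin55"
  shows "R55.rho s ** R55.rho (cl_rev s) = mat 1" "R55.rho (cl_rev s) ** R55.rho s = mat 1"
proof -
  show "R55.rho s ** R55.rho (cl_rev s) = mat 1"
    using assms R55.spin_iff[OF spin55_even[OF assms]] by blast
  then show "R55.rho (cl_rev s) ** R55.rho s = mat 1"
    using matrix_left_right_inverse by blast
qed

lemma spin55I:
  assumes "x \<in> even_cl UNIV" "R55.rho x ** R55.rho (cl_rev x) = mat 1"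
    "\<And>v. \<exists>w. R55.rho x ** gamma55 \<mu> v ** R55.rho (cl_rev x) = gamma55 \<mu> w"
  shows "x \<in> Spin55"
  using assms R55.spin_iff[OF assms(1)] by simp

lemma rho55_spin_vec:
  assumes "s \<in> Spin55"
  shows "R55.rho s ** gamma55 \<mu> v ** R55.rho (cl_rev s) = gamma55 \<mu> (spin_vec eta s v)"
proof -
  obtain w where w: "cl_mult eta (cl_mult eta s (cl_vec v)) (cl_rev s) = cl_vec w"
    using assms by (auto simp: spin_def)
  then have "spin_vec eta s v = w"
    by (simp add: spin_vec_def cl_vec_nth vec_eq_iff)
  then show ?thesis
    using arg_cong[OF w, of R55.rho] by (simp add: rho55_mult R55.rho_vec)
qed

text \<open>An intertwining relation is usually easier to verify than a conjugation, because it does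
  not mention \<open>cl_rev\<close>.\<close>

lemma spin_vec_eqI:
  assumes "s \<in> Spin55" "R55.rho s ** gamma55 \<mu> v = gamma55 \<mu> w ** R55.rho s"
  shows "spin_vec eta s v = w"
proof -
  have "gamma55 \<mu> (spin_vec eta s v) = gamma55 \<mu> w ** (R55.rho s ** R55.rho (cl_rev s))"
    unfolding rho55_spin_vec[OF assms(1), symmetric] assms(2) by (simp add: matrix_mul_assoc)
  then show ?thesis
    by (simp add: spin55_rev[OF assms(1)] gamma55_inject)
qed

lemma spin55_mult:
  assumes "s \<in> Spin55" "t \<in> Spin55"
  shows "s \<star> t \<in> Spin55"
proof (rule spin55I)
  show "s \<star> t \<in> even_cl UNIV"
    using assms by (simp add: cl_mult_even spin55_even)
  have conj: "R55.rho (s \<star> t) ** M ** R55.rho (cl_rev (s \<star> t)) =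
    R55.rho s ** (R55.rho t ** M ** R55.rho (cl_rev t)) ** R55.rho (cl_rev s)" for M
    using assms by (simp add: rho55_mult cl_rev_mult spin55_even matrix_mul_assoc)
  show "R55.rho (s \<star> t) ** R55.rho (cl_rev (s \<star> t)) = mat 1"
    using conj[of "mat 1"] assms by (simp add: spin55_rev)
  show "\<exists>w. R55.rho (s \<star> t) ** gamma55 \<mu> v ** R55.rho (cl_rev (s \<star> t)) = gamma55 \<mu> w" for v
    unfolding conj using assms by (auto simp: rho55_spin_vec)
qed

lemma spin_vec_mult:
  assumes "s \<in> Spin55" "t \<in> Spin55"
  shows "spin_vec eta (s \<star> t) v = spin_vec eta s (spin_vec eta t v)"
proof (rule spin_vec_eqI)
  show "s \<star> t \<in> Spin55"
    by (rule spin55_mult[OF assms])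
  have *: "R55.rho u ** gamma55 \<mu> v = gamma55 \<mu> (spin_vec eta u v) ** R55.rho u" if "u \<in> Spin55" for u v
    unfolding rho55_spin_vec[OF that, symmetric]
    by (simp add: matrix_mul_assoc[symmetric] spin55_rev[OF that])
  show "R55.rho (s \<star> t) ** gamma55 \<mu> v = gamma55 \<mu> (spin_vec eta s (spin_vec eta t v)) ** R55.rho (s \<star> t)"
  proof -
    have "R55.rho (s \<star> t) ** gamma55 \<mu> v = R55.rho s ** (R55.rho t ** gamma55 \<mu> v)"
      by (simp only: rho55_mult matrix_mul_assoc)
    also have "\<dots> = (R55.rho s ** gamma55 \<mu> (spin_vec eta t v)) ** R55.rho t"
      unfolding *[OF assms(2)] by (simp only: matrix_mul_assoc)
    also have "\<dots> = gamma55 \<mu> (spin_vec eta s (spin_vec eta t v)) ** R55.rho (s \<star> t)"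
      unfolding *[OF assms(1)] by (simp only: rho55_mult matrix_mul_assoc)
    finally show ?thesis .
  qed
qed

lemma linear_spin_vec:
  assumes "s \<in> Spin55"
  shows "linear (spin_vec eta s)"
proof (rule linearI)
  fix v w c
  have *: "gamma55 \<mu> (spin_vec eta s (v + w)) = gamma55 \<mu> (spin_vec eta s v + spin_vec eta s w)"
    by (simp add: linear_add[OF linear_gamma55] rho55_spin_vec[OF assms, symmetric]
        matrix_add_ldistrib matrix_add_rdistrib)
  then show "spin_vec eta s (v + w) = spin_vec eta s v + spin_vec eta s w"
    by (simp add: gamma55_inject)
  have "gamma55 \<mu> (spin_vec eta s (c *\<^sub>R v)) = gamma55 \<mu> (c *\<^sub>R spin_vec eta s v)"
    by (simp add: linear_scale[OF linear_gamma55] rho55_spin_vec[OF assms, symmetric]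
        matrix_mult_scaleR_left matrix_mult_scaleR_right)
  then show "spin_vec eta s (c *\<^sub>R v) = c *\<^sub>R spin_vec eta s v"
    by (simp add: gamma55_inject)
qed

text \<open>The value of the form is the square of the vector, a scalar, and conjugation by
  \<open>s\<close> fixes scalars.\<close>

lemma spin_vec_isometry:
  assumes "s \<in> Spin55"
  shows "(\<Sum>j\<in>UNIV. eta j * (spin_vec eta s v $ j)\<^sup>2) = (\<Sum>j\<in>UNIV. eta j * (v$j)\<^sup>2)"
proof -
  have "(\<Sum>j\<in>UNIV. eta j * (spin_vec eta s v $ j)\<^sup>2) *\<^sub>R mat 1 =
    R55.rho s ** gamma55 \<mu> v ** (R55.rho (cl_rev s) ** R55.rho s) ** gamma55 \<mu> v ** R55.rho (cl_rev s)"
    unfolding gamma55_square[symmetric] rho55_spin_vec[OF assms, symmetric] by (simp add: matrix_mul_assoc)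
  also have "\<dots> = R55.rho s ** (gamma55 \<mu> v ** gamma55 \<mu> v) ** R55.rho (cl_rev s)"
    using spin55_rev[OF assms] by (simp add: matrix_mul_assoc)
  also have "\<dots> = (\<Sum>j\<in>UNIV. eta j * (v$j)\<^sup>2) *\<^sub>R mat 1"
    unfolding gamma55_square
    by (simp add: matrix_mult_scaleR_left matrix_mult_scaleR_right spin55_rev[OF assms])
  finally show ?thesis
    by (simp add: mat_1_neq_0)
qed

text \<open>The inverse also has to map vectors to vectors. The action of \<open>s\<close> on
  vectors is linear and injective, hence surjective by finite dimension, so every vector is an image
  that \<open>cl_rev s\<close> takes back.\<close>

lemma cl_rev_spin55:
  assumes "s \<in> Spin55"
  shows "cl_rev s \<in> Spin55"
proof (rule spin55I)
  show "cl_rev s \<in> even_cl UNIV"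
    using assms by (simp add: cl_rev_even spin55_even)
  show "R55.rho (cl_rev s) ** R55.rho (cl_rev (cl_rev s)) = mat 1"
    using spin55_rev[OF assms] by (simp add: cl_rev_rev)
  have "inj (spin_vec eta s)"
  proof (rule injI)
    fix v w assume "spin_vec eta s v = spin_vec eta s w"
    then have "R55.rho (cl_rev s) ** (R55.rho s ** gamma55 \<mu> v ** R55.rho (cl_rev s)) ** R55.rho s =
      R55.rho (cl_rev s) ** (R55.rho s ** gamma55 \<mu> w ** R55.rho (cl_rev s)) ** R55.rho s"
      by (simp add: rho55_spin_vec[OF assms])
    then have "(R55.rho (cl_rev s) ** R55.rho s) ** gamma55 \<mu> v ** (R55.rho (cl_rev s) ** R55.rho s) =
      (R55.rho (cl_rev s) ** R55.rho s) ** gamma55 \<mu> w ** (R55.rho (cl_rev s) ** R55.rho s)"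
      by (simp add: matrix_mul_assoc)
    then show "v = w"
      by (simp add: spin55_rev[OF assms] gamma55_inject)
  qed
  then have surj: "surj (spin_vec eta s)"
    using linear_injective_imp_surjective[OF linear_spin_vec[OF assms]] by simp
  fix v
  obtain w where w: "v = spin_vec eta s w"
    using surj by blast
  have "R55.rho (cl_rev s) ** gamma55 \<mu> v ** R55.rho s =
    (R55.rho (cl_rev s) ** R55.rho s) ** gamma55 \<mu> w ** (R55.rho (cl_rev s) ** R55.rho s)"
    unfolding w rho55_spin_vec[OF assms, symmetric] by (simp add: matrix_mul_assoc)
  then show "\<exists>w. R55.rho (cl_rev s) ** gamma55 \<mu> v ** R55.rho (cl_rev (cl_rev s)) = gamma55 \<mu> w"
    by (auto simp: spin55_rev[OF assms] cl_rev_rev)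
qed

lemma cl_one_spin55: "cl_one \<in> Spin55"
proof (rule spin55I)
  have "cl_rev cl_one = (cl_one :: 10 clifford)"
    using cl_rev_scalar[of 1] by simp
  then show "R55.rho cl_one ** R55.rho (cl_rev cl_one) = mat 1"
    "\<exists>w. R55.rho cl_one ** gamma55 \<mu> v ** R55.rho (cl_rev cl_one) = gamma55 \<mu> w" for v
    by auto
qed (rule cl_one_even)

lemma spin_vec_one: "spin_vec eta cl_one v = v"
  by (rule spin_vec_eqI[OF cl_one_spin55]) simp

lemma cl_rev_star: "s \<in> Spin55 \<Longrightarrow> cl_rev s \<star> s = cl_one" "s \<in> Spin55 \<Longrightarrow> s \<star> cl_rev s = cl_one"
  using spin55_rev[of s] by (simp_all flip: rho55_inject add: rho55_mult)

lemma spin33_commutes: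
  assumes "s \<in> even_cl I33" "v \<in> vecs I22"
  shows "R55.rho s ** gamma55 \<mu> v = gamma55 \<mu> v ** R55.rho s"
proof -
  have "s \<in> cl_carrier I33"
    using assms(1) even_cl_subset_carrier by blast
  then show ?thesis
    using R33.omega_rho_even[OF assms(1)] by (simp add: rho55_I33 gamma55_I22 assms(2) kron_mult)
qed

lemma spin22_commutes:
  assumes "s \<in> even_cl I22" "v \<in> vecs I33"
  shows "R55.rho s ** gamma55 \<mu> v = gamma55 \<mu> v ** R55.rho s"
  using assms by (simp add: rho55_I22 gamma55_I33 kron_mult)

text \<open>The part of both inclusions that they share: \<open>s\<close> maps the component in
  \<open>vecs I\<close> to a vector by definition, and fixes the other component because it commutes
  with it.\<close>

lemma spin_subset_spin55:
  assumes "s \<in> spin eta I" "\<And>v. v \<in> vecs I' \<Longrightarrow> R55.rho s ** gamma55 \<mu> v = gamma55 \<mu> v ** R55.rho s"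
    and split: "\<And>v. v = restrict_vec I v + restrict_vec I' v"
  shows "s \<in> Spin55"
proof (rule spin55I)
  have even: "s \<in> even_cl I"
    using assms(1) spin_subset_even by blast
  then show "s \<in> even_cl UNIV"
    using even_cl_mono by blast
  have "s \<star> cl_rev s = cl_one"
    using assms(1) by (simp add: spin_def)
  then show rev: "R55.rho s ** R55.rho (cl_rev s) = mat 1"
    using rho55_mult by (metis R55.rho_one)
  fix v
  obtain w where "s \<star> cl_vec (restrict_vec I v) \<star> cl_rev s = cl_vec w"
    using assms(1) restrict_vec_in_vecs unfolding spin_def by blast
  then have 1: "R55.rho s ** gamma55 \<mu> (restrict_vec I v) ** R55.rho (cl_rev s) = gamma55 \<mu> w"
    by (metis R55.rho_vec rho55_mult)
  have 2: "R55.rho s ** gamma55 \<mu> (restrict_vec I' v) ** R55.rho (cl_rev s) = gamma55 \<mu> (restrict_vec I' v)"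
    unfolding assms(2)[OF restrict_vec_in_vecs] by (simp add: matrix_mul_assoc[symmetric] rev)
  have "R55.rho s ** gamma55 \<mu> v ** R55.rho (cl_rev s) = gamma55 \<mu> (w + restrict_vec I' v)"
    by (subst split[of v]) (simp only: linear_add[OF linear_gamma55] matrix_add_ldistrib matrix_add_rdistrib 1 2)
  then show "\<exists>w. R55.rho s ** gamma55 \<mu> v ** R55.rho (cl_rev s) = gamma55 \<mu> w" ..
qed

lemma spin33_subset: "Spin33 \<subseteq> Spin55"
proof
  fix s assume s: "s \<in> Spin33"
  show "s \<in> Spin55"
  proof (rule spin_subset_spin55[OF s])
    show "R55.rho s ** gamma55 \<mu> v = gamma55 \<mu> v ** R55.rho s" if "v \<in> vecs I22" for v
      using spin33_commutes that s spin_subset_even by blast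
  qed (rule restrict_vec_split)
qed

lemma spin22_subset: "Spin22 \<subseteq> Spin55"
proof
  fix s assume s: "s \<in> Spin22"
  show "s \<in> Spin55"
  proof (rule spin_subset_spin55[OF s])
    show "R55.rho s ** gamma55 \<mu> v = gamma55 \<mu> v ** R55.rho s" if "v \<in> vecs I33" for v
      using spin22_commutes that s spin_subset_even by blast
  qed (subst add.commute, rule restrict_vec_split)
qed

lemma spin33_spin22_commute:
  assumes "s \<in> Spin33" "t \<in> Spin22"
  shows "s \<star> t = t \<star> s"
proof -
  have "s \<in> cl_carrier I33" "t \<in> even_cl I22"
    using assms spin_subset_even even_cl_subset_carrier by blast+
  then show ?thesis
    by (simp flip: rho55_inject add: rho55_mult rho55_I33 rho55_I22 kron_mult)
qed

text \<open>If the product is one, then \<open>s\<close> is the inverse \<open>cl_rev t\<close> and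
  lies in both even algebras. Their index sets are disjoint, so \<open>s\<close> is a scalar, and
  the scalar squares to one.\<close>

lemma spin33_spin22_kernel:
  assumes "s \<in> Spin33" "t \<in> Spin22"
  shows "s \<star> t = cl_one \<longleftrightarrow> s = cl_one \<and> t = cl_one \<or> s = - cl_one \<and> t = - cl_one"
proof
  assume st: "s \<star> t = cl_one"
  have even: "s \<in> even_cl I33" "t \<in> even_cl I22" and spin: "s \<in> Spin55" "t \<in> Spin55"
    using assms spin_subset_even spin33_subset spin22_subset by blast+
  have "R55.rho s ** (R55.rho t ** R55.rho (cl_rev t)) = R55.rho (cl_rev t)"
    using arg_cong[OF st, of R55.rho] by (simp add: rho55_mult matrix_mul_assoc)
  then have "s = cl_rev t"
    by (simp add: spin55_rev spin rho55_inject)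
  then have "s \<in> even_cl I22"
    using even cl_rev_even by blast
  with even obtain c where c: "s = c *\<^sub>R cl_one"
    by (auto elim: I33_I22_scalar)
  then have t: "t = c *\<^sub>R cl_one"
    using \<open>s = cl_rev t\<close> by (metis cl_rev_rev cl_rev_scalar)
  have "(c * c) *\<^sub>R cl_one = (1 :: real) *\<^sub>R (cl_one :: 10 clifford)"
    using arg_cong[OF st, of R55.rho] unfolding c t
    by (simp flip: rho55_inject
        add: rho55_mult linear_scale[OF R55.linear_rho] matrix_mult_scaleR_left matrix_mult_scaleR_right)
  then have "c * c = 1"
    by (drule_tac arg_cong[where f = "\<lambda>x. x${}"]) (simp add: cl_one_def axis_def)
  then have "c = 1 \<or> c = -1"
    by (simp add: square_eq_1_iff)
  then show "s = cl_one \<and> t = cl_one \<or> s = - cl_one \<and> t = - cl_one"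
    using c t by auto
next
  assume "s = cl_one \<and> t = cl_one \<or> s = - cl_one \<and> t = - cl_one"
  then show "s \<star> t = cl_one"
    by (auto simp flip: rho55_inject simp add: rho55_mult linear_neg[OF R55.linear_rho]
        matrix_mult_minus_left matrix_mult_minus_right)
qed

lemma rho55_theta:
  "R55.rho (theta4 g \<star> theta2 h k) = kron (blk g 0 0 (contragredient g)) (blk h 0 0 k)"
  using theta4 theta2 even_cl_subset_carrier
  by (subst rho55_mult, subst rho55_I33, blast, subst rho55_I22) (auto simp: kron_mult)

lemma theta_spin55:
  assumes "g \<in> SL" "h \<in> SL" "k \<in> SL"
  shows "theta4 g \<star> theta2 h k \<in> Spin55"
  using assms spin55_mult theta4_spin theta2_spin spin33_subset spin22_subset by blast

text \<open>The two tensor factors intertwine \<open>gamma33\<close> and \<open>gamma22\<close>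
  separately. The relations combine because \<open>omega\<close> commutes with the block diagonal
  matrix on the (3,3) side.\<close>

lemma spin_vec_theta:
  assumes "g \<in> SL" "h \<in> SL" "k \<in> SL"
    and A: "Amat w = contragredient g ** Amat v ** matrix_inv g"
    and B: "Bmat \<mu> w = contragredient h ** Bmat \<mu> v ** matrix_inv k"
  shows "spin_vec eta (theta4 g \<star> theta2 h k) v = w"
proof (rule spin_vec_eqI)
  show "theta4 g \<star> theta2 h k \<in> Spin55"
    by (rule theta_spin55[OF assms(1-3)])
  let ?D = "blk g 0 0 (contragredient g)" and ?E = "blk h 0 0 k"
  have D1: "?D ** gamma33 v ** blk (transpose (contragredient g)) 0 0 (transpose g) = gamma33 w"
    using A by (intro gamma33_congruence contragredient_inv(1) det_contragredient assms) simp
  have "gamma33 w ** ?D = ?D ** gamma33 v ** (blk (transpose (contragredient g)) 0 0 (transpose g) ** ?D)"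
    unfolding D1[symmetric] by (simp only: matrix_mul_assoc)
  then have D: "gamma33 w ** ?D = ?D ** gamma33 v"
    using contragredient_inv[OF assms(1)] by (simp add: blk_mult blk_one[symmetric])
  have E1: "?E ** gamma22 \<mu> v ** blk (qconj h) 0 0 (qconj k) = gamma22 \<mu> w"
    using B assms by (intro gamma22_congruence) (simp add: matrix_inv_2)
  have "gamma22 \<mu> w ** ?E = ?E ** gamma22 \<mu> v ** (blk (qconj h) 0 0 (qconj k) ** ?E)"
    unfolding E1[symmetric] by (simp only: matrix_mul_assoc)
  then have E: "gamma22 \<mu> w ** ?E = ?E ** gamma22 \<mu> v"
    using assms by (simp add: blk_mult blk_one[symmetric] qconj_mult SL_def)
  show "R55.rho (theta4 g \<star> theta2 h k) ** gamma55 \<mu> v = gamma55 \<mu> w ** R55.rho (theta4 g \<star> theta2 h k)"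
    unfolding rho55_theta gamma55_def
    by (simp add: matrix_add_ldistrib matrix_add_rdistrib kron_mult D E omega_commute_blk_diag)
qed

end

section \<open>Peirce decomposition of Hermitian matrices\<close>

lemma herm_eq_iff: "X = Y \<longleftrightarrow> (\<forall>j k. entry X j k = entry Y j k)"
  by transfer (auto simp: vec_eq_iff)

lemma entry_conj: "entry X k j = oconj (entry X j k)"
  by transfer simp

lemma entry_zero [simp]: "entry 0 j k = 0"
  and entry_add [simp]: "entry (X + Y) j k = entry X j k + entry Y j k"
  and entry_diff [simp]: "entry (X - Y) j k = entry X j k - entry Y j k"
  and entry_scaleR [simp]: "entry (c *\<^sub>R X) j k = c *\<^sub>R entry X j k"
  by (transfer; simp)+

lemma entry_diag_unit: "entry (diag_unit i) j k = (if j = i \<and> k = i then oone else 0)"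
  by transfer simp

lemma entry_jordan: "entry (jordan \<mu> X Y) j k =
    (1/2) *\<^sub>R (\<Sum>l\<in>UNIV. omult \<mu> (entry X j l) (entry Y l k) + omult \<mu> (entry Y j l) (entry X l k))"
  by transfer simp

lemma entry_block: "entry (block i Y) j k = (if j = i \<or> k = i then 0
    else entry Y (if j = i + 1 then 1 else 2) (if k = i + 1 then 1 else 2))"
  by transfer simp

lemma oconj_fixed:
  assumes "oconj x = x"
  shows "x = ore x *\<^sub>R oone"
proof -
  have f: "qconj (fst x) = fst x" and "- snd x = snd x"
    using arg_cong[OF assms, of fst] arg_cong[OF assms, of snd] by (simp_all add: oconj_def)
  then have "snd x = 0"
    by (simp add: vec_eq_iff)
  have "qconj (fst x) $ i $ j = fst x $ i $ j" for i j
    using f by simp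
  from this[of 1 1] this[of 1 2] this[of 2 1] have "fst x$2$2 = fst x$1$1" "fst x$1$2 = 0" "fst x$2$1 = 0"
    by (simp_all add: qconj_nth)
  then show ?thesis
    using \<open>snd x = 0\<close> by (simp add: oct_eq_iff forall_2 ore_def trace_2 oone_def mat_def)
qed

lemma entry_diagonal: "entry X j j = ore (entry X j j) *\<^sub>R oone"
  by (rule oconj_fixed) (rule entry_conj[symmetric])

lemma omult_zero [simp]: "omult \<mu> 0 x = 0" "omult \<mu> x 0 = 0"
  by (simp_all add: oct_coords)

lemma omult_oone [simp]: "omult \<mu> (c *\<^sub>R oone) x = c *\<^sub>R x" "omult \<mu> x (c *\<^sub>R oone) = c *\<^sub>R x"
  "omult \<mu> oone x = x" "omult \<mu> x oone = x"
  by (simp_all add: oct_coords)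

lemma oone_neq_0: "oone \<noteq> 0"
  by (simp add: oct_coords)

lemma ore_oone [simp]: "ore (c *\<^sub>R oone) = c" "ore oone = 1"
  by (simp_all add: oct_coords)

lemma ore_add [simp]: "ore (x + y) = ore x + ore y"
  and ore_scaleR [simp]: "ore (c *\<^sub>R x) = c * ore x"
  and ore_zero [simp]: "ore 0 = 0"
  by (simp_all add: oct_coords field_simps)

lift_definition diag_matrix :: "('n::finite \<Rightarrow> real) \<Rightarrow> 'n herm" is
  "\<lambda>d. \<chi> j k. if j = k then d j *\<^sub>R oone else 0"
  by (simp add: oct_coords)

lemma entry_diag_matrix: "entry (diag_matrix d) j k = (if j = k then d j *\<^sub>R oone else 0)"
  by transfer simp

lemma diag_matrix_eq_iff: "diag_matrix d = diag_matrix d' \<longleftrightarrow> d = d'"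
  by (auto simp: herm_eq_iff entry_diag_matrix oone_neq_0 fun_eq_iff split: if_splits)

lemma diag_matrix_add: "diag_matrix d + diag_matrix d' = diag_matrix (\<lambda>j. d j + d' j)"
  by (simp add: herm_eq_iff entry_diag_matrix scaleR_add_left)

lemma diag_matrix_zero: "diag_matrix (\<lambda>_. 0) = 0"
  by (simp add: herm_eq_iff entry_diag_matrix)

lemma diag_unit_eq: "diag_unit i = diag_matrix (\<lambda>j. if j = i then 1 else 0)"
  by (auto simp: herm_eq_iff entry_diag_matrix entry_diag_unit)

lemma jordan_diag_matrix:
  "entry (jordan \<mu> (diag_matrix d) X) j k = ((d j + d k) / 2) *\<^sub>R entry X j k"
proof -
  have "(\<Sum>l\<in>UNIV. omult \<mu> (entry (diag_matrix d) j l) (entry X l k) + omult \<mu> (entry X j l) (entry (diag_matrix d) l k))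
    = (\<Sum>l\<in>UNIV. (if l = j then d j *\<^sub>R entry X j k else 0) + (if l = k then d k *\<^sub>R entry X j k else 0))"
    by (intro sum.cong) (auto simp: entry_diag_matrix)
  also have "\<dots> = (d j + d k) *\<^sub>R entry X j k"
    by (simp add: sum.distrib scaleR_add_left)
  finally show ?thesis
    by (simp add: entry_jordan)
qed

lemma jordan_diag_matrix_diag_matrix:
  "jordan \<mu> (diag_matrix d) (diag_matrix d') = diag_matrix (\<lambda>j. d j * d' j)"
  by (simp add: herm_eq_iff jordan_diag_matrix) (simp add: entry_diag_matrix)

lemma diagonal_eq_diag_matrix:
  assumes "diagonal p"
  obtains d where "p = diag_matrix d"
proof
  show "p = diag_matrix (\<lambda>j. ore (entry p j j))"
    using assms entry_diagonal[of p] by (auto simp: herm_eq_iff entry_diag_matrix diagonal_def)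
qed

text \<open>The diagonal entries are 0 or 1 and not all 0. Splitting off one entry 1 writes
  \<open>p\<close> as a sum of orthogonal idempotents, so primitivity leaves nothing else.\<close>

lemma primitive_diagonal_idempotent:
  assumes "primitive_idempotent \<mu> p" "diagonal p"
  obtains i where "p = diag_unit i"
proof -
  obtain d where p: "p = diag_matrix d"
    using diagonal_eq_diag_matrix[OF assms(2)] .
  have "jordan \<mu> p p = p" "p \<noteq> 0"
    using assms(1) by (simp_all add: primitive_idempotent_def)
  then have dd: "d j * d j = d j" for j
    unfolding p jordan_diag_matrix_diag_matrix diag_matrix_eq_iff by metis
  have "d \<noteq> (\<lambda>_. 0)"
    using \<open>p \<noteq> 0\<close> diag_matrix_zero p by metis
  then obtain i where "d i \<noteq> 0"
    by auto
  then have i: "d i = 1"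
    using dd[of i] by simp
  define f where "f j = (if j = i then 0 else d j)" for j
  have "diag_unit i \<noteq> 0" "jordan \<mu> (diag_unit i) (diag_unit i) = diag_unit i"
    "jordan \<mu> (diag_unit i) (diag_matrix f) = 0"
    "jordan \<mu> (diag_matrix f) (diag_matrix f) = diag_matrix f" "p = diag_unit i + diag_matrix f"
    using i dd unfolding p diag_unit_eq jordan_diag_matrix_diag_matrix diag_matrix_add diag_matrix_zero[symmetric]
      diag_matrix_eq_iff
    by (auto simp: f_def fun_eq_iff)
  then have "diag_matrix f = 0"
    using assms(1) unfolding primitive_idempotent_def by blast
  then show ?thesis
    using that[of i] \<open>p = diag_unit i + diag_matrix f\<close> by simp
qed

text \<open>Multiplication by a diagonal matrix scales each entry separately, here by half the
  number of its indices that equal \<open>i\<close>.\<close>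

lemma mem_peirce_iff: "X \<in> peirce \<mu> \<nu> (diag_unit i) \<longleftrightarrow>
    (\<forall>j k. entry X j k = 0 \<or> \<nu> = ((if j = i then 1 else 0) + (if k = i then 1 else 0)) / 2)"
  unfolding peirce_def mem_Collect_eq herm_eq_iff diag_unit_eq jordan_diag_matrix entry_scaleR
    scaleR_right_imp_eq scaleR_cancel_right by metis

section \<open>Cyclic indexing, which treats the three diagonal idempotents alike\<close>

lemma index_3 [simp]:
  "i + 1 \<noteq> i" "i + 2 \<noteq> i" "i \<noteq> i + 1" "i \<noteq> i + 2" "i + 2 \<noteq> i + 1" "i + 1 \<noteq> i + 2" for i :: 3
  by (cases i rule: exhaust_3[THEN disjE]; simp)+

lemma UNIV_3_shift: "(UNIV :: 3 set) = {i, i + 1, i + 2}"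
proof -
  have "card {i, i + 1, i + 2} = CARD(3)"
    by simp
  then show ?thesis
    by (metis card_subset_eq finite_code subset_UNIV)
qed

lemma forall_3_shift: "(\<forall>j :: 3. P j) \<longleftrightarrow> P i \<and> P (i + 1) \<and> P (i + 2)"
  using UNIV_3_shift[of i] by (metis UNIV_I empty_iff insertE)

lemma sum_3_shift: "(\<Sum>j\<in>(UNIV :: 3 set). f j) = f i + f (i + 1) + f (i + 2)"
  unfolding UNIV_3_shift[of i] by (simp add: add.assoc)

lift_definition herm2 :: "real \<Rightarrow> oct \<Rightarrow> real \<Rightarrow> 2 herm" is
  "\<lambda>\<alpha> y \<beta>. \<chi> j k. if j = 1 then (if k = 1 then \<alpha> *\<^sub>R oone else y) else (if k = 1 then oconj y else \<beta> *\<^sub>R oone)"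
  by (simp add: forall_2 oconj_scaleR) (simp add: oct_coords)

lemma entry_herm2 [simp]:
  "entry (herm2 \<alpha> y \<beta>) 1 1 = \<alpha> *\<^sub>R oone" "entry (herm2 \<alpha> y \<beta>) 1 2 = y"
  "entry (herm2 \<alpha> y \<beta>) 2 1 = oconj y" "entry (herm2 \<alpha> y \<beta>) 2 2 = \<beta> *\<^sub>R oone"
  by (transfer; simp)+

lemma herm2_cases: "Y = herm2 (ore (entry Y 1 1)) (entry Y 1 2) (ore (entry Y 2 2))"
  using entry_conj[of Y 2 1]
  by (simp add: herm_eq_iff forall_2 entry_diagonal[symmetric])

lemma herm2_eq_iff: "herm2 \<alpha> y \<beta> = herm2 \<alpha>' y' \<beta>' \<longleftrightarrow> \<alpha> = \<alpha>' \<and> y = y' \<and> \<beta> = \<beta>'"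
  by (auto simp: herm_eq_iff forall_2 oone_neq_0)

lemma herm2_add: "herm2 \<alpha> y \<beta> + herm2 \<alpha>' y' \<beta>' = herm2 (\<alpha> + \<alpha>') (y + y') (\<beta> + \<beta>')"
  and herm2_scaleR: "c *\<^sub>R herm2 \<alpha> y \<beta> = herm2 (c * \<alpha>) (c *\<^sub>R y) (c * \<beta>)"
  by (simp_all add: herm_eq_iff forall_2 scaleR_add_left oconj_add oconj_scaleR)

text \<open>The positions follow the cyclic pattern in \<open>N3\<close>: with \<open>y\<close> the
  off-diagonal entry of the complementary block, the cubic term becomes the real part of the product
  of \<open>a\<close>, \<open>y\<close> and \<open>b\<close>.\<close>

lift_definition half :: "3 \<Rightarrow> oct \<Rightarrow> oct \<Rightarrow> 3 herm" is
  "\<lambda>i a b. \<chi> j k. if j = i \<and> k = i + 1 then a else if j = i + 1 \<and> k = i then oconj a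
    else if j = i + 2 \<and> k = i then b else if j = i \<and> k = i + 2 then oconj b else 0"
  by auto

lemma entry_half: "entry (half i a b) j k = (if j = i \<and> k = i + 1 then a else if j = i + 1 \<and> k = i then oconj a
    else if j = i + 2 \<and> k = i then b else if j = i \<and> k = i + 2 then oconj b else 0)"
  by transfer simp

lemma half_eq_iff: "half i a b = half i a' b' \<longleftrightarrow> a = a' \<and> b = b'"
  by (auto simp: herm_eq_iff forall_3_shift[of _ i] entry_half)

lemma half_add: "half i a b + half i a' b' = half i (a + a') (b + b')"
  and half_scaleR: "c *\<^sub>R half i a b = half i (c *\<^sub>R a) (c *\<^sub>R b)"
  by (simp_all add: herm_eq_iff entry_half oconj_add oconj_scaleR)

lemma linear_block: "linear (block i)"
  by (rule linearI) (simp_all add: herm_eq_iff entry_block)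

lemma entry_block_shift [simp]:
  "entry (block i Y) i k = 0" "entry (block i Y) j i = 0"
  "entry (block i Y) (i + 1) (i + 1) = entry Y 1 1" "entry (block i Y) (i + 1) (i + 2) = entry Y 1 2"
  "entry (block i Y) (i + 2) (i + 1) = entry Y 2 1" "entry (block i Y) (i + 2) (i + 2) = entry Y 2 2"
  by (simp_all add: entry_block)

lemma inj_block: "inj (block i)"
  by (rule injI) (simp add: herm_eq_iff[where 'a = 3] forall_3_shift[of _ i] herm_eq_iff[where 'a = 2] forall_2)

lemma block_jordan: "block i (jordan \<mu> Y Z) = jordan \<mu> (block i Y) (block i Z)"
  by (simp add: herm_eq_iff forall_3_shift[of _ i] entry_jordan sum_3_shift[of _ i] sum_2)

lemma peirce_one: "peirce \<mu> 1 (diag_unit (i :: 3)) = range (\<lambda>c. c *\<^sub>R diag_unit i)"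
proof (intro equalityI subsetI)
  fix X assume "X \<in> peirce \<mu> 1 (diag_unit i)"
  then have "X = ore (entry X i i) *\<^sub>R diag_unit i"
    using entry_diagonal[of X i]
    by (auto simp: mem_peirce_iff herm_eq_iff entry_diag_unit split: if_splits)
  then show "X \<in> range (\<lambda>c. c *\<^sub>R diag_unit i)"
    by (rule range_eqI)
qed (auto simp: mem_peirce_iff entry_diag_unit)

lemma range_block: "range (block i) = peirce \<mu> 0 (diag_unit i)"
proof (intro equalityI subsetI)
  fix X assume X: "X \<in> peirce \<mu> 0 (diag_unit i)"
  have z: "entry X i k = 0" "entry X k i = 0" for k
    using X[unfolded mem_peirce_iff, rule_format, of i k] X[unfolded mem_peirce_iff, rule_format, of k i]
    by (auto split: if_splits)
  have "X = block i (herm2 (ore (entry X (i + 1) (i + 1))) (entry X (i + 1) (i + 2)) (ore (entry X (i + 2) (i + 2))))"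
    using entry_conj[of X "i + 2" "i + 1"]
    by (simp add: herm_eq_iff forall_3_shift[of _ i] z entry_diagonal[symmetric])
  then show "X \<in> range (block i)"
    by (rule range_eqI)
qed (auto simp: mem_peirce_iff entry_block)

lemma peirce_half: "peirce \<mu> (1/2) (diag_unit i) = range (\<lambda>(a, b). half i a b)"
proof (intro equalityI subsetI)
  fix X assume X: "X \<in> peirce \<mu> (1/2) (diag_unit i)"
  have z: "entry X j k = 0" if "(j = i) = (k = i)" for j k
    using X[unfolded mem_peirce_iff, rule_format, of j k] that by (auto split: if_splits)
  have "X = half i (entry X i (i + 1)) (entry X (i + 2) i)"
    using entry_conj[of X "i + 1" i] entry_conj[of X i "i + 2"]
    by (simp add: herm_eq_iff forall_3_shift[of _ i] z entry_half)
  then show "X \<in> range (\<lambda>(a, b). half i a b)"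
    by (intro range_eqI[of _ _ "(entry X i (i + 1), entry X (i + 2) i)"]) simp
qed (auto simp: mem_peirce_iff entry_half split: if_splits)

lemma herm3_decompose:
  "X = ore (entry X i i) *\<^sub>R diag_unit i + half i (entry X i (i + 1)) (entry X (i + 2) i)
    + block i (herm2 (ore (entry X (i + 1) (i + 1))) (entry X (i + 1) (i + 2)) (ore (entry X (i + 2) (i + 2))))"
  using entry_conj[of X "i + 2" "i + 1"] entry_conj[of X "i + 1" i] entry_conj[of X i "i + 2"]
  by (simp add: herm_eq_iff forall_3_shift[of _ i] entry_half entry_diag_unit entry_diagonal[symmetric])

lemma herm3_decompose_unique:
  assumes "c *\<^sub>R diag_unit i + half i a b + block i Y = c' *\<^sub>R diag_unit i + half i a' b' + block i Y'"
  shows "c = c' \<and> a = a' \<and> b = b' \<and> Y = Y'"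
proof -
  have *: "entry (c *\<^sub>R diag_unit i + half i a b + block i Y) j k = entry (c' *\<^sub>R diag_unit i + half i a' b' + block i Y') j k" for j k
    using assms by simp
  show ?thesis
    using *[of i i] *[of i "i+1"] *[of "i+2" i] *[of "i+1" "i+1"] *[of "i+1" "i+2"] *[of "i+2" "i+1"] *[of "i+2" "i+2"]
    by (simp add: entry_half entry_diag_unit oone_neq_0 herm_eq_iff forall_2)
qed

text \<open>The real part of a triple product is insensitive to rotation although the octonions are
  neither commutative nor associative. It gives \<open>N3\<close> its cyclic symmetry.\<close>

lemma ore_omult_cyclic: "ore (omult \<mu> (omult \<mu> x y) z) = ore (omult \<mu> (omult \<mu> y z) x)"
  by (simp add: omult_def ore_def trace_2 matrix_mult_2 qconj_nth algebra_simps)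

lemma N3_shift: "N3 \<mu> X =
     ore (entry X i i) * (ore (entry X (i + 1) (i + 1)) * ore (entry X (i + 2) (i + 2)) - onorm2 \<mu> (entry X (i + 1) (i + 2)))
     - ore (entry X (i + 1) (i + 1)) * onorm2 \<mu> (entry X (i + 2) i)
     - ore (entry X (i + 2) (i + 2)) * onorm2 \<mu> (entry X i (i + 1))
     + 2 * ore (omult \<mu> (omult \<mu> (entry X i (i + 1)) (entry X (i + 1) (i + 2))) (entry X (i + 2) i))"
proof -
  have "(1::3) + 1 = 2" "(1::3) + 2 = 3" "(2::3) + 1 = 3" "(2::3) + 2 = 1" "(3::3) + 1 = 1" "(3::3) + 2 = 2"
    by simp_all
  moreover have "i = 1 \<or> i = 2 \<or> i = 3"
    by (rule exhaust_3)
  ultimately show ?thesis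
    using ore_omult_cyclic[of \<mu> "entry X 1 2" "entry X 2 3" "entry X 3 1"]
      ore_omult_cyclic[of \<mu> "entry X 2 3" "entry X 3 1" "entry X 1 2"]
    by (elim disjE) (simp_all only: N3_def, simp_all add: algebra_simps)
qed

lemma N3_decompose: "N3 \<mu> (c *\<^sub>R diag_unit i + half i a b + block i (herm2 \<alpha> y \<beta>)) =
    c * (\<alpha> * \<beta> - onorm2 \<mu> y) - \<alpha> * onorm2 \<mu> b - \<beta> * onorm2 \<mu> a + 2 * ore (omult \<mu> (omult \<mu> a y) b)"
  unfolding N3_shift[of _ _ i] by (simp add: entry_half entry_diag_unit)

lemma N2_herm2: "N2 \<mu> (herm2 \<alpha> y \<beta>) = \<alpha> * \<beta> - onorm2 \<mu> y"
  by (simp add: N2_def)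

section \<open>Tensor coordinates\<close>

lemma herm2_mem_J2_Hs: "herm2 \<alpha> y \<beta> \<in> J2_Hs \<longleftrightarrow> snd y = 0"
  by (auto simp: J2_Hs_def Hs_def forall_2 oone_def oconj_def)

lemma herm2_mem_J2_Hs_l: "herm2 \<alpha> y \<beta> \<in> J2_Hs_l \<longleftrightarrow> \<alpha> = 0 \<and> fst y = 0 \<and> \<beta> = 0"
  by (auto simp: J2_Hs_l_def Hs_l_def oone_neq_0)

lemma J2_decompose: "\<exists>!t. case t of (A, B) \<Rightarrow> A \<in> J2_Hs \<and> B \<in> J2_Hs_l \<and> Y = A + B"
proof -
  obtain \<alpha> y \<beta> where Y: "Y = herm2 \<alpha> y \<beta>"
    using herm2_cases by blast
  show ?thesis
  proof (rule ex1I[of _ "(herm2 \<alpha> (fst y, 0) \<beta>, herm2 0 (0, snd y) 0)"])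
    show "case (herm2 \<alpha> (fst y, 0) \<beta>, herm2 0 (0, snd y) 0) of (A, B) \<Rightarrow> A \<in> J2_Hs \<and> B \<in> J2_Hs_l \<and> Y = A + B"
      by (simp add: Y herm2_mem_J2_Hs herm2_mem_J2_Hs_l herm2_add)
    fix t
    assume t: "case t of (A, B) \<Rightarrow> A \<in> J2_Hs \<and> B \<in> J2_Hs_l \<and> Y = A + B"
    obtain a1 y1 b1 a2 y2 b2 where t_eq: "t = (herm2 a1 y1 b1, herm2 a2 y2 b2)"
      using herm2_cases by (metis surj_pair)
    show "t = (herm2 \<alpha> (fst y, 0) \<beta>, herm2 0 (0, snd y) 0)"
      using t unfolding t_eq Y
      by (auto simp: herm2_mem_J2_Hs herm2_mem_J2_Hs_l herm2_add herm2_eq_iff prod_eq_iff)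
  qed
qed

lemma J2_orthogonal: "A \<in> J2_Hs \<Longrightarrow> B \<in> J2_Hs_l \<Longrightarrow> polar (N2 \<mu>) A B = 0"
proof -
  assume AB: "A \<in> J2_Hs" "B \<in> J2_Hs_l"
  obtain a1 y1 b1 a2 y2 b2 where *: "A = herm2 a1 y1 b1" "B = herm2 a2 y2 b2"
    using herm2_cases by metis
  show ?thesis
    using AB unfolding * by (auto simp: herm2_mem_J2_Hs herm2_mem_J2_Hs_l polar_def herm2_add N2_herm2 onorm2_eq det_2)
qed

section \<open>Signatures, transport of modules, and the tensor form of the norms\<close>

lemma vecs_eq_span: "vecs I = span ((\<lambda>i. axis i (1::real)) ` I)"
proof
  show "span ((\<lambda>i. axis i 1) ` I) \<subseteq> vecs I"
    by (intro span_minimal subspace_vecs) (auto simp: axis_in_vecs)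
  show "vecs I \<subseteq> span ((\<lambda>i. axis i 1) ` I)"
  proof
    fix v :: "real^'a" assume v: "v \<in> vecs I"
    have "(\<Sum>i\<in>UNIV. v$i *\<^sub>R axis i 1) \<in> span ((\<lambda>i. axis i 1) ` I)"
    proof (rule span_sum)
      fix i
      show "v$i *\<^sub>R axis i 1 \<in> span ((\<lambda>i. axis i 1) ` I)"
        using v by (cases "i \<in> I") (auto simp: vecs_def span_zero intro: span_scale span_base)
    qed
    then show "v \<in> span ((\<lambda>i. axis i 1) ` I)"
      using vec_eq_sum_axis[of v] by metis
  qed
qed

lemma has_signature_coords:
  fixes e :: "real^'n \<Rightarrow> 'v::real_vector" and f :: "nat \<Rightarrow> 'n"
  assumes "linear e" "\<And>v. q (e v) = (\<Sum>j\<in>UNIV. \<eta> j * (v$j)\<^sup>2)" "inj_on f {..<r + s}"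
    "\<And>k. k < r \<Longrightarrow> \<eta> (f k) = 1" "\<And>k. r \<le> k \<Longrightarrow> k < r + s \<Longrightarrow> \<eta> (f k) = -1"
  shows "has_signature q (e ` vecs (f ` {..<r + s})) r s"
  unfolding has_signature_def
proof (intro exI[of _ "\<lambda>k. e (axis (f k) 1)"] conjI allI)
  show "e ` vecs (f ` {..<r + s}) = span ((\<lambda>k. e (axis (f k) 1)) ` {..<r + s})"
    unfolding vecs_eq_span linear_span_image[OF assms(1), symmetric] by (simp add: image_image)
  fix c :: "nat \<Rightarrow> real"
  define v where "v = (\<Sum>k<r + s. c k *\<^sub>R axis (f k) (1::real))"
  have v: "v$j = (\<Sum>k<r + s. if f k = j then c k else 0)" for j
    by (auto simp: v_def axis_def intro: sum.cong)
  have vf: "v$(f k) = c k" if "k < r + s" for k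
  proof -
    have "v$(f k) = (\<Sum>l<r + s. if l = k then c k else 0)"
      unfolding v using assms(3) that by (intro sum.cong) (auto simp: inj_on_def)
    then show ?thesis using that by simp
  qed
  have v0: "v$j = 0" if "j \<notin> f ` {..<r + s}" for j
    unfolding v using that by (intro sum.neutral) auto
  have "q (\<Sum>k<r + s. c k *\<^sub>R e (axis (f k) 1)) = q (e v)"
    by (simp add: v_def linear_sum[OF assms(1)] linear_scale[OF assms(1)])
  also have "\<dots> = (\<Sum>j\<in>f ` {..<r + s}. \<eta> j * (v$j)\<^sup>2)"
    unfolding assms(2) by (rule sum.mono_neutral_right) (auto simp: v0)
  also have "\<dots> = (\<Sum>k<r + s. \<eta> (f k) * (c k)\<^sup>2)"
    using assms(3) by (simp add: sum.reindex vf)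
  also have "\<dots> = (\<Sum>k\<in>{..<r} \<union> {r..<r + s}. \<eta> (f k) * (c k)\<^sup>2)"
    by (rule sum.cong) auto
  also have "\<dots> = (\<Sum>k<r. \<eta> (f k) * (c k)\<^sup>2) + (\<Sum>k\<in>{r..<r + s}. \<eta> (f k) * (c k)\<^sup>2)"
    by (rule sum.union_disjoint) auto
  also have "\<dots> = (\<Sum>k<r. (c k)\<^sup>2) - (\<Sum>k\<in>{r..<r + s}. (c k)\<^sup>2)"
    using assms(4,5) by (simp add: sum_negf)
  finally show "q (\<Sum>k<r + s. c k *\<^sub>R e (axis (f k) 1)) = (\<Sum>k<r. (c k)\<^sup>2) - (\<Sum>k\<in>{r..<r + s}. (c k)\<^sup>2)" .
qed

text \<open>Submodules of the image are pulled back to \<open>U\<close>. Injectivity is asked for on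
  \<open>U\<close> alone, since the maps in question, such as \<open>spinor_of\<close>, forget the
  other eigenspace of the grading.\<close>

lemma weyl_module_transport:
  assumes W: "weyl_module \<eta> I \<sigma> U R" and "even (card I)" and f: "linear f" "inj_on f U" "f ` U = U'"
    and R': "\<And>x u. x \<in> even_cl I \<Longrightarrow> u \<in> U \<Longrightarrow> R' x (f u) = f (R x u)"
  shows "weyl_module \<eta> I \<sigma> U' R'"
proof -
  have U: "subspace U" "U \<noteq> {0}"
    and R: "\<And>x y u v c. x \<in> even_cl I \<Longrightarrow> y \<in> even_cl I \<Longrightarrow> u \<in> U \<Longrightarrow> v \<in> U \<Longrightarrow>
        R x u \<in> U \<and> R x (u + v) = R x u + R x v \<and> R x (c *\<^sub>R u) = c *\<^sub>R R x u \<and>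
        R (x + y) u = R x u + R y u \<and> R (c *\<^sub>R x) u = c *\<^sub>R R x u \<and>
        R cl_one u = u \<and> R (cl_mult \<eta> x y) u = R x (R y u)"
    and vol: "\<And>u. u \<in> U \<Longrightarrow> R (cl_volume I) u = \<sigma> *\<^sub>R u"
    and irr: "\<And>W. subspace W \<Longrightarrow> W \<subseteq> U \<Longrightarrow> (\<forall>x\<in>even_cl I. \<forall>w\<in>W. R x w \<in> W) \<Longrightarrow> W = {0} \<or> W = U"
    using W unfolding weyl_module_def by blast+
  show ?thesis
    unfolding weyl_module_def f(3)[symmetric] ball_simps
  proof (intro conjI ballI allI impI)
    show "subspace (f ` U)"
      by (rule linear_subspace_image[OF f(1) U(1)])
    show "f ` U \<noteq> {0}"
    proof
      assume "f ` U = {0}"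
      then have "u = 0" if "u \<in> U" for u
        using f(2) that subspace_0[OF U(1)] linear_0[OF f(1)] unfolding inj_on_def by (metis image_eqI singletonD)
      then show False
        using U subspace_0 by blast
    qed
    fix x y u v c
    assume x: "x \<in> even_cl I" and y: "y \<in> even_cl I" and u: "u \<in> U" and v: "v \<in> U"
    have R1: "R x u \<in> U" and R2: "R x (u + v) = R x u + R x v" and R3: "R x (c *\<^sub>R u) = c *\<^sub>R R x u"
      and R4: "R (x + y) u = R x u + R y u" and R5: "R (c *\<^sub>R x) u = c *\<^sub>R R x u"
      and R6: "R cl_one u = u" and R7: "R (cl_mult \<eta> x y) u = R x (R y u)" and R8: "R y u \<in> U"
      using R[OF x y u v] R[OF y y u u] by auto
    show "R' x (f u) \<in> f ` U"
      unfolding R'[OF x u] by (rule imageI[OF R1])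
    show "R' x (f u + f v) = R' x (f u) + R' x (f v)"
      unfolding linear_add[OF f(1), symmetric] R'[OF x u] R'[OF x v]
        R'[OF x subspace_add[OF U(1) u v]] R2 ..
    show "R' x (c *\<^sub>R f u) = c *\<^sub>R R' x (f u)"
      unfolding linear_scale[OF f(1), symmetric] R'[OF x u] R'[OF x subspace_scale[OF U(1) u]] R3 ..
    show "R' (x + y) (f u) = R' x (f u) + R' y (f u)"
      unfolding R'[OF x u] R'[OF y u] R'[OF subspace_add[OF subspace_even_cl x y] u] R4
      by (rule linear_add[OF f(1)])
    show "R' (c *\<^sub>R x) (f u) = c *\<^sub>R R' x (f u)"
      unfolding R'[OF x u] R'[OF subspace_scale[OF subspace_even_cl x] u] R5
      by (rule linear_scale[OF f(1)])
    show "R' cl_one (f u) = f u"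
      unfolding R'[OF cl_one_even u] R6 ..
    show "R' (cl_mult \<eta> x y) (f u) = R' x (R' y (f u))"
      unfolding R'[OF cl_mult_even[OF x y] u] R'[OF y u] R'[OF x R8] R7 ..
  next
    fix u assume "u \<in> U"
    then show "R' (cl_volume I) (f u) = \<sigma> *\<^sub>R f u"
      using R'[OF cl_volume_even[OF assms(2)]] vol by (simp add: linear_scale[OF f(1)])
  next
    fix W'
    assume W': "subspace W' \<and> W' \<subseteq> f ` U \<and> (\<forall>x\<in>even_cl I. \<forall>w\<in>W'. R' x w \<in> W')"
    define W where "W = {u \<in> U. f u \<in> W'}"
    have "subspace W"
      using W' U(1) by (auto simp: W_def subspace_def linear_0[OF f(1)] linear_add[OF f(1)] linear_scale[OF f(1)])
    moreover have "R x w \<in> W" if "x \<in> even_cl I" "w \<in> W" for x w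
    proof -
      have w: "w \<in> U" "f w \<in> W'"
        using that(2) by (simp_all add: W_def)
      then have "R' x (f w) \<in> W'"
        using W' that(1) by blast
      then show ?thesis
        using R[OF that(1) that(1) w(1) w(1)] R'[OF that(1) w(1)] by (simp add: W_def)
    qed
    ultimately have "W = {0} \<or> W = U"
      using irr[of W] by (auto simp: W_def)
    moreover have "W' = f ` W"
      using W' by (auto simp: W_def)
    ultimately show "W' = {0} \<or> W' = f ` U"
      by (auto simp: linear_0[OF f(1)])
  qed
qed

text \<open>In 2 by 2 blocks \<open>\<psi> = (P, Q)\<close>, \<open>\<xi> = (R, S)\<close> and with \<open>J = sympl\<close>, the entry \<open>(i, i + 1)\<close> is
  \<open>J Q\<^sup>T + (J\<^sup>T R\<^sup>T) l\<close> and the entry \<open>(i + 2, i)\<close> is \<open>P + (qconj S) l\<close>; below, the off-diagonal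
  entry of \<open>bispinor_herm B\<close> is \<open>(B\<^sup>T J) l\<close>.\<close>

definition spinor_herm :: "3 \<Rightarrow> real^2^4 \<Rightarrow> real^2^4 \<Rightarrow> 3 herm" where
  "spinor_herm i \<psi> \<xi> = half i
     (vector [vector [\<psi>$3$2, \<psi>$4$2], vector [- \<psi>$3$1, - \<psi>$4$1]],
      vector [vector [- \<xi>$1$2, - \<xi>$2$2], vector [\<xi>$1$1, \<xi>$2$1]])
     (vector [vector [\<psi>$1$1, \<psi>$1$2], vector [\<psi>$2$1, \<psi>$2$2]],
      vector [vector [\<xi>$4$2, - \<xi>$3$2], vector [- \<xi>$4$1, \<xi>$3$1]])"

text \<open>Chosen so that \<open>N2\<close> becomes the Pfaffian: the diagonal gives the product of
  the entries 12 and 34, and the determinant of the off-diagonal quaternion gives the rest.\<close>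

definition skew_herm :: "real^4^4 \<Rightarrow> 2 herm" where
  "skew_herm A = herm2 (- A$1$2) (vector [vector [A$1$3, A$2$3], vector [A$1$4, A$2$4]], 0) (- A$3$4)"

definition bispinor_herm :: "real^2^2 \<Rightarrow> 2 herm" where
  "bispinor_herm B = herm2 0 (0, vector [vector [- B$2$1, B$1$1], vector [- B$2$2, B$1$2]]) 0"

lemma linear_spinor_herm: "linear (\<lambda>(\<psi>, \<xi>). spinor_herm i \<psi> \<xi>)"
  by (rule linearI)
    (simp_all add: case_prod_beta spinor_herm_def half_add half_scaleR half_eq_iff prod_eq_iff vec_eq_iff forall_2)

lemma inj_spinor_herm: "inj (\<lambda>(\<psi>, \<xi>). spinor_herm i \<psi> \<xi>)"
  by (rule injI)
    (auto simp: spinor_herm_def half_eq_iff prod_eq_iff vec_eq_iff forall_2 forall_4)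

lemma range_spinor_herm: "range (\<lambda>(\<psi>, \<xi>). spinor_herm i \<psi> \<xi>) = peirce \<mu> (1/2) (diag_unit i)"
proof -
  have "half i a b \<in> range (\<lambda>(\<psi>, \<xi>). spinor_herm i \<psi> \<xi>)" for a b
  proof (rule range_eqI)
    let ?\<psi> = "vector [vector [fst b$1$1, fst b$1$2], vector [fst b$2$1, fst b$2$2],
      vector [- fst a$2$1, fst a$1$1], vector [- fst a$2$2, fst a$1$2]] :: real^2^4"
    let ?\<xi> = "vector [vector [snd a$2$1, - snd a$1$1], vector [snd a$2$2, - snd a$1$2],
      vector [snd b$2$2, - snd b$1$2], vector [- snd b$2$1, snd b$1$1]] :: real^2^4"
    show "half i a b = (\<lambda>(\<psi>, \<xi>). spinor_herm i \<psi> \<xi>) (?\<psi>, ?\<xi>)"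
      by (simp add: spinor_herm_def half_eq_iff prod_eq_iff vec_eq_iff forall_2)
  qed
  then show ?thesis
    unfolding peirce_half by (auto simp: spinor_herm_def)
qed

lemma linear_skew_herm: "linear skew_herm"
  by (rule linearI)
    (auto simp: skew_herm_def herm2_add herm2_scaleR herm2_eq_iff prod_eq_iff vec_eq_iff forall_2)

lemma linear_bispinor_herm: "linear bispinor_herm"
  by (rule linearI)
    (auto simp: bispinor_herm_def herm2_add herm2_scaleR herm2_eq_iff prod_eq_iff vec_eq_iff forall_2)

lemma bij_skew_herm: "bij_betw skew_herm antisym_mats J2_Hs"
proof (rule bij_betw_imageI)
  show "inj_on skew_herm antisym_mats"
  proof (rule inj_onI)
    fix A B assume AB: "A \<in> antisym_mats" "B \<in> antisym_mats" "skew_herm A = skew_herm B"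
    show "A = B"
      by (subst antisym_eq_skew[OF AB(1)], subst antisym_eq_skew[OF AB(2)])
        (use AB(3) in \<open>simp add: skew_herm_def herm2_eq_iff vec_eq_iff forall_2\<close>)
  qed
  show "skew_herm ` antisym_mats = J2_Hs"
  proof (intro equalityI subsetI)
    fix Y assume Y: "Y \<in> J2_Hs"
    obtain \<alpha> y \<beta> where Y_eq: "Y = herm2 \<alpha> y \<beta>"
      using herm2_cases by blast
    have "Y = skew_herm (skew (- \<alpha>) (fst y$1$1) (fst y$2$1) (fst y$1$2) (fst y$2$2) (- \<beta>))"
      using Y unfolding Y_eq herm2_mem_J2_Hs
      by (simp add: skew_herm_def herm2_eq_iff prod_eq_iff vec_eq_iff forall_2)
    then show "Y \<in> skew_herm ` antisym_mats"
      using skew_in_antisym by blast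
  qed (auto simp: skew_herm_def herm2_mem_J2_Hs)
qed

lemma bij_bispinor_herm: "bij_betw bispinor_herm UNIV J2_Hs_l"
proof (rule bij_betw_imageI)
  show "inj bispinor_herm"
    by (rule injI) (auto simp: bispinor_herm_def herm2_eq_iff vec_eq_iff forall_2)
  show "range bispinor_herm = J2_Hs_l"
  proof (intro equalityI subsetI)
    fix Y assume Y: "Y \<in> J2_Hs_l"
    obtain \<alpha> y \<beta> where Y_eq: "Y = herm2 \<alpha> y \<beta>"
      using herm2_cases by blast
    have "Y = bispinor_herm (vector [vector [snd y$1$2, snd y$2$2], vector [- snd y$1$1, - snd y$2$1]])"
      using Y unfolding Y_eq herm2_mem_J2_Hs_l
      by (simp add: bispinor_herm_def herm2_eq_iff prod_eq_iff vec_eq_iff forall_2)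
    then show "Y \<in> range bispinor_herm"
      by (rule range_eqI)
  qed (auto simp: bispinor_herm_def herm2_mem_J2_Hs_l)
qed

lemma skew_herm_add_bispinor_herm: "skew_herm A + bispinor_herm B =
    herm2 (- A$1$2) (vector [vector [A$1$3, A$2$3], vector [A$1$4, A$2$4]],
      vector [vector [- B$2$1, B$1$1], vector [- B$2$2, B$1$2]]) (- A$3$4)"
  by (simp add: skew_herm_def bispinor_herm_def herm2_add)

lemma N2_tensor: "N2 \<mu> (skew_herm A) = pf A" "N2 \<mu> (bispinor_herm B) = \<mu> * det B"
  "N2 \<mu> (skew_herm A + bispinor_herm B) = pf A + \<mu> * det B"
  unfolding skew_herm_add_bispinor_herm unfolding skew_herm_def bispinor_herm_def
  by (simp_all add: N2_herm2 onorm2_eq det_2 pf_def algebra_simps)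

text \<open>The two A-terms run over ordered pairs and count each monomial twice, hence the halves.
  The terms with \<xi> contain exactly two l-components, either both from \<xi> or one from \<xi>
  and one from \<open>B\<close>, which explains the factor \<mu>.\<close>

lemma N3_tensor:
  assumes "A \<in> antisym_mats"
  shows "N3 \<mu> (c *\<^sub>R diag_unit i + spinor_herm i \<psi> \<xi> + block i (skew_herm A + bispinor_herm B)) =
    c * (pf A + \<mu> * det B) + (1/2) * A_psi_psi A \<psi> + (- \<mu> / 2) * A_chi_chi A \<xi> + (- \<mu>) * B_psi_chi B \<psi> \<xi>"
proof -
  obtain a b d e f g where A: "A = skew a b d e f g"
    using antisym_eq_skew[OF assms] by blast
  have 1: "A_psi_psi A \<psi> = 2 * (a * (\<psi>$1$1 * \<psi>$2$2 - \<psi>$1$2 * \<psi>$2$1) + b * (\<psi>$1$1 * \<psi>$3$2 - \<psi>$1$2 * \<psi>$3$1)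
      + d * (\<psi>$1$1 * \<psi>$4$2 - \<psi>$1$2 * \<psi>$4$1) + e * (\<psi>$2$1 * \<psi>$3$2 - \<psi>$2$2 * \<psi>$3$1)
      + f * (\<psi>$2$1 * \<psi>$4$2 - \<psi>$2$2 * \<psi>$4$1) + g * (\<psi>$3$1 * \<psi>$4$2 - \<psi>$3$2 * \<psi>$4$1))"
    by (simp add: A_psi_psi_def A eps2_sympl sum_4 sum_2 algebra_simps)
  have 2: "A_chi_chi A \<xi> = 2 * (g * (\<xi>$1$1 * \<xi>$2$2 - \<xi>$1$2 * \<xi>$2$1) - f * (\<xi>$1$1 * \<xi>$3$2 - \<xi>$1$2 * \<xi>$3$1)
      + e * (\<xi>$1$1 * \<xi>$4$2 - \<xi>$1$2 * \<xi>$4$1) + d * (\<xi>$2$1 * \<xi>$3$2 - \<xi>$2$2 * \<xi>$3$1)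
      - b * (\<xi>$2$1 * \<xi>$4$2 - \<xi>$2$2 * \<xi>$4$1) + a * (\<xi>$3$1 * \<xi>$4$2 - \<xi>$3$2 * \<xi>$4$1))"
    by (simp add: A_chi_chi_def A dual_skew eps2_sympl sum_4 sum_2 algebra_simps)
  show ?thesis
    unfolding 1 2 skew_herm_add_bispinor_herm spinor_herm_def N3_decompose
    by (simp add: A pf_def B_psi_chi_def sum_4 sum_2 onorm2_eq det_2 ore_def trace_2 omult_def matrix_mult_2
        qconj_nth field_simps)
qed

text \<open>Here and below, contractions are written as inner products, the shape in which the form
  \<open>C55\<close> produces them.\<close>

lemma A_psi_psi_eq_inner: "A_psi_psi A \<psi> = \<psi> \<bullet> (A ** \<psi> ** transpose sympl)"
  by (simp add: A_psi_psi_def eps2_sympl inner_vec_def sum_4 sum_2 matrix_matrix_mult_def transpose_def algebra_simps)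

lemma A_chi_chi_eq_inner: "A_chi_chi A \<xi> = \<xi> \<bullet> (dual_form A ** \<xi> ** transpose sympl)"
  by (simp add: A_chi_chi_def eps2_sympl inner_vec_def sum_4 sum_2 matrix_matrix_mult_def transpose_def algebra_simps)

lemma B_psi_chi_eq_inner: "B_psi_chi B \<psi> \<xi> = \<psi> \<bullet> (\<xi> ** transpose B)" "B_psi_chi B \<psi> \<xi> = \<xi> \<bullet> (\<psi> ** B)"
  by (simp_all add: B_psi_chi_def inner_vec_def sum_4 sum_2 matrix_matrix_mult_def transpose_def algebra_simps)

lemma B_psi_chi_invariant:
  assumes "g \<in> SL"
  shows "B_psi_chi B (g ** \<psi>) (contragredient g ** \<xi>) = B_psi_chi B \<psi> \<xi>"
proof -
  have "(g ** \<psi>) \<bullet> (contragredient g ** M) = \<psi> \<bullet> (transpose g ** (contragredient g ** M))" for M :: "real^2^4"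
    by (simp add: inner_vec_def sum_4 sum_2 matrix_matrix_mult_def transpose_def algebra_simps)
  also have "\<dots> M = \<psi> \<bullet> M" for M :: "real^2^4"
    by (simp add: matrix_mul_assoc contragredient_inv[OF assms])
  finally show ?thesis
    by (simp add: B_psi_chi_eq_inner(1) matrix_mul_assoc[symmetric])
qed

section \<open>The action of Spin(5,5) on the Albert algebra\<close>

lemma inner_matrix_transpose: "(A *v x) \<bullet> y = x \<bullet> (transpose A *v y)" for A :: "real^'m^'n"
  using dot_lmul_matrix[of x "transpose A" y] by simp

definition std_iso :: "real \<Rightarrow> real^10 \<Rightarrow> 2 herm" where
  "std_iso \<mu> v = skew_herm (Amat v) + bispinor_herm (Bmat \<mu> v)"

definition emb :: "real^2^4 \<Rightarrow> real^2^4 \<Rightarrow> real^((4 + 4) \<times> (2 + 2))" where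
  "emb \<psi> \<xi> = vecm (blk \<psi> 0 0 \<xi>)"

text \<open>A left inverse of \<open>emb\<close> followed by \<open>spinor_herm\<close>, extended
  linearly to all spinors by dropping the odd blocks.\<close>

definition spinor_of :: "3 \<Rightarrow> real^((4 + 4) \<times> (2 + 2)) \<Rightarrow> 3 herm" where
  "spinor_of i w = spinor_herm i (\<chi> a \<alpha>. w$(Inl a, Inl \<alpha>)) (\<chi> a \<alpha>. w$(Inr a, Inr \<alpha>))"

lemma spinor_of_emb [simp]: "spinor_of i (emb \<psi> \<xi>) = spinor_herm i \<psi> \<xi>"
  by (simp add: spinor_of_def emb_def)

lemma emb_add: "emb \<psi> \<xi> + emb \<psi>' \<xi>' = emb (\<psi> + \<psi>') (\<xi> + \<xi>')"
  and emb_scaleR: "c *\<^sub>R emb \<psi> \<xi> = emb (c *\<^sub>R \<psi>) (c *\<^sub>R \<xi>)"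
  and emb_zero: "emb 0 0 = 0"
  by (auto simp: emb_def vec_eq_iff forall_Plus)

lemma emb_eq_iff [simp]: "emb \<psi> \<xi> = emb \<psi>' \<xi>' \<longleftrightarrow> \<psi> = \<psi>' \<and> \<xi> = \<xi>'"
  by (simp add: emb_def)

lemma spinor_herm_add: "spinor_herm i \<psi> \<xi> + spinor_herm i \<psi>' \<xi>' = spinor_herm i (\<psi> + \<psi>') (\<xi> + \<xi>')"
  using linear_add[OF linear_spinor_herm[of i], of "(\<psi>, \<xi>)" "(\<psi>', \<xi>')"] by simp

lemma spinor_herm_scaleR: "c *\<^sub>R spinor_herm i \<psi> \<xi> = spinor_herm i (c *\<^sub>R \<psi>) (c *\<^sub>R \<xi>)"
  using linear_scale[OF linear_spinor_herm[of i], of c "(\<psi>, \<xi>)"] by simp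

lemma spinor_herm_zero [simp]: "spinor_herm i 0 0 = 0"
  using spinor_herm_scaleR[of 0 i 0 0] by simp

lemma spinor_herm_eq_iff [simp]: "spinor_herm i \<psi> \<xi> = spinor_herm i \<psi>' \<xi>' \<longleftrightarrow> \<psi> = \<psi>' \<and> \<xi> = \<xi>'"
  using inj_spinor_herm[of i] by (auto simp: inj_def)

lemma linear_spinor_of: "linear (spinor_of i)"
proof (rule linearI)
  fix v w :: "real^((4 + 4) \<times> (2 + 2))" and c
  show "spinor_of i (v + w) = spinor_of i v + spinor_of i w"
    unfolding spinor_of_def spinor_herm_add by (simp add: vec_eq_iff)
  show "spinor_of i (c *\<^sub>R v) = c *\<^sub>R spinor_of i v"
    unfolding spinor_of_def spinor_herm_scaleR by (simp add: vec_eq_iff)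
qed

text \<open>The product of the two gradings negates precisely the off-diagonal blocks, so the even
  spinors are the block diagonal ones.\<close>

lemma range_emb: "range (\<lambda>(\<psi>, \<xi>). emb \<psi> \<xi>) = {w. kron omega omega *v w = 1 *\<^sub>R w}"
proof (intro equalityI subsetI)
  fix w :: "real^((4 + 4) \<times> (2 + 2))"
  assume w: "w \<in> {w. kron omega omega *v w = 1 *\<^sub>R w}"
  obtain W where W: "w = vecm W"
    by (rule vecm_cases)
  obtain a b c d where abcd: "W = blk a b c d"
    by (rule blk_cases)
  have "- b = b" "- c = c"
    using w unfolding W abcd
    by (simp_all add: kron_vecm omega_def blk_mult blk_transpose transpose_mat linear_neg[OF linear_transpose]
        matrix_mult_minus_left matrix_mult_minus_right)
  then have "b = 0" "c = 0"
    by (simp_all add: vec_eq_iff)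
  then show "w \<in> range (\<lambda>(\<psi>, \<xi>). emb \<psi> \<xi>)"
    using W abcd by (intro range_eqI[of _ _ "(a, d)"]) (simp add: emb_def)
qed (auto simp: emb_def kron_vecm omega_def blk_mult blk_transpose transpose_mat linear_neg[OF linear_transpose]
    matrix_mult_minus_left matrix_mult_minus_right)

lemma omega_emb: "kron omega omega *v emb \<psi> \<xi> = emb \<psi> \<xi>"
proof -
  have "emb \<psi> \<xi> \<in> range (\<lambda>(\<psi>, \<xi>). emb \<psi> \<xi>)"
    by (intro range_eqI[of _ _ "(\<psi>, \<xi>)"]) simp
  then show ?thesis
    unfolding range_emb by simp
qed

lemma linear_std_iso: "linear (std_iso \<mu>)"
  by (rule linearI)
    (simp_all add: std_iso_def linear_add[OF linear_Amat] linear_add[OF linear_Bmat] linear_add[OF linear_skew_herm]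
      linear_add[OF linear_bispinor_herm] linear_scale[OF linear_Amat] linear_scale[OF linear_Bmat]
      linear_scale[OF linear_skew_herm] linear_scale[OF linear_bispinor_herm] scaleR_add_right)

lemma cl_mult_zero: "cl_mult \<eta> x 0 = 0" "cl_mult \<eta> 0 x = 0"
  by (simp_all add: cl_mult_def)

lemma spin_vec_zero: "spin_vec \<eta> x 0 = 0"
  by (simp add: spin_vec_def linear_0[OF linear_cl_vec] cl_mult_zero vec_eq_iff)

context split_oct
begin

lemma N2_std_iso: "N2 \<mu> (std_iso \<mu> v) = (\<Sum>j\<in>UNIV. eta j * (v$j)\<^sup>2)"
  unfolding std_iso_def N2_tensor(3) pf_Amat det_Bmat sum_10 sum_I33 sum_I22 by simp

lemma std_iso_I33: "v \<in> vecs I33 \<Longrightarrow> std_iso \<mu> v = skew_herm (Amat v)"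
  by (simp add: std_iso_def Bmat_vecs_I33 linear_0[OF linear_bispinor_herm])

lemma std_iso_I22: "v \<in> vecs I22 \<Longrightarrow> std_iso \<mu> v = bispinor_herm (Bmat \<mu> v)"
  by (simp add: std_iso_def Amat_vecs_I22 linear_0[OF linear_skew_herm])

lemma std_iso_image_I33: "std_iso \<mu> ` vecs I33 = J2_Hs"
proof -
  have "Amat ` vecs I33 = antisym_mats"
  proof (intro equalityI subsetI)
    fix A assume "A \<in> antisym_mats"
    then obtain v where "v \<in> vecs I33" "Amat v = A"
      by (rule Amat_surj)
    then show "A \<in> Amat ` vecs I33"
      by (intro image_eqI[of _ _ v]) simp_all
  qed (auto simp: Amat_antisym)
  then have "skew_herm ` Amat ` vecs I33 = J2_Hs"
    using bij_skew_herm by (simp add: bij_betw_def)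
  moreover have "std_iso \<mu> ` vecs I33 = skew_herm ` Amat ` vecs I33"
    unfolding image_image by (intro image_cong refl std_iso_I33)
  ultimately show ?thesis
    by (simp only:)
qed

lemma std_iso_image_I22: "std_iso \<mu> ` vecs I22 = J2_Hs_l"
proof -
  have "Bmat \<mu> ` vecs I22 = UNIV"
  proof (intro equalityI subsetI UNIV_I)
    fix B :: "real^2^2"
    obtain v where "v \<in> vecs I22" "Bmat \<mu> v = B"
      by (rule Bmat_surj)
    then show "B \<in> Bmat \<mu> ` vecs I22"
      by (intro image_eqI[of _ _ v]) simp_all
  qed
  then have "bispinor_herm ` Bmat \<mu> ` vecs I22 = J2_Hs_l"
    using bij_bispinor_herm by (simp add: bij_betw_def)
  moreover have "std_iso \<mu> ` vecs I22 = bispinor_herm ` Bmat \<mu> ` vecs I22"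
    unfolding image_image by (intro image_cong refl std_iso_I22)
  ultimately show ?thesis
    by (simp only:)
qed

lemma std_iso_eq_iff [simp]: "std_iso \<mu> v = std_iso \<mu> w \<longleftrightarrow> v = w"
proof
  assume "std_iso \<mu> v = std_iso \<mu> w"
  then have *: "v$0 + v$3 = w$0 + w$3" "v$4 + v$1 = w$4 + w$1" "v$2 - v$5 = w$2 - w$5"
    "v$2 + v$5 = w$2 + w$5" "v$4 - v$1 = w$4 - w$1" "v$0 - v$3 = w$0 - w$3"
    "\<mu> * (v$6 + v$8) = \<mu> * (w$6 + w$8)" "\<mu> * (v$9 + v$7) = \<mu> * (w$9 + w$7)"
    "v$9 - v$7 = w$9 - w$7" "v$6 - v$8 = w$6 - w$8"
    unfolding std_iso_def skew_herm_add_bispinor_herm herm2_eq_iff prod_eq_iff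
    by (simp_all add: vec_eq_iff forall_2 Amat_def Bmat_def)
  then have "v$6 + v$8 = w$6 + w$8" "v$9 + v$7 = w$9 + w$7"
    using mu by auto
  with * have "v$0 = w$0" "v$1 = w$1" "v$2 = w$2" "v$3 = w$3" "v$4 = w$4" "v$5 = w$5"
    "v$6 = w$6" "v$7 = w$7" "v$8 = w$8" "v$9 = w$9"
    by linarith+
  then show "v = w"
    by (simp add: vec_eq_iff forall_10)
qed simp

lemma bij_std_iso: "bij (std_iso \<mu>)"
proof (rule bijI)
  show "inj (std_iso \<mu>)"
    by (rule injI) simp
  have "Y \<in> range (std_iso \<mu>)" for Y
  proof -
    obtain A B where AB: "A \<in> J2_Hs" "B \<in> J2_Hs_l" "Y = A + B"
      using J2_decompose[of Y] by (auto dest!: ex1_implies_ex)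
    then obtain v w where "A = std_iso \<mu> v" "B = std_iso \<mu> w"
      using std_iso_image_I33 std_iso_image_I22 by (metis imageE)
    then have "Y = std_iso \<mu> (v + w)"
      using AB(3) by (simp add: linear_add[OF linear_std_iso])
    then show ?thesis by (rule range_eqI)
  qed
  then show "surj (std_iso \<mu>)"
    by auto
qed

lemma signature_J2_Hs: "has_signature (N2 \<mu>) J2_Hs 3 3"
proof -
  have "{..<3 + 3 :: nat} = {0, 1, 2, 3, 4, 5}"
    by auto
  then have I: "I33 = of_nat ` {..<3 + 3 :: nat}"
    by (simp add: I33_def)
  have "inj_on (of_nat :: nat \<Rightarrow> 10) {..<3 + 3}"
    by (rule eq_card_imp_inj_on) (simp_all only: I[symmetric] card_I33, simp_all)
  moreover have "eta (of_nat k) = 1" if "k < 3" for k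
  proof -
    have "k \<in> {0, 1, 2}" using that by auto
    then show ?thesis by (auto simp: eta_values)
  qed
  moreover have "eta (of_nat k) = -1" if "3 \<le> k" "k < 3 + 3" for k
  proof -
    have "k \<in> {3, 4, 5}" using that by auto
    then show ?thesis by (auto simp: eta_values)
  qed
  ultimately show ?thesis
    using has_signature_coords[OF linear_std_iso N2_std_iso, of of_nat 3 3]
    by (simp only: I[symmetric] std_iso_image_I33)
qed

lemma signature_J2_Hs_l: "has_signature (N2 \<mu>) J2_Hs_l 2 2"
proof -
  \<comment> \<open>The indices of \<open>I22\<close> start at 6, and the first two of them carry
    the positive sign.\<close>
  let ?f = "\<lambda>k :: nat. of_nat (k + 6) :: 10"
  have "{..<2 + 2 :: nat} = {0, 1, 2, 3}"
    by auto
  then have I: "I22 = ?f ` {..<2 + 2}"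
    by (simp add: I22_def)
  have "inj_on ?f {..<2 + 2}"
    by (rule eq_card_imp_inj_on) (simp_all only: I[symmetric] card_I22, simp_all)
  moreover have "eta (?f k) = 1" if "k < 2" for k
  proof -
    have "k \<in> {0, 1}" using that by auto
    then show ?thesis by (auto simp: eta_values)
  qed
  moreover have "eta (?f k) = -1" if "2 \<le> k" "k < 2 + 2" for k
  proof -
    have "k \<in> {2, 3}" using that by auto
    then show ?thesis by (auto simp: eta_values)
  qed
  ultimately show ?thesis
    using has_signature_coords[OF linear_std_iso N2_std_iso, of ?f 2 2]
    by (simp only: I[symmetric] std_iso_image_I22)
qed

definition albert :: "3 \<Rightarrow> real \<Rightarrow> real^2^4 \<Rightarrow> real^2^4 \<Rightarrow> real^10 \<Rightarrow> 3 herm" where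
  "albert i c \<psi> \<xi> v = c *\<^sub>R diag_unit i + spinor_herm i \<psi> \<xi> + block i (std_iso \<mu> v)"

lemma albert_eq_iff [simp]:
  "albert i c \<psi> \<xi> v = albert i c' \<psi>' \<xi>' v' \<longleftrightarrow> c = c' \<and> \<psi> = \<psi>' \<and> \<xi> = \<xi>' \<and> v = v'"
proof
  assume *: "albert i c \<psi> \<xi> v = albert i c' \<psi>' \<xi>' v'"
  obtain a b a' b' where ab: "spinor_herm i \<psi> \<xi> = half i a b" "spinor_herm i \<psi>' \<xi>' = half i a' b'"
    unfolding spinor_herm_def by blast
  have "c = c' \<and> a = a' \<and> b = b' \<and> std_iso \<mu> v = std_iso \<mu> v'"
    using * unfolding albert_def ab by (rule herm3_decompose_unique)
  then show "c = c' \<and> \<psi> = \<psi>' \<and> \<xi> = \<xi>' \<and> v = v'"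
    using ab spinor_herm_eq_iff by (metis std_iso_eq_iff)
qed simp

lemma albert_cases: obtains c \<psi> \<xi> v where "X = albert i c \<psi> \<xi> v"
proof -
  obtain c a b Y where X: "X = c *\<^sub>R diag_unit i + half i a b + block i Y"
    using herm3_decompose[of X i] by blast
  have "half i a b \<in> range (\<lambda>(\<psi>, \<xi>). spinor_herm i \<psi> \<xi>)"
    unfolding range_spinor_herm[of i \<mu>] peirce_half by (auto intro: range_eqI[of _ _ "(a, b)"])
  then obtain \<psi> \<xi> where half: "half i a b = spinor_herm i \<psi> \<xi>"
    by auto
  obtain v where v: "Y = std_iso \<mu> v"
    using bij_std_iso by (metis bij_pointE)
  show ?thesis
    by (rule that[of c \<psi> \<xi> v]) (simp add: X half v albert_def)
qed

lemma albert_add: "albert i c \<psi> \<xi> v + albert i c' \<psi>' \<xi>' v' = albert i (c + c') (\<psi> + \<psi>') (\<xi> + \<xi>') (v + v')"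
  by (simp add: albert_def scaleR_add_left linear_add[OF linear_block] linear_add[OF linear_std_iso]
      flip: spinor_herm_add)

lemma albert_scaleR: "r *\<^sub>R albert i c \<psi> \<xi> v = albert i (r * c) (r *\<^sub>R \<psi>) (r *\<^sub>R \<xi>) (r *\<^sub>R v)"
  by (simp add: albert_def scaleR_add_right linear_scale[OF linear_block] linear_scale[OF linear_std_iso]
      flip: spinor_herm_scaleR)

lemma albert_simps:
  "albert i c 0 0 0 = c *\<^sub>R diag_unit i" "albert i 0 \<psi> \<xi> 0 = spinor_herm i \<psi> \<xi>"
  "albert i 0 0 0 v = block i (std_iso \<mu> v)"
  by (simp_all add: albert_def linear_0[OF linear_block] linear_0[OF linear_std_iso])

text \<open>The bridge from octonions to spinors: \<open>N3\<close> is expressed by objects on which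
  the spin group acts transparently. The form yields the three contractions with coefficients 1,
  \<open>- \<mu>\<close> and \<open>- 2 * \<mu>\<close>, twice those of \<open>N3_tensor\<close>;
  the B-term is doubled because both diagonal blocks contribute it.\<close>

lemma N3_albert: "N3 \<mu> (albert i c \<psi> \<xi> v) = c * (\<Sum>j\<in>UNIV. eta j * (v$j)\<^sup>2) +
    (1/2) * (emb \<psi> \<xi> \<bullet> (C55 \<mu> *v (gamma55 \<mu> v *v emb \<psi> \<xi>)))"
proof -
  let ?A = "Amat v" and ?B = "Bmat \<mu> v" and ?J = "transpose sympl"
  have J: "M ** ?J ** ?J = - M" "M ** (?J ** ?J) = - M" for M :: "real^2^4"
    by (simp_all add: vec_eq_iff matrix_matrix_mult_def sum_2 forall_2 transpose_def)
  have "gamma55 \<mu> v *v emb \<psi> \<xi> = vecm (gamma33 v ** blk \<psi> 0 0 \<xi> + omega ** blk \<psi> 0 0 \<xi> ** transpose (gamma22 \<mu> v))"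
    by (simp add: gamma55_def emb_def matrix_vector_mult_add_rdistrib kron_vecm transpose_mat linear_add[OF linear_vecm])
  also have "\<dots> = vecm (blk 0 (\<psi> ** ?B ** ?J - dual_form ?A ** \<xi>) (?A ** \<psi> + \<mu> *\<^sub>R (\<xi> ** transpose ?B ** ?J)) 0)"
    by (simp add: gamma33_def gamma22_def omega_def blk_mult blk_add blk_transpose matrix_transpose_mul
        linear_scale[OF linear_transpose] linear_neg[OF linear_transpose] matrix_mult_minus_left
        matrix_mult_minus_right matrix_mult_scaleR_right matrix_mul_assoc)
  finally have "C55 \<mu> *v (gamma55 \<mu> v *v emb \<psi> \<xi>) =
    vecm (blk ((?A ** \<psi> + \<mu> *\<^sub>R (\<xi> ** transpose ?B ** ?J)) ** ?J) 0 0
      (\<mu> *\<^sub>R ((\<psi> ** ?B ** ?J - dual_form ?A ** \<xi>) ** ?J)))"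
    by (simp add: C55_def C33_def C22_def kron_vecm blk_mult blk_transpose linear_scale[OF linear_transpose]
        matrix_mult_scaleR_right)
  also have "(?A ** \<psi> + \<mu> *\<^sub>R (\<xi> ** transpose ?B ** ?J)) ** ?J = ?A ** \<psi> ** ?J - \<mu> *\<^sub>R (\<xi> ** transpose ?B)"
    by (simp add: matrix_add_rdistrib matrix_mult_scaleR_left J)
  also have "(\<psi> ** ?B ** ?J - dual_form ?A ** \<xi>) ** ?J = - (\<psi> ** ?B) - dual_form ?A ** \<xi> ** ?J"
    by (simp add: linear_diff[OF linear_matrix_mult_left] J)
  finally have "emb \<psi> \<xi> \<bullet> (C55 \<mu> *v (gamma55 \<mu> v *v emb \<psi> \<xi>)) =
    A_psi_psi ?A \<psi> - \<mu> * A_chi_chi ?A \<xi> - 2 * \<mu> * B_psi_chi ?B \<psi> \<xi>"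
    by (simp add: emb_def vecm_inner blk_inner inner_diff_right A_psi_psi_eq_inner A_chi_chi_eq_inner)
      (simp add: B_psi_chi_eq_inner(1)[of ?B, symmetric] B_psi_chi_eq_inner(2)[of ?B, symmetric] algebra_simps)
  then show ?thesis
    unfolding albert_def std_iso_def N3_tensor[OF Amat_antisym] N2_std_iso[symmetric, unfolded std_iso_def N2_tensor]
    by (simp add: field_simps)
qed

text \<open>The coordinates in \<open>albert\<close> exist and are unique, so \<open>THE\<close> is well-defined.\<close>

definition Phi :: "3 \<Rightarrow> 10 clifford \<Rightarrow> 3 herm \<Rightarrow> 3 herm" where
  "Phi i s X = (THE Z. \<exists>c \<psi> \<xi> v. X = albert i c \<psi> \<xi> v \<and>
     Z = c *\<^sub>R diag_unit i + spinor_of i (R55.rho s *v emb \<psi> \<xi>) + block i (std_iso \<mu> (spin_vec eta s v)))"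

lemma Phi_albert: "Phi i s (albert i c \<psi> \<xi> v) =
    c *\<^sub>R diag_unit i + spinor_of i (R55.rho s *v emb \<psi> \<xi>) + block i (std_iso \<mu> (spin_vec eta s v))"
  unfolding Phi_def by (rule the_equality) auto

lemma rho55_emb:
  assumes "s \<in> even_cl UNIV"
  obtains \<psi>' \<xi>' where "R55.rho s *v emb \<psi> \<xi> = emb \<psi>' \<xi>'"
proof -
  have "kron omega omega *v (R55.rho s *v emb \<psi> \<xi>) = R55.rho s *v (kron omega omega *v emb \<psi> \<xi>)"
    by (simp only: matrix_vector_mul_assoc R55.omega_rho_even[OF assms])
  then have "R55.rho s *v emb \<psi> \<xi> \<in> range (\<lambda>(\<psi>, \<xi>). emb \<psi> \<xi>)"
    unfolding range_emb omega_emb by simp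
  then show ?thesis
    using that by auto
qed

lemma Phi_albert_emb:
  assumes "R55.rho s *v emb \<psi> \<xi> = emb \<psi>' \<xi>'"
  shows "Phi i s (albert i c \<psi> \<xi> v) = albert i c \<psi>' \<xi>' (spin_vec eta s v)"
  unfolding Phi_albert assms by (simp add: albert_def)

lemma Phi_mult:
  assumes "s \<in> Spin55" "t \<in> Spin55"
  shows "Phi i (s \<star> t) = Phi i s \<circ> Phi i t"
proof
  fix X
  obtain c \<psi> \<xi> v where X: "X = albert i c \<psi> \<xi> v"
    by (rule albert_cases)
  obtain \<psi>' \<xi>' where t: "R55.rho t *v emb \<psi> \<xi> = emb \<psi>' \<xi>'"
    by (rule rho55_emb[OF spin55_even[OF assms(2)]])
  obtain \<psi>'' \<xi>'' where s: "R55.rho s *v emb \<psi>' \<xi>' = emb \<psi>'' \<xi>''"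
    by (rule rho55_emb[OF spin55_even[OF assms(1)]])
  have "R55.rho (s \<star> t) *v emb \<psi> \<xi> = emb \<psi>'' \<xi>''"
    unfolding rho55_mult matrix_vector_mul_assoc[symmetric] s t ..
  then show "Phi i (s \<star> t) X = (Phi i s \<circ> Phi i t) X"
    unfolding X comp_apply by (simp add: Phi_albert_emb s t spin_vec_mult assms)
qed

lemma Phi_one: "Phi i cl_one = id"
proof
  fix X
  obtain c \<psi> \<xi> v where X: "X = albert i c \<psi> \<xi> v"
    by (rule albert_cases)
  show "Phi i cl_one X = id X"
    unfolding X by (simp add: Phi_albert_emb spin_vec_one)
qed

lemma linear_Phi:
  assumes "s \<in> Spin55"
  shows "linear (Phi i s)"
proof (rule linearI)
  fix X Y and r :: real
  obtain c \<psi> \<xi> v where X: "X = albert i c \<psi> \<xi> v"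
    by (rule albert_cases)
  obtain c' \<psi>' \<xi>' v' where Y: "Y = albert i c' \<psi>' \<xi>' v'"
    by (rule albert_cases)
  show "Phi i s (X + Y) = Phi i s X + Phi i s Y"
    unfolding X Y albert_add Phi_albert
    by (simp add: emb_add[symmetric] matrix_vector_right_distrib linear_add[OF linear_spinor_of] scaleR_add_left
        linear_add[OF linear_spin_vec[OF assms]] linear_add[OF linear_std_iso] linear_add[OF linear_block])
  show "Phi i s (r *\<^sub>R X) = r *\<^sub>R Phi i s X"
    unfolding X albert_scaleR Phi_albert
    by (simp add: emb_scaleR[symmetric] matrix_vector_mult_scaleR linear_scale[OF linear_spinor_of] scaleR_add_right
        linear_scale[OF linear_spin_vec[OF assms]] linear_scale[OF linear_std_iso] linear_scale[OF linear_block])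
qed

lemma Phi_N3:
  assumes "s \<in> Spin55"
  shows "N3 \<mu> (Phi i s X) = N3 \<mu> X"
proof -
  obtain c \<psi> \<xi> v where X: "X = albert i c \<psi> \<xi> v"
    by (rule albert_cases)
  obtain \<psi>' \<xi>' where s: "R55.rho s *v emb \<psi> \<xi> = emb \<psi>' \<xi>'"
    by (rule rho55_emb[OF spin55_even[OF assms]])
  let ?\<rho> = "R55.rho s" and ?\<rho>' = "R55.rho (cl_rev s)" and ?w = "emb \<psi> \<xi>"
  \<comment> \<open>The adjoint relation is used for \<open>cl_rev s\<close> instead of
    \<open>s\<close>, which lets the transpose of \<open>rho s\<close> pass through the form and
    meet its inverse.\<close>
  have C: "C55 \<mu> ** ?\<rho>' = transpose ?\<rho> ** C55 \<mu>"
    using rho55_rev[OF cl_rev_even[OF spin55_even[OF assms]]] by (simp add: cl_rev_rev)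
  have "emb \<psi>' \<xi>' \<bullet> (C55 \<mu> *v (gamma55 \<mu> (spin_vec eta s v) *v emb \<psi>' \<xi>')) =
    (?\<rho> *v ?w) \<bullet> ((C55 \<mu> ** (?\<rho> ** gamma55 \<mu> v ** (?\<rho>' ** ?\<rho>))) *v ?w)"
    unfolding s[symmetric] rho55_spin_vec[OF assms, symmetric] by (simp only: matrix_vector_mul_assoc matrix_mul_assoc)
  also have "\<dots> = ?w \<bullet> (transpose ?\<rho> *v ((C55 \<mu> ** (?\<rho> ** gamma55 \<mu> v)) *v ?w))"
    unfolding spin55_rev[OF assms]
    by (simp only: inner_matrix_transpose matrix_mul_rid)
  also have "\<dots> = ?w \<bullet> (((transpose ?\<rho> ** C55 \<mu>) ** ?\<rho> ** gamma55 \<mu> v) *v ?w)"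
    by (simp only: matrix_vector_mul_assoc matrix_mul_assoc)
  also have "(transpose ?\<rho> ** C55 \<mu>) ** ?\<rho> ** gamma55 \<mu> v = C55 \<mu> ** (?\<rho>' ** ?\<rho>) ** gamma55 \<mu> v"
    unfolding C[symmetric] by (simp only: matrix_mul_assoc)
  also have "?w \<bullet> ((C55 \<mu> ** (?\<rho>' ** ?\<rho>) ** gamma55 \<mu> v) *v ?w) = ?w \<bullet> (C55 \<mu> *v (gamma55 \<mu> v *v ?w))"
    unfolding spin55_rev[OF assms] by (simp add: matrix_vector_mul_assoc)
  finally show ?thesis
    unfolding X Phi_albert_emb[OF s] N3_albert spin_vec_isometry[OF assms] by simp
qed

lemma Phi_E66:
  assumes "s \<in> Spin55"
  shows "Phi i s \<in> E66 \<mu>"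
proof -
  have "Phi i s \<circ> Phi i (cl_rev s) = id" "Phi i (cl_rev s) \<circ> Phi i s = id"
    using assms cl_rev_spin55[OF assms] by (simp_all flip: Phi_mult add: cl_rev_star Phi_one)
  then have "bij (Phi i s)"
    by (rule o_bij[rotated])
  then show ?thesis
    using assms by (simp add: E66_def linear_Phi Phi_N3)
qed

lemma inj_on_Phi: "inj_on (Phi i) Spin55"
proof (rule inj_onI)
  fix s t assume s: "s \<in> Spin55" and t: "t \<in> Spin55" and eq: "Phi i s = Phi i t"
  have *: "R55.rho s *v emb \<psi> \<xi> = R55.rho t *v emb \<psi> \<xi> \<and> spin_vec eta s v = spin_vec eta t v" for \<psi> \<xi> v
  proof -
    obtain \<psi>1 \<xi>1 where 1: "R55.rho s *v emb \<psi> \<xi> = emb \<psi>1 \<xi>1"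
      by (rule rho55_emb[OF spin55_even[OF s]])
    obtain \<psi>2 \<xi>2 where 2: "R55.rho t *v emb \<psi> \<xi> = emb \<psi>2 \<xi>2"
      by (rule rho55_emb[OF spin55_even[OF t]])
    have "albert i 0 \<psi>1 \<xi>1 (spin_vec eta s v) = albert i 0 \<psi>2 \<xi>2 (spin_vec eta t v)"
      using fun_cong[OF eq, of "albert i 0 \<psi> \<xi> v"] by (simp only: Phi_albert_emb[OF 1] Phi_albert_emb[OF 2])
    then show ?thesis
      by (simp add: 1 2)
  qed
  \<comment> \<open>\<open>M\<close> kills the even spinors; since it intertwines an invertible vector \<open>?g\<close>, also the odd ones\<close>
  define M where "M = R55.rho s - R55.rho t"
  let ?\<Omega> = "kron omega omega :: real^((4 + 4) \<times> (2 + 2))^((4 + 4) \<times> (2 + 2))" and ?g = "gamma55 \<mu> (axis 0 1)"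
  have even: "M ** (mat 1 + ?\<Omega>) = 0"
  proof -
    have "(M ** (mat 1 + ?\<Omega>)) *v w = 0" for w
    proof -
      have "(mat 1 + ?\<Omega>) *v w \<in> {w. ?\<Omega> *v w = 1 *\<^sub>R w}"
        by (simp add: matrix_vector_mul_assoc matrix_add_ldistrib kron_mult omega_square kron_one add.commute)
      then obtain \<psi> \<xi> where "(mat 1 + ?\<Omega>) *v w = emb \<psi> \<xi>"
        unfolding range_emb[symmetric] by auto
      then show ?thesis
        using * by (simp add: matrix_vector_mul_assoc[symmetric] M_def matrix_vector_mult_diff_rdistrib)
    qed
    then show ?thesis
      by (simp add: matrix_eq)
  qed
  have g: "?g ** ?g = mat 1"
    unfolding gamma55_square sum_10 by (simp add: axis_def eta_values)
  have intertwine: "R55.rho u ** ?g = gamma55 \<mu> (spin_vec eta u (axis 0 1)) ** R55.rho u" if "u \<in> Spin55" for u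
    unfolding rho55_spin_vec[OF that, symmetric]
    by (simp add: matrix_mul_assoc[symmetric] spin55_rev[OF that])
  have Mg: "M ** ?g = gamma55 \<mu> (spin_vec eta s (axis 0 1)) ** M"
    unfolding M_def linear_diff[OF linear_matrix_mult_left] linear_diff[OF linear_matrix_mult_right]
      intertwine[OF s] intertwine[OF t] using * by simp
  \<comment> \<open>The vector \<open>?g\<close> is odd and squares to one, so conjugation by it
    exchanges the even and the odd projection.\<close>
  have flip: "?g ** (mat 1 + ?\<Omega>) ** ?g = mat 1 - ?\<Omega>"
  proof -
    have "?g ** ?\<Omega> = - (?\<Omega> ** ?g)"
      using R55.omega_anti[of "axis 0 1"] by simp
    then have "?g ** (mat 1 + ?\<Omega>) ** ?g = ?g ** ?g - ?\<Omega> ** (?g ** ?g)"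
      by (simp add: matrix_add_ldistrib matrix_add_rdistrib linear_diff[OF linear_matrix_mult_left] matrix_mul_assoc)
    then show ?thesis by (simp add: g)
  qed
  have "M ** (mat 1 - ?\<Omega>) = M ** ?g ** (mat 1 + ?\<Omega>) ** ?g"
    unfolding flip[symmetric] by (simp only: matrix_mul_assoc)
  also have "\<dots> = gamma55 \<mu> (spin_vec eta s (axis 0 1)) ** (M ** (mat 1 + ?\<Omega>)) ** ?g"
    unfolding Mg by (simp only: matrix_mul_assoc)
  finally have "M ** (mat 1 - ?\<Omega>) = 0"
    by (simp add: even)
  then have "M - M ** ?\<Omega> = 0"
    by (simp add: linear_diff[OF linear_matrix_mult_right])
  moreover have "M + M ** ?\<Omega> = 0"
    using even by (simp add: matrix_add_ldistrib)
  ultimately have "2 *\<^sub>R M = 0"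
    by (simp add: scaleR_2)
  then have "M = 0"
    by simp
  then show "s = t"
    by (simp add: M_def flip: rho55_inject)
qed

lemma Phi_diag_unit: "Phi i s (diag_unit i) = diag_unit i"
  using Phi_albert[of i s 1 0 0 0]
  by (simp add: albert_simps emb_zero linear_0[OF linear_spinor_of] spin_vec_zero linear_0[OF linear_std_iso]
      linear_0[OF linear_block])

lemma Phi_block: "Phi i s (block i (std_iso \<mu> v)) = block i (std_iso \<mu> (spin_vec eta s v))"
  using Phi_albert[of i s 0 0 0 v] by (simp add: albert_simps emb_zero linear_0[OF linear_spinor_of])

lemma Phi_spinor: "Phi i s (spinor_herm i \<psi> \<xi>) = spinor_of i (R55.rho s *v emb \<psi> \<xi>)"
  using Phi_albert[of i s 0 \<psi> \<xi> 0]
  by (simp add: albert_simps spin_vec_zero linear_0[OF linear_std_iso] linear_0[OF linear_block])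

text \<open>\<open>Phi i\<close> is defined on the whole Clifford algebra, so on the spinors it is
  itself a module structure extending the group action.\<close>

lemma weyl_module_Phi: "\<exists>\<sigma>\<in>{1, -1}. weyl_module eta UNIV \<sigma> (peirce \<mu> (1/2) (diag_unit i)) (Phi i)"
proof -
  let ?U = "{w. kron omega omega *v w = 1 *\<^sub>R w} :: (real^((4 + 4) \<times> (2 + 2))) set"
  obtain \<sigma> :: real where \<sigma>: "\<sigma> \<in> {1, -1}"
    and weyl: "\<And>\<tau>. \<tau> \<in> {1, -1} \<Longrightarrow> {w :: real^((4 + 4) \<times> (2 + 2)). kron omega omega *v w = \<tau> *\<^sub>R w} \<noteq> {0} \<Longrightarrow>
      weyl_module eta UNIV (\<sigma> * \<tau>) {w. kron omega omega *v w = \<tau> *\<^sub>R w} (\<lambda>x w. R55.rho x *v w)"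
    by (rule R55.weyl_module_rho) (blast intro: that)
  have "emb (\<chi> a \<alpha>. 1) 0 \<in> ?U"
    by (simp add: omega_emb)
  moreover have "emb (\<chi> a \<alpha>. 1) 0 \<noteq> emb 0 0"
    unfolding emb_eq_iff by (simp add: vec_eq_iff)
  ultimately have "weyl_module eta UNIV \<sigma> ?U (\<lambda>x w. R55.rho x *v w)"
    using weyl[of 1] emb_zero by auto
  then have "weyl_module eta UNIV \<sigma> (peirce \<mu> (1/2) (diag_unit i)) (Phi i)"
  proof (rule weyl_module_transport)
    show "linear (spinor_of i)"
      by (rule linear_spinor_of)
    show "inj_on (spinor_of i) ?U"
      unfolding range_emb[symmetric] by (auto simp: inj_on_def)
    show "spinor_of i ` ?U = peirce \<mu> (1/2) (diag_unit i)"
      unfolding range_emb[symmetric] range_spinor_herm[symmetric] image_image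
      by (intro image_cong) auto
    show "Phi i x (spinor_of i u) = spinor_of i (R55.rho x *v u)" if "u \<in> ?U" for x u
      using that unfolding range_emb[symmetric] by (auto simp: Phi_spinor)
  qed simp
  then show ?thesis
    using \<sigma> by blast
qed

lemma Phi_theta_spinor:
  "Phi i (theta4 g \<star> theta2 h k) (spinor_herm i \<psi> \<xi>) =
    spinor_herm i (g ** \<psi> ** transpose h) (contragredient g ** \<xi> ** transpose k)"
  unfolding Phi_spinor rho55_theta
  by (simp add: emb_def kron_vecm blk_mult blk_transpose flip: spinor_of_emb)

lemma Phi_theta_skew:
  assumes "g \<in> SL" "h \<in> SL" "k \<in> SL" "A \<in> antisym_mats"
  shows "Phi i (theta4 g \<star> theta2 h k) (block i (skew_herm A)) =
    block i (skew_herm (contragredient g ** A ** matrix_inv g))"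
proof -
  obtain v where v: "v \<in> vecs I33" "Amat v = A"
    using Amat_surj[OF assms(4)] .
  have "contragredient g ** A ** matrix_inv g \<in> antisym_mats"
    by (rule antisym_congruence[OF assms(4)])
  then obtain w where w: "w \<in> vecs I33" "Amat w = contragredient g ** A ** matrix_inv g"
    by (rule Amat_surj)
  have "spin_vec eta (theta4 g \<star> theta2 h k) v = w"
    using v w by (intro spin_vec_theta assms) (simp_all add: Bmat_vecs_I33)
  then show ?thesis
    using Phi_block[of i "theta4 g \<star> theta2 h k" v] v w by (simp add: std_iso_I33)
qed

lemma Phi_theta_bispinor:
  assumes "g \<in> SL" "h \<in> SL" "k \<in> SL"
  shows "Phi i (theta4 g \<star> theta2 h k) (block i (bispinor_herm B)) =
    block i (bispinor_herm (contragredient h ** B ** matrix_inv k))"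
proof -
  obtain v where v: "v \<in> vecs I22" "Bmat \<mu> v = B"
    by (rule Bmat_surj)
  obtain w where w: "w \<in> vecs I22" "Bmat \<mu> w = contragredient h ** B ** matrix_inv k"
    by (rule Bmat_surj)
  have "spin_vec eta (theta4 g \<star> theta2 h k) v = w"
    using v w by (intro spin_vec_theta assms) (simp_all add: Amat_vecs_I22)
  then show ?thesis
    using Phi_block[of i "theta4 g \<star> theta2 h k" v] v w by (simp add: std_iso_I22)
qed

text \<open>An even element of signature (3,3) commutes with the vectors of signature (2,2), so
  \<open>s\<close> fixes \<open>block i B\<close> and invariance of the full norm suffices.\<close>

lemma spin33_scalar:
  assumes "s \<in> Spin33" "B \<in> J2_Hs_l"
  shows "N3 \<mu> (Phi i s \<Psi> + block i B) = N3 \<mu> (\<Psi> + block i B)"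
proof -
  have s: "s \<in> Spin55" "s \<in> even_cl I33"
    using assms(1) spin33_subset spin_subset_even by blast+
  obtain v where v: "v \<in> vecs I22" "B = std_iso \<mu> v"
    using assms(2) unfolding std_iso_image_I22[symmetric] by blast
  have "spin_vec eta s v = v"
    by (rule spin_vec_eqI[OF s(1) spin33_commutes[OF s(2) v(1)]])
  then have "Phi i s (\<Psi> + block i B) = Phi i s \<Psi> + block i B"
    by (simp add: linear_add[OF linear_Phi[OF s(1)]] v(2) Phi_block)
  then show ?thesis
    using Phi_N3[OF s(1)] by metis
qed

end

text \<open>The modules are the two eigenspaces of the grading, moved to \<open>real^4\<close> by
  forgetting the half that is zero. The volume element acts by opposite signs because the
  eigenvalues are opposite.\<close>

lemma weyl_modules_33: "\<exists>\<sigma>\<in>{1, -1}. \<exists>R R'.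
    weyl_module eta I33 \<sigma> (UNIV :: (real^4) set) R \<and> (\<forall>g\<in>SL. \<forall>v. R (theta4 g) v = g *v v) \<and>
    weyl_module eta I33 (- \<sigma>) (UNIV :: (real^4) set) R' \<and> (\<forall>g\<in>SL. \<forall>v. R' (theta4 g) v = contragredient g *v v)"
proof -
  obtain \<sigma> :: real where \<sigma>: "\<sigma> \<in> {1, -1}"
    and weyl: "\<And>\<tau>. \<tau> \<in> {1, -1} \<Longrightarrow> {w :: real^(4 + 4). omega *v w = \<tau> *\<^sub>R w} \<noteq> {0} \<Longrightarrow>
      weyl_module eta I33 (\<sigma> * \<tau>) {w. omega *v w = \<tau> *\<^sub>R w} (\<lambda>x w. R33.rho x *v w)"
    by (rule R33.weyl_module_rho) (blast intro: that)
  define upper :: "real^(4 + 4) \<Rightarrow> real^4" where "upper w = (\<chi> a. w$Inl a)" for w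
  define lower :: "real^(4 + 4) \<Rightarrow> real^4" where "lower w = (\<chi> a. w$Inr a)" for w
  have upper: "upper (join u v) = u" and lower: "lower (join u v) = v" for u v
    by (simp_all add: upper_def lower_def)
  have lin: "linear upper" "linear lower"
    by (rule linearI; simp add: upper_def lower_def vec_eq_iff)+
  have minus_vec: "(- mat 1) *v v = - v" for v :: "real^4"
    using scaleR_matrix_vector_assoc[of "-1" "mat 1" v] by simp
  have omega_join: "omega *v join u v = join u (- v)" for u v :: "real^4"
    by (simp add: omega_def blk_mult_vec minus_vec)
  have U1: "{w. omega *v w = 1 *\<^sub>R w} = range (\<lambda>u :: real^4. join u 0)" (is "?U1 = _")
  proof (intro equalityI subsetI)
    fix w assume w: "w \<in> ?U1"
    obtain u v where uv: "w = join u v" by (rule join_cases)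
    have "v = 0" using w unfolding uv by (simp add: omega_join) (simp add: vec_eq_iff)
    then show "w \<in> range (\<lambda>u. join u 0)" using uv by blast
  qed (auto simp: omega_join)
  have U2: "{w. omega *v w = -1 *\<^sub>R w} = range (\<lambda>v :: real^4. join 0 v)" (is "?U2 = _")
  proof (intro equalityI subsetI)
    fix w assume w: "w \<in> ?U2"
    obtain u v where uv: "w = join u v" by (rule join_cases)
    have "- join u v = join (- u) (- v)" by (simp add: blk_simps)
    then have "u = 0" using w unfolding uv by (simp add: omega_join) (simp add: vec_eq_iff)
    then show "w \<in> range (\<lambda>v. join 0 v)" using uv by blast
  next
    fix w :: "real^(4 + 4)"
    assume "w \<in> range (\<lambda>v :: real^4. join 0 v)"
    then obtain v :: "real^4" where "w = join 0 v" by blast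
    then show "w \<in> ?U2" by (simp add: omega_join) (simp add: blk_simps)
  qed
  define one :: "real^4" where "one = axis 1 1"
  have one: "one \<noteq> 0" by (simp add: one_def axis_eq_0_iff)
  let ?R = "\<lambda>x u. upper (R33.rho x *v join u 0)" and ?R' = "\<lambda>x v. lower (R33.rho x *v join 0 v)"
  have "?U1 \<noteq> {0}"
    using one unfolding U1 join_zero by (metis join_eq_iff rangeI singletonD)
  then have "weyl_module eta I33 \<sigma> ?U1 (\<lambda>x w. R33.rho x *v w)"
    using weyl[of 1] by simp
  then have W1: "weyl_module eta I33 \<sigma> UNIV ?R"
  proof (rule weyl_module_transport[OF _ _ lin(1)])
    show "inj_on upper ?U1" "upper ` ?U1 = UNIV"
      unfolding U1 by (auto simp: upper inj_on_def image_image)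
    show "upper (R33.rho x *v join (upper u) 0) = upper (R33.rho x *v u)" if "u \<in> ?U1" for x u
      using that unfolding U1 by (auto simp: upper)
  qed (simp add: card_I33)
  have "?U2 \<noteq> {0}"
    using one unfolding U2 join_zero by (metis join_eq_iff rangeI singletonD)
  then have "weyl_module eta I33 (- \<sigma>) ?U2 (\<lambda>x w. R33.rho x *v w)"
    using weyl[of "-1"] by simp
  then have W2: "weyl_module eta I33 (- \<sigma>) UNIV ?R'"
  proof (rule weyl_module_transport[OF _ _ lin(2)])
    show "inj_on lower ?U2" "lower ` ?U2 = UNIV"
      unfolding U2 by (auto simp: lower inj_on_def image_image)
    show "lower (R33.rho x *v join 0 (lower u)) = lower (R33.rho x *v u)" if "u \<in> ?U2" for x u
      using that unfolding U2 by (auto simp: lower)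
  qed (simp add: card_I33)
  show ?thesis
    using \<sigma> W1 W2
    by (intro bexI[of _ \<sigma>] exI[of _ ?R] exI[of _ ?R'] conjI ballI allI)
      (simp_all add: theta4(2) blk_mult_vec upper lower)
qed

lemma peirce_decompose:
  "\<exists>!t. case t of (c, \<Psi>, Y) \<Rightarrow> \<Psi> \<in> peirce \<mu> (1/2) (diag_unit i) \<and>
     Y \<in> peirce \<mu> 0 (diag_unit i) \<and> X = c *\<^sub>R diag_unit i + \<Psi> + Y" for i :: 3
proof -
  obtain c a b Y where X: "X = c *\<^sub>R diag_unit i + half i a b + block i Y"
    using herm3_decompose[of X i] by blast
  show ?thesis
  proof (rule ex1I[of _ "(c, half i a b, block i Y)"])
    show "case (c, half i a b, block i Y) of (c, \<Psi>, Y) \<Rightarrow> \<Psi> \<in> peirce \<mu> (1/2) (diag_unit i) \<and>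
      Y \<in> peirce \<mu> 0 (diag_unit i) \<and> X = c *\<^sub>R diag_unit i + \<Psi> + Y"
      unfolding peirce_half range_block[symmetric] by (auto simp: X intro: range_eqI[of _ _ "(a, b)"])
    fix t
    assume "case t of (c, \<Psi>, Y) \<Rightarrow> \<Psi> \<in> peirce \<mu> (1/2) (diag_unit i) \<and>
      Y \<in> peirce \<mu> 0 (diag_unit i) \<and> X = c *\<^sub>R diag_unit i + \<Psi> + Y"
    then obtain c' a' b' Y' where t: "t = (c', half i a' b', block i Y')"
      and "X = c' *\<^sub>R diag_unit i + half i a' b' + block i Y'"
      unfolding peirce_half range_block[symmetric] by (cases t) auto
    then show "t = (c, half i a b, block i Y)"
      using herm3_decompose_unique[of c i a b Y c' a' b' Y'] X by simp
  qed
qed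

theorem mainTheorem7:
  fixes \<mu> :: real and p :: "3 herm"
  assumes "\<mu> = 1 \<or> \<mu> = -1"
    and "primitive_idempotent \<mu> p" and "diagonal p"
  shows
    "\<exists>i. p = diag_unit i \<and>
      peirce \<mu> 1 p = range (\<lambda>c. c *\<^sub>R p) \<and>
      (\<forall>X. \<exists>!t. case t of (c, \<Psi>, Y) \<Rightarrow>
         \<Psi> \<in> peirce \<mu> (1/2) p \<and> Y \<in> peirce \<mu> 0 p \<and> X = c *\<^sub>R p + \<Psi> + Y) \<and>
      linear (block i) \<and> inj (block i) \<and> range (block i) = peirce \<mu> 0 p \<and>
      (\<forall>Y Z. block i (jordan \<mu> Y Z) = jordan \<mu> (block i Y) (block i Z)) \<and>
      (\<forall>Y. \<exists>!t. case t of (A, B) \<Rightarrow> A \<in> J2_Hs \<and> B \<in> J2_Hs_l \<and> Y = A + B) \<and>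
      (\<forall>A\<in>J2_Hs. \<forall>B\<in>J2_Hs_l. polar (N2 \<mu>) A B = 0) \<and>
      has_signature (N2 \<mu>) J2_Hs 3 3 \<and> has_signature (N2 \<mu>) J2_Hs_l 2 2 \<and>
      (\<exists>(e :: real^10 \<Rightarrow> 2 herm) (\<Phi> :: 10 clifford \<Rightarrow> 3 herm \<Rightarrow> 3 herm)
        (\<theta>4 :: real^4^4 \<Rightarrow> 10 clifford) (\<theta>2 :: real^2^2 \<Rightarrow> real^2^2 \<Rightarrow> 10 clifford)
        (FS :: real^2^4 \<Rightarrow> real^2^4 \<Rightarrow> 3 herm) (FA :: real^4^4 \<Rightarrow> 2 herm) (FB :: real^2^2 \<Rightarrow> 2 herm).
        \<comment> \<open>isometry of the standard space of signature (5,5) with \<open>J\<^sub>2\<close>, respecting the decomposition\<close>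
        linear e \<and> bij e \<and> (\<forall>v. N2 \<mu> (e v) = (\<Sum>j\<in>UNIV. eta j * (v$j)\<^sup>2)) \<and>
        e ` vecs I33 = J2_Hs \<and> e ` vecs I22 = J2_Hs_l \<and>
        \<comment> \<open>Spin(5,5) as a subgroup of \<open>E\<^sub>6\<^sub>(\<^sub>6\<^sub>)\<close>, and its action on 1, 10 and 16\<close>
        inj_on \<Phi> Spin55 \<and> \<Phi> ` Spin55 \<subseteq> E66 \<mu> \<and>
        (\<forall>s\<in>Spin55. \<forall>t\<in>Spin55. s \<star> t \<in> Spin55 \<and> \<Phi> (s \<star> t) = \<Phi> s \<circ> \<Phi> t) \<and>
        (\<forall>s\<in>Spin55. \<Phi> s p = p) \<and>
        (\<forall>s\<in>Spin55. \<forall>v. \<Phi> s (block i (e v)) = block i (e (spin_vec eta s v))) \<and>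
        (\<exists>\<sigma>\<in>{1, -1}. \<exists>R. weyl_module eta UNIV \<sigma> (peirce \<mu> (1/2) p) R \<and>
           (\<forall>s\<in>Spin55. \<forall>\<Psi>\<in>peirce \<mu> (1/2) p. \<Phi> s \<Psi> = R s \<Psi>)) \<and>
        \<comment> \<open>Spin(3,3) and Spin(2,2) in Spin(5,5); the product map has kernel \<open>{\<plusminus>(1, 1)}\<close>\<close>
        Spin33 \<subseteq> Spin55 \<and> Spin22 \<subseteq> Spin55 \<and>
        (\<forall>s\<in>Spin33. \<forall>t\<in>Spin22. s \<star> t = t \<star> s \<and>
           (s \<star> t = cl_one \<longleftrightarrow> s = cl_one \<and> t = cl_one \<or> s = - cl_one \<and> t = - cl_one)) \<and>
        \<comment> \<open>Spin(3,3) is SL(4), Spin(2,2) is SL(2) x SL(2)\<close>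
        bij_betw \<theta>4 SL Spin33 \<and> (\<forall>g\<in>SL. \<forall>g'\<in>SL. \<theta>4 (g ** g') = \<theta>4 g \<star> \<theta>4 g') \<and>
        bij_betw (\<lambda>(h, k). \<theta>2 h k) (SL \<times> SL) Spin22 \<and>
        (\<forall>h\<in>SL. \<forall>k\<in>SL. \<forall>h'\<in>SL. \<forall>k'\<in>SL. \<theta>2 (h ** h') (k ** k') = \<theta>2 h k \<star> \<theta>2 h' k') \<and>
        \<comment> \<open>identifications: 16 is the sum of (4,2,1) and (4*,1,2), and 10 of (6,1,1) and (1,2,2)\<close>
        linear (\<lambda>(\<psi>, \<xi>). FS \<psi> \<xi>) \<and> inj (\<lambda>(\<psi>, \<xi>). FS \<psi> \<xi>) \<and>
        range (\<lambda>(\<psi>, \<xi>). FS \<psi> \<xi>) = peirce \<mu> (1/2) p \<and>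
        linear FA \<and> bij_betw FA antisym_mats J2_Hs \<and>
        linear FB \<and> bij_betw FB UNIV J2_Hs_l \<and>
        (\<forall>g\<in>SL. \<forall>h\<in>SL. \<forall>k\<in>SL.
           (\<forall>\<psi> \<xi>. \<Phi> (\<theta>4 g \<star> \<theta>2 h k) (FS \<psi> \<xi>) =
              FS (g ** \<psi> ** transpose h) (contragredient g ** \<xi> ** transpose k)) \<and>
           (\<forall>A\<in>antisym_mats. \<Phi> (\<theta>4 g \<star> \<theta>2 h k) (block i (FA A)) =
              block i (FA (contragredient g ** A ** matrix_inv g))) \<and>
           (\<forall>B. \<Phi> (\<theta>4 g \<star> \<theta>2 h k) (block i (FB B)) =
              block i (FB (contragredient h ** B ** matrix_inv k)))) \<and>
        \<comment> \<open>the cubic norm\<close>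
        (\<exists>c1 c2 c3 :: real. c1 \<noteq> 0 \<and> c2 \<noteq> 0 \<and> c3 \<noteq> 0 \<and>
          (\<forall>l0 \<psi> \<xi>. \<forall>A\<in>antisym_mats. \<forall>B.
             N3 \<mu> (l0 *\<^sub>R p + FS \<psi> \<xi> + block i (FA A) + block i (FB B)) =
               l0 * (N2 \<mu> (FA A) + N2 \<mu> (FB B)) +
               c1 * A_psi_psi A \<psi> + c2 * A_chi_chi A \<xi> + c3 * B_psi_chi B \<psi> \<xi>)) \<and>
        \<comment> \<open>the B-dependent spinor term is a Spin(3,3) scalar pairing opposite Weyl modules\<close>
        (\<forall>s\<in>Spin33. \<forall>\<Psi>\<in>peirce \<mu> (1/2) p. \<forall>B\<in>J2_Hs_l.
           N3 \<mu> (\<Phi> s \<Psi> + block i B) = N3 \<mu> (\<Psi> + block i B)) \<and>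
        (\<forall>g\<in>SL. \<forall>B \<psi> \<xi>. B_psi_chi B (g ** \<psi>) (contragredient g ** \<xi>) = B_psi_chi B \<psi> \<xi>) \<and>
        (\<exists>\<sigma>\<in>{1, -1}. \<exists>R R'.
           weyl_module eta I33 \<sigma> (UNIV :: (real^4) set) R \<and>
           (\<forall>g\<in>SL. \<forall>v. R (\<theta>4 g) v = g *v v) \<and>
           weyl_module eta I33 (-\<sigma>) (UNIV :: (real^4) set) R' \<and>
           (\<forall>g\<in>SL. \<forall>v. R' (\<theta>4 g) v = contragredient g *v v)))"
proof -
  obtain i where p: "p = diag_unit i"
    using primitive_diagonal_idempotent[OF assms(2,3)] .
  interpret split_oct \<mu>
    by unfold_locales (rule assms(1))
  show ?thesis
    unfolding p
  proof (intro exI[of _ i] conjI exI[of _ "std_iso \<mu>"] exI[of _ "Phi i"] exI[of _ theta4] exI[of _ theta2]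
      exI[of _ "spinor_herm i"] exI[of _ skew_herm] exI[of _ bispinor_herm])
    show "\<exists>c1 c2 c3 :: real. c1 \<noteq> 0 \<and> c2 \<noteq> 0 \<and> c3 \<noteq> 0 \<and>
      (\<forall>l0 \<psi> \<xi>. \<forall>A\<in>antisym_mats. \<forall>B.
        N3 \<mu> (l0 *\<^sub>R diag_unit i + spinor_herm i \<psi> \<xi> + block i (skew_herm A) + block i (bispinor_herm B)) =
          l0 * (N2 \<mu> (skew_herm A) + N2 \<mu> (bispinor_herm B)) +
          c1 * A_psi_psi A \<psi> + c2 * A_chi_chi A \<xi> + c3 * B_psi_chi B \<psi> \<xi>)"
    \<comment> \<open>The coefficients of \<open>N3_tensor\<close>; the last two are nonzero because
      \<mu> is a sign.\<close>
    proof (rule exI[of _ "1/2"], rule exI[of _ "- \<mu> / 2"], rule exI[of _ "- \<mu>"], intro conjI allI ballI)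
      show "N3 \<mu> (c *\<^sub>R diag_unit i + spinor_herm i \<psi> \<xi> + block i (skew_herm A) + block i (bispinor_herm B)) =
          c * (N2 \<mu> (skew_herm A) + N2 \<mu> (bispinor_herm B)) +
          1 / 2 * A_psi_psi A \<psi> + - \<mu> / 2 * A_chi_chi A \<xi> + - \<mu> * B_psi_chi B \<psi> \<xi>"
        if "A \<in> antisym_mats" for c \<psi> \<xi> A B
        using N3_tensor[OF that, of \<mu> c i \<psi> \<xi> B] by (simp add: N2_tensor linear_add[OF linear_block] add.assoc)
    qed (use mu in auto)
    show "\<exists>\<sigma>\<in>{1, -1}. \<exists>R. weyl_module eta UNIV \<sigma> (peirce \<mu> (1/2) (diag_unit i)) R \<and>
      (\<forall>s\<in>Spin55. \<forall>\<Psi>\<in>peirce \<mu> (1/2) (diag_unit i). Phi i s \<Psi> = R s \<Psi>)"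
      using weyl_module_Phi[of i] by blast
    show "\<forall>s\<in>Spin55. \<forall>t\<in>Spin55. s \<star> t \<in> Spin55 \<and> Phi i (s \<star> t) = Phi i s \<circ> Phi i t"
      using spin55_mult Phi_mult by blast
    show "\<forall>s\<in>Spin33. \<forall>t\<in>Spin22. s \<star> t = t \<star> s \<and>
      (s \<star> t = cl_one \<longleftrightarrow> s = cl_one \<and> t = cl_one \<or> s = - cl_one \<and> t = - cl_one)"
      using spin33_spin22_commute spin33_spin22_kernel by blast
    show "\<forall>g\<in>SL. \<forall>h\<in>SL. \<forall>k\<in>SL.
      (\<forall>\<psi> \<xi>. Phi i (theta4 g \<star> theta2 h k) (spinor_herm i \<psi> \<xi>) =
         spinor_herm i (g ** \<psi> ** transpose h) (contragredient g ** \<xi> ** transpose k)) \<and>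
      (\<forall>A\<in>antisym_mats. Phi i (theta4 g \<star> theta2 h k) (block i (skew_herm A)) =
         block i (skew_herm (contragredient g ** A ** matrix_inv g))) \<and>
      (\<forall>B. Phi i (theta4 g \<star> theta2 h k) (block i (bispinor_herm B)) =
         block i (bispinor_herm (contragredient h ** B ** matrix_inv k)))"
      by (intro ballI conjI allI Phi_theta_spinor Phi_theta_skew Phi_theta_bispinor)
    show "\<exists>\<sigma>\<in>{1, -1}. \<exists>R R'.
      weyl_module eta I33 \<sigma> (UNIV :: (real^4) set) R \<and> (\<forall>g\<in>SL. \<forall>v. R (theta4 g) v = g *v v) \<and>
      weyl_module eta I33 (- \<sigma>) (UNIV :: (real^4) set) R' \<and> (\<forall>g\<in>SL. \<forall>v. R' (theta4 g) v = contragredient g *v v)"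
      by (rule weyl_modules_33)
  qed (use bij_theta2 in \<open>auto simp: peirce_one peirce_decompose linear_block inj_block range_block block_jordan
      J2_decompose J2_orthogonal signature_J2_Hs signature_J2_Hs_l linear_std_iso bij_std_iso N2_std_iso
      std_iso_image_I33 std_iso_image_I22 inj_on_Phi Phi_E66 Phi_diag_unit Phi_block
      spin33_subset[THEN subsetD] spin22_subset[THEN subsetD] bij_theta4 theta4_mult theta2_mult
      linear_spinor_herm inj_spinor_herm range_spinor_herm linear_skew_herm bij_skew_herm
      linear_bispinor_herm bij_bispinor_herm spin33_scalar B_psi_chi_invariant\<close>)
qed

end
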